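(* Let $\alpha\in(0,1]$, $n\in\mathbb{N}$, $\rho_0\in\mathbb{R}$, and let $f:\mathbb{R}_{>0}\times\mathbb{C}^n\to\mathbb{C}^n$ be continuous with $|f(t,y_1)-f(t,y_2)|\leq c|y_1-y_2|$ for some $c\geq0$ and all $y_1,y_2\in\mathbb{C}^n$, $t>0$, and with $(t\mapsto f(t,0))\in L^2_{\rho_0}(\mathbb{R}_{>0};\mathbb{C}^n)$. Define $\tilde f(t,y):=f(t,y)$ for $t>0$ and $\tilde f(t,y):=0$ for $t\leq0$. Let $y_0\in\mathbb{C}^n$. Then there is $\rho_1>0$ such that for all $\rho\geq\rho_1$ there exists a unique $y\in L^2_\rho(\mathbb{R};\mathbb{C}^n)$ with $y-y_0\chi_{\mathbb{R}_{>0}}\in H^\alpha_\rho(\mathbb{R};\mathbb{C}^n)$ satisfying \[\partial^\alpha_{0,\rho}(y-y_0\chi_{\mathbb{R}_{>0}})=\tilde f(\cdot,y(\cdot)).\] Moreover, $\operatorname{spt}y\subseteq\mathbb{R}_{\geq0}$.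
   Context: $\chi_{\mathbb{R}_{>0}}$ is the indicator function of $(0,\infty)$. For $\rho\in\mathbb{R}$, $L^2_\rho(\mathbb{R};\mathbb{C}^n)$ is the space of measurable $g$ with $\int|g(t)|^2e^{-2\rho t}dt<\infty$ (similarly on $\mathbb{R}_{>0}$); $\mathcal{L}_\rho g(\xi)=(2\pi)^{-1/2}\int e^{-(i\xi+\rho)t}g(t)\,dt$ (extended to a unitary map $L^2_\rho(\mathbb{R};\mathbb{C}^n)\to L^2(\mathbb{R};\mathbb{C}^n)$). For $\rho>0$, $\gamma\geq0$: $H^\gamma_\rho(\mathbb{R};\mathbb{C}^n):=\{u\in L^2_\rho:(\xi\mapsto(i\xi+\rho)^\gamma\mathcal{L}_\rho u(\xi))\in L^2\}$ (principal branch) with norm $\|(i\xi+\rho)^\gamma\mathcal{L}_\rho u\|_{L^2}$, and $\partial^\gamma_{0,\rho}u:=\mathcal{L}_\rho^{*}\big((i\xi+\rho)^\gamma\mathcal{L}_\rho u\big)$. Support is the usual (essential) support of an $L^2_\rho$ function. *)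

theory Defs
  imports "HOL-Analysis.Analysis"
begin

definition cscale :: "complex \<Rightarrow> complex ^ 'n \<Rightarrow> complex ^ 'n" where
  "cscale c v = (\<chi> i. c * v $ i)"

definition L2w :: "real \<Rightarrow> (real \<Rightarrow> complex ^ 'n) \<Rightarrow> bool" where
  "L2w \<rho> g \<longleftrightarrow> g \<in> borel_measurable lebesgue \<and>
     integrable lebesgue (\<lambda>t. (norm (g t))\<^sup>2 * exp (- 2 * \<rho> * t))"

definition trunc_laplace :: "real \<Rightarrow> (real \<Rightarrow> complex ^ 'n) \<Rightarrow> real \<Rightarrow> real \<Rightarrow> complex ^ 'n" where
  "trunc_laplace \<rho> g R \<xi> =
     (LINT t:{-R..R}|lebesgue. cscale (exp (- (Complex \<rho> \<xi> * complex_of_real t)) / complex_of_real (sqrt (2 * pi))) (g t))"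

text \<open>\<open>laplace_rel \<rho> g G\<close>: G is (a representative of) \<open>\<L>\<^sub>\<rho> g\<close>, the unitary extension,
  i.e. the L^2-limit of the truncated transforms (Plancherel).\<close>
definition laplace_rel :: "real \<Rightarrow> (real \<Rightarrow> complex ^ 'n) \<Rightarrow> (real \<Rightarrow> complex ^ 'n) \<Rightarrow> bool" where
  "laplace_rel \<rho> g G \<longleftrightarrow> L2w 0 G \<and>
     ((\<lambda>R. LINT \<xi>|lebesgue. (norm (G \<xi> - trunc_laplace \<rho> g R \<xi>))\<^sup>2) \<longlongrightarrow> 0) at_top"

definition trunc_laplace_inv :: "real \<Rightarrow> (real \<Rightarrow> complex ^ 'n) \<Rightarrow> real \<Rightarrow> real \<Rightarrow> complex ^ 'n" where
  "trunc_laplace_inv \<rho> h R t =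
     (LINT \<xi>:{-R..R}|lebesgue. cscale (exp (Complex \<rho> \<xi> * complex_of_real t) / complex_of_real (sqrt (2 * pi))) (h \<xi>))"

text \<open>\<open>laplace_inv_rel \<rho> h w\<close>: w is (a representative of) \<open>\<L>\<^sub>\<rho>\<^sup>* h\<close>, limit in \<open>L\<^sup>2\<^sub>\<rho>\<close>.\<close>
definition laplace_inv_rel :: "real \<Rightarrow> (real \<Rightarrow> complex ^ 'n) \<Rightarrow> (real \<Rightarrow> complex ^ 'n) \<Rightarrow> bool" where
  "laplace_inv_rel \<rho> h w \<longleftrightarrow> L2w \<rho> w \<and>
     ((\<lambda>R. LINT t|lebesgue. (norm (w t - trunc_laplace_inv \<rho> h R t))\<^sup>2 * exp (- 2 * \<rho> * t)) \<longlongrightarrow> 0) at_top"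

definition Hsp :: "real \<Rightarrow> real \<Rightarrow> (real \<Rightarrow> complex ^ 'n) \<Rightarrow> bool" where
  "Hsp \<rho> \<gamma> u \<longleftrightarrow> L2w \<rho> u \<and>
     (\<exists>G. laplace_rel \<rho> u G \<and> L2w 0 (\<lambda>\<xi>. cscale (Complex \<rho> \<xi> powr complex_of_real \<gamma>) (G \<xi>)))"

definition frac_deriv_rel :: "real \<Rightarrow> real \<Rightarrow> (real \<Rightarrow> complex ^ 'n) \<Rightarrow> (real \<Rightarrow> complex ^ 'n) \<Rightarrow> bool" where
  "frac_deriv_rel \<rho> \<gamma> u w \<longleftrightarrow>
     (\<exists>G. laplace_rel \<rho> u G \<and>
        laplace_inv_rel \<rho> (\<lambda>\<xi>. cscale (Complex \<rho> \<xi> powr complex_of_real \<gamma>) (G \<xi>)) w)"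

definition ftilde :: "(real \<Rightarrow> complex ^ 'n \<Rightarrow> complex ^ 'n) \<Rightarrow> real \<Rightarrow> complex ^ 'n \<Rightarrow> complex ^ 'n" where
  "ftilde f t v = (if 0 < t then f t v else 0)"

definition frac_ivp_solution ::
  "real \<Rightarrow> (real \<Rightarrow> complex ^ 'n \<Rightarrow> complex ^ 'n) \<Rightarrow> complex ^ 'n \<Rightarrow> real \<Rightarrow> (real \<Rightarrow> complex ^ 'n) \<Rightarrow> bool" where
  "frac_ivp_solution \<alpha> f y0 \<rho> y \<longleftrightarrow>
     L2w \<rho> y \<and>
     Hsp \<rho> \<alpha> (\<lambda>t. y t - indicator {0<..} t *\<^sub>R y0) \<and>
     frac_deriv_rel \<rho> \<alpha> (\<lambda>t. y t - indicator {0<..} t *\<^sub>R y0) (\<lambda>t. ftilde f t (y t))"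

end

theory Submission
  imports Defs "HOL-Probability.Probability" "HOL-Real_Asymp.Real_Asymp"
begin

text \<open>Multiplying by \<open>e\<^sup>-\<^sup>\<rho>\<^sup>t\<close> turns \<open>L\<^sup>2\<^sub>\<rho>\<close> into \<open>L\<^sup>2\<close> and \<open>\<L>\<^sub>\<rho>\<close> into the Fourier transform, which is an
  \<open>L\<^sup>2\<close> isometry by Plancherel's theorem. The symbol \<open>(\<rho> + i\<xi>)\<^sup>-\<^sup>\<alpha>\<close> is the transform of the nonnegative
  kernel \<open>t\<^sup>\<alpha>\<^sup>-\<^sup>1 e\<^sup>-\<^sup>\<rho>\<^sup>t / \<Gamma>(\<alpha>)\<close> on \<open>t > 0\<close>, whose integral is \<open>\<rho>\<^sup>-\<^sup>\<alpha>\<close>. Hence the equation is equivalent to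
  a Volterra equation \<open>Y = Y\<^sub>0 + \<kappa> * N(Y)\<close>. For large \<open>\<rho>\<close> one has \<open>c \<rho>\<^sup>-\<^sup>\<alpha> < 1\<close>, so Picard iteration
  converges by Young's inequality; the solution vanishes on the negative half-line because \<open>\<kappa>\<close> and
  \<open>N(Y)\<close> do.\<close>

section \<open>Square-integrable functions\<close>

text \<open>Inverting the multiplier in frequency space alone would leave the support open: that
  (i\<xi> + \<rho>)^(-\<alpha>) preserves vanishing on the negative half-line is a fact of
  Paley-Wiener type. Realising it as convolution with an explicit one-sided kernel makes causality
  visible in the integrand; the price is computing the transform of that kernel along the whole line
  Re z = \<rho>. Uniqueness does stay in frequency space: a competing solution is only Lebesgue
  measurable and known through its transforms, so isometry and the bound on the inverse multiplier
  are applied to it directly. Of the equivalence with the Volterra equation, just the passage from a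
  Volterra solution to a solution of the differential equation is carried out. Two features of the
  definitions shape the rest. The transforms are relations given by L2 limits of truncated
  integrals, so facts are proved for truncations or integrable functions and then carried to the
  limit. And everything lives on the completed measure \<open>lebesgue\<close>, whereas Fubini is
  applied on products of \<open>lborel\<close>, so Borel representatives mediate between the
  two.\<close>

definition sq :: "'a measure \<Rightarrow> ('a \<Rightarrow> 'b::euclidean_space) \<Rightarrow> bool" where
  "sq M f \<longleftrightarrow> f \<in> borel_measurable M \<and> integrable M (\<lambda>x. (norm (f x))\<^sup>2)"

text \<open>Functions are not identified almost everywhere, so this is a seminorm. The integral of a
  non-integrable function is 0 by convention, hence the value means something only together with
  \<open>sq\<close>, which therefore accompanies it in nearly all estimates.\<close>

definition l2 :: "'a measure \<Rightarrow> ('a \<Rightarrow> 'b::euclidean_space) \<Rightarrow> real" where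
  "l2 M f = sqrt (LINT x|M. (norm (f x))\<^sup>2)"

lemma sqD_measurable [measurable_dest]: "sq M f \<Longrightarrow> f \<in> borel_measurable M"
  and sqD_integrable: "sq M f \<Longrightarrow> integrable M (\<lambda>x. (norm (f x))\<^sup>2)"
  by (auto simp: sq_def)

lemma l2_nonneg [simp]: "0 \<le> l2 M f"
  by (simp add: l2_def)

lemma l2_power2: "(l2 M f)\<^sup>2 = (LINT x|M. (norm (f x))\<^sup>2)"
  by (simp add: l2_def)

text \<open>The comparison principle behind scalings, truncations, Lipschitz nonlinearities and
  bounded Fourier multipliers alike.\<close>

lemma sq_bound:
  fixes f :: "'a \<Rightarrow> 'b::euclidean_space" and g :: "'a \<Rightarrow> 'c::euclidean_space"
  assumes g: "sq M g" and f: "f \<in> borel_measurable M"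
    and le: "AE x in M. norm (f x) \<le> C * norm (g x)"
  shows "sq M f" "0 \<le> C \<Longrightarrow> l2 M f \<le> C * l2 M g"
proof -
  note [measurable] = f
  have 1: "integrable M (\<lambda>x. C\<^sup>2 * (norm (g x))\<^sup>2)"
    using g by (simp add: sq_def)
  have 2: "AE x in M. (norm (f x))\<^sup>2 \<le> C\<^sup>2 * (norm (g x))\<^sup>2"
    using le
  proof eventually_elim
    case (elim x)
    then have "(norm (f x))\<^sup>2 \<le> (C * norm (g x))\<^sup>2" by (intro power_mono) auto
    then show ?case by (simp add: power_mult_distrib)
  qed
  have "integrable M (\<lambda>x. (norm (f x))\<^sup>2)"
    by (rule Bochner_Integration.integrable_bound[OF 1]) (use 2 in auto)
  then show sf: "sq M f" using f by (simp add: sq_def)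
  assume C: "0 \<le> C"
  have "(l2 M f)\<^sup>2 \<le> (LINT x|M. C\<^sup>2 * (norm (g x))\<^sup>2)"
    unfolding l2_power2 by (intro integral_mono_AE sqD_integrable[OF sf] 1 2)
  also have "\<dots> = (C * l2 M g)\<^sup>2"
    by (simp add: power_mult_distrib l2_power2)
  finally show "l2 M f \<le> C * l2 M g"
    by (rule power2_le_imp_le) (use C in auto)
qed

lemma l2_cong_AE:
  assumes "f \<in> borel_measurable M" "g \<in> borel_measurable M" "AE x in M. f x = g x"
  shows "l2 M f = l2 M g"
  unfolding l2_def
  by (intro arg_cong[where f=sqrt] integral_cong_AE) (use assms in auto)

lemma sq_cong_AE:
  assumes "sq M f" "g \<in> borel_measurable M" "AE x in M. f x = g x"
  shows "sq M g"
  by (rule sq_bound[where C=1 and g=f]) (use assms in auto)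

lemma sq_zero [simp]: "sq M (\<lambda>x. 0)"
  by (simp add: sq_def)

lemma sq_scaleR: "sq M f \<Longrightarrow> sq M (\<lambda>x. c *\<^sub>R f x)"
  by (rule sq_bound[where C="\<bar>c\<bar>" and g=f]) auto

lemma sq_uminus: "sq M f \<Longrightarrow> sq M (\<lambda>x. - f x)"
  using sq_scaleR[of M f "-1"] by simp

lemma l2_scaleR: "l2 M (\<lambda>x. c *\<^sub>R f x) = \<bar>c\<bar> * l2 M f"
  by (simp add: l2_def power_mult_distrib real_sqrt_mult)

lemma l2_uminus: "l2 M (\<lambda>x. - f x) = l2 M f"
  by (simp add: l2_def)

lemma l2_minus_commute: "l2 M (\<lambda>x. f x - g x) = l2 M (\<lambda>x. g x - f x)"
  by (simp add: l2_def norm_minus_commute)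

lemma sq_add:
  assumes f: "sq M f" and g: "sq M g"
  shows "sq M (\<lambda>x. f x + g x)"
proof -
  have "integrable M (\<lambda>x. 2 * (norm (f x))\<^sup>2 + 2 * (norm (g x))\<^sup>2)"
    using assms by (simp add: sq_def)
  then have "integrable M (\<lambda>x. (norm (f x + g x))\<^sup>2)"
  proof (rule Bochner_Integration.integrable_bound)
    have "(norm (f x + g x))\<^sup>2 \<le> 2 * (norm (f x))\<^sup>2 + 2 * (norm (g x))\<^sup>2" for x
    proof -
      have "(norm (f x + g x))\<^sup>2 \<le> (norm (f x) + norm (g x))\<^sup>2"
        by (intro power_mono norm_triangle_ineq) auto
      also have "\<dots> \<le> 2 * (norm (f x))\<^sup>2 + 2 * (norm (g x))\<^sup>2"
        using sum_squares_bound[of "norm (f x)" "norm (g x)"] by (simp add: power2_sum)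
      finally show ?thesis .
    qed
    then show "AE x in M. norm ((norm (f x + g x))\<^sup>2) \<le> norm (2 * (norm (f x))\<^sup>2 + 2 * (norm (g x))\<^sup>2)"
      by (auto intro: AE_I2)
  qed (use assms in measurable)
  then show ?thesis using assms by (auto simp: sq_def)
qed

lemma sq_diff: "sq M f \<Longrightarrow> sq M g \<Longrightarrow> sq M (\<lambda>x. f x - g x)"
  using sq_add[of M f "\<lambda>x. - g x"] by (simp add: sq_uminus)

lemma sq_norm: "sq M f \<Longrightarrow> sq M (\<lambda>x. norm (f x))"
  by (rule sq_bound[where C=1 and g=f]) (auto intro: borel_measurable_norm sqD_measurable)

lemma l2_norm: "l2 M (\<lambda>x. norm (f x)) = l2 M f"
  by (simp add: l2_def)

lemma integrable_norm_mult:
  assumes f: "sq M f" and g: "sq M g"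
  shows "integrable M (\<lambda>x. norm (f x) * norm (g x))"
proof (rule Bochner_Integration.integrable_bound)
  show "integrable M (\<lambda>x. (norm (f x))\<^sup>2 + (norm (g x))\<^sup>2)"
    using assms by (simp add: sq_def)
  have "norm (f x) * norm (g x) \<le> (norm (f x))\<^sup>2 + (norm (g x))\<^sup>2" for x
    using sum_squares_bound[of "norm (f x)" "norm (g x)"]
      mult_nonneg_nonneg[of "norm (f x)" "norm (g x)"] norm_ge_zero[of "f x"] norm_ge_zero[of "g x"]
    by linarith
  then show "AE x in M. norm (norm (f x) * norm (g x)) \<le> norm ((norm (f x))\<^sup>2 + (norm (g x))\<^sup>2)"
    by (auto intro: AE_I2)
qed (use assms in measurable)

lemma integrable_inner_sq:
  assumes f: "sq M f" and g: "sq M g"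
  shows "integrable M (\<lambda>x. f x \<bullet> g x)"
  by (rule Bochner_Integration.integrable_bound[OF integrable_norm_mult[OF assms]])
    (use assms in \<open>auto simp: Cauchy_Schwarz_ineq2 intro!: borel_measurable_inner\<close>)

text \<open>The inner product is the real one, which on \<open>complex ^ 'n\<close> is the real part
  of the Hermitian product. This expansion of the square yields Cauchy-Schwarz, the triangle
  inequality and, later, Fourier inversion.\<close>

lemma l2_diff_power2:
  assumes f: "sq M f" and g: "sq M g"
  shows "(l2 M (\<lambda>x. f x - g x))\<^sup>2 = (l2 M f)\<^sup>2 - 2 * (LINT x|M. f x \<bullet> g x) + (l2 M g)\<^sup>2"
proof -
  have "(norm (f x - g x))\<^sup>2 = (norm (f x))\<^sup>2 - 2 * (f x \<bullet> g x) + (norm (g x))\<^sup>2" for x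
    by (simp add: power2_norm_eq_inner inner_diff inner_commute)
  then show ?thesis
    using assms by (simp add: l2_power2 sqD_integrable integrable_inner_sq)
qed

lemma l2_eq_0_iff:
  assumes "sq M f"
  shows "l2 M f = 0 \<longleftrightarrow> (AE x in M. f x = 0)"
proof -
  have "l2 M f = 0 \<longleftrightarrow> (LINT x|M. (norm (f x))\<^sup>2) = 0"
    by (simp add: l2_def)
  also have "\<dots> \<longleftrightarrow> (AE x in M. (norm (f x))\<^sup>2 = 0)"
    by (intro integral_nonneg_eq_0_iff_AE sqD_integrable assms) simp
  finally show ?thesis by simp
qed

text \<open>With a and b the norms of f and g, expanding the nonnegative square of the norm of b|f|
  - a|g| gives the claim multiplied by 2ab. If ab = 0 one of the functions vanishes almost
  everywhere, and so does the integrand.\<close>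

lemma Cauchy_Schwarz_norm:
  assumes f: "sq M f" and g: "sq M g"
  shows "(LINT x|M. norm (f x) * norm (g x)) \<le> l2 M f * l2 M g"
proof -
  define a b where "a = l2 M f" and "b = l2 M g"
  have *: "2 * a * b * (LINT x|M. norm (f x) * norm (g x)) \<le> 2 * a * b * (a * b)"
  proof -
    let ?F = "\<lambda>x. b *\<^sub>R norm (f x)" and ?G = "\<lambda>x. a *\<^sub>R norm (g x)"
    have "0 \<le> (l2 M (\<lambda>x. ?F x - ?G x))\<^sup>2" by simp
    also have "\<dots> = (l2 M ?F)\<^sup>2 - 2 * (LINT x|M. ?F x \<bullet> ?G x) + (l2 M ?G)\<^sup>2"
      by (intro l2_diff_power2 sq_scaleR sq_norm assms)
    also have "l2 M ?F = a * b" by (subst l2_scaleR) (simp add: l2_norm a_def b_def)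
    also have "l2 M ?G = a * b" by (subst l2_scaleR) (simp add: l2_norm a_def b_def)
    also have "(LINT x|M. ?F x \<bullet> ?G x) = a * b * (LINT x|M. norm (f x) * norm (g x))"
      by (simp add: mult_ac flip: integral_mult_right_zero)
    finally show ?thesis by (simp add: power2_eq_square algebra_simps)
  qed
  show ?thesis
  proof (cases "a = 0 \<or> b = 0")
    case False
    then have "0 < a * b" using l2_nonneg by (simp add: a_def b_def less_le)
    then have "(LINT x|M. norm (f x) * norm (g x)) \<le> a * b"
      using * mult_le_cancel_left_pos[of "2 * a * b"] by (simp add: mult.assoc)
    then show ?thesis by (simp add: a_def b_def)
  next
    case True
    have "AE x in M. norm (f x) * norm (g x) = 0"
      using True l2_eq_0_iff[OF f] l2_eq_0_iff[OF g] by (auto simp: a_def b_def elim!: eventually_mono)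
    then have "(LINT x|M. norm (f x) * norm (g x)) = 0"
      by (rule integral_eq_zero_AE)
    with True show ?thesis by (auto simp: a_def b_def)
  qed
qed

lemma abs_integral_inner_le:
  assumes f: "sq M f" and g: "sq M g"
  shows "\<bar>LINT x|M. f x \<bullet> g x\<bar> \<le> l2 M f * l2 M g"
proof -
  have "\<bar>LINT x|M. f x \<bullet> g x\<bar> \<le> (LINT x|M. \<bar>f x \<bullet> g x\<bar>)"
    by (rule integral_abs_bound)
  also have "\<dots> \<le> (LINT x|M. norm (f x) * norm (g x))"
    by (intro integral_mono integrable_abs integrable_inner_sq integrable_norm_mult assms)
      (rule Cauchy_Schwarz_ineq2)
  also have "\<dots> \<le> l2 M f * l2 M g" by (rule Cauchy_Schwarz_norm[OF assms])
  finally show ?thesis .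
qed

lemma l2_diff_triangle:
  assumes f: "sq M f" and g: "sq M g"
  shows "l2 M (\<lambda>x. f x - g x) \<le> l2 M f + l2 M g"
proof (rule power2_le_imp_le)
  show "(l2 M (\<lambda>x. f x - g x))\<^sup>2 \<le> (l2 M f + l2 M g)\<^sup>2"
    using l2_diff_power2[OF assms] abs_integral_inner_le[OF assms] by (simp add: power2_sum abs_le_iff)
qed simp

lemma l2_add_triangle:
  assumes f: "sq M f" and g: "sq M g"
  shows "l2 M (\<lambda>x. f x + g x) \<le> l2 M f + l2 M g"
  using l2_diff_triangle[OF f sq_uminus[OF g]] by (simp only: diff_minus_eq_add l2_uminus)

lemma l2_triangle:
  assumes "sq M f" "sq M g" "sq M h"
  shows "l2 M (\<lambda>x. f x - h x) \<le> l2 M (\<lambda>x. f x - g x) + l2 M (\<lambda>x. g x - h x)"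
  using l2_add_triangle[OF sq_diff[OF assms(1,2)] sq_diff[OF assms(2,3)]] by (simp only: diff_add_eq_diff_diff_swap diff_add_cancel add_diff_eq)

lemma l2_abs_diff_le:
  assumes "sq M f" "sq M g"
  shows "\<bar>l2 M f - l2 M g\<bar> \<le> l2 M (\<lambda>x. f x - g x)"
  using l2_triangle[of M f g "\<lambda>x. 0"] l2_triangle[of M g f "\<lambda>x. 0"] assms
  by (simp add: l2_minus_commute[of M g f])

lemma l2_power2_nn:
  assumes "sq M f"
  shows "ennreal ((l2 M f)\<^sup>2) = (\<integral>\<^sup>+x. ennreal ((norm (f x))\<^sup>2) \<partial>M)"
  by (simp add: l2_power2 nn_integral_eq_integral sqD_integrable[OF assms])

text \<open>Fatou's lemma bounds nonnegative integrals without presupposing integrability; this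
  turns such a bound back into square-integrability with the same constant.\<close>

lemma sqI_nn:
  assumes "f \<in> borel_measurable M" "(\<integral>\<^sup>+x. ennreal ((norm (f x))\<^sup>2) \<partial>M) \<le> ennreal (C\<^sup>2)" "0 \<le> C"
  shows "sq M f" "l2 M f \<le> C"
proof -
  have "integrable M (\<lambda>x. (norm (f x))\<^sup>2)"
  proof (rule integrableI_bounded)
    show "(\<integral>\<^sup>+x. ennreal (norm ((norm (f x))\<^sup>2)) \<partial>M) < \<infinity>"
      by (rule le_less_trans[OF _ ennreal_less_top[of "C\<^sup>2"], unfolded infinity_ennreal_def[symmetric]])
        (use assms(2) in simp)
  qed (use assms(1) in measurable)
  then show s: "sq M f" using assms by (simp add: sq_def)
  have "(l2 M f)\<^sup>2 \<le> C\<^sup>2"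
    using l2_power2_nn[OF s] assms(2) by (simp flip: ennreal_le_iff[of "C\<^sup>2"])
  then show "l2 M f \<le> C" using assms(3) by (rule power2_le_imp_le)
qed

lemma l2_sum_le:
  fixes n :: nat
  assumes "\<And>k. k < n \<Longrightarrow> sq M (f k)"
  shows "sq M (\<lambda>x. \<Sum>k<n. f k x) \<and> l2 M (\<lambda>x. \<Sum>k<n. f k x) \<le> (\<Sum>k<n. l2 M (f k))"
  using assms
proof (induction n)
  case (Suc n)
  then have "l2 M (\<lambda>x. (\<Sum>k<n. f k x) + f n x) \<le> l2 M (\<lambda>x. \<Sum>k<n. f k x) + l2 M (f n)"
    by (intro l2_add_triangle) auto
  with Suc show ?case by (auto intro!: sq_add)
qed (simp add: l2_def)

text \<open>The increments are summed in norm first, so that monotone convergence yields an almost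
  everywhere convergent series; Fatou's lemma then bounds the tails.\<close>
lemma l2_complete:
  fixes F :: "nat \<Rightarrow> 'a \<Rightarrow> 'b::euclidean_space"
  assumes F: "\<And>n. sq M (F n)"
    and sm: "summable (\<lambda>k. l2 M (\<lambda>x. F (Suc k) x - F k x))"
  obtains f where "sq M f" "(\<lambda>n. l2 M (\<lambda>x. F n x - f x)) \<longlonglongrightarrow> 0" "AE x in M. (\<lambda>n. F n x) \<longlonglongrightarrow> f x"
proof -
  note [measurable] = F[THEN sqD_measurable]
  define a where "a k = l2 M (\<lambda>x. F (Suc k) x - F k x)" for k
  define S where "S = suminf a"
  have sma: "summable a" using sm by (simp add: a_def[abs_def])
  have a0: "0 \<le> a k" for k by (simp add: a_def)
  have S0: "0 \<le> S" unfolding S_def by (intro suminf_nonneg sma a0)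
  define g where "g n x = (\<Sum>k<n. norm (F (Suc k) x - F k x))" for n x
  have g_sq: "sq M (g n)" and g_le: "l2 M (g n) \<le> S" for n
  proof -
    have "sq M (g n) \<and> l2 M (g n) \<le> (\<Sum>k<n. l2 M (\<lambda>x. norm (F (Suc k) x - F k x)))"
      unfolding g_def by (intro l2_sum_le sq_norm sq_diff F)
    moreover have "(\<Sum>k<n. a k) \<le> S"
      unfolding S_def by (intro sum_le_suminf sma a0) auto
    ultimately show "sq M (g n)" "l2 M (g n) \<le> S"
      by (auto simp: l2_norm a_def)
  qed
  have g_meas [measurable]: "g n \<in> borel_measurable M" for n using g_sq by auto
  have g0: "0 \<le> g n x" for n x by (auto simp: g_def intro: sum_nonneg)
  have g_mono: "g n x \<le> g m x" if "n \<le> m" for n m x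
    unfolding g_def by (intro sum_mono2) (use that in auto)
  have "(\<integral>\<^sup>+x. (SUP n. ennreal ((g n x)\<^sup>2)) \<partial>M) = (SUP n. \<integral>\<^sup>+x. ennreal ((g n x)\<^sup>2) \<partial>M)"
    by (intro nn_integral_monotone_convergence_SUP)
      (auto simp: incseq_def le_fun_def intro!: ennreal_leI power_mono g0 g_mono)
  also have "\<dots> \<le> ennreal (S\<^sup>2)"
  proof (rule SUP_least)
    fix n
    have "(\<integral>\<^sup>+x. ennreal ((g n x)\<^sup>2) \<partial>M) = ennreal ((l2 M (g n))\<^sup>2)"
      using l2_power2_nn[OF g_sq[of n]] by simp
    also have "\<dots> \<le> ennreal (S\<^sup>2)" by (intro ennreal_leI power_mono g_le) simp
    finally show "(\<integral>\<^sup>+x. ennreal ((g n x)\<^sup>2) \<partial>M) \<le> ennreal (S\<^sup>2)" .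
  qed
  finally have "(\<integral>\<^sup>+x. (SUP n. ennreal ((g n x)\<^sup>2)) \<partial>M) \<noteq> \<infinity>"
    by (auto simp: top_unique)
  then have "AE x in M. (SUP n. ennreal ((g n x)\<^sup>2)) \<noteq> \<infinity>"
    by (intro nn_integral_PInf_AE) auto
  then have conv: "AE x in M. convergent (\<lambda>n. F n x)"
  proof eventually_elim
    case (elim x)
    then obtain C where C: "0 \<le> C" "(SUP n. ennreal ((g n x)\<^sup>2)) = ennreal C"
      by (metis ennreal_cases infinity_ennreal_def)
    have "(g n x)\<^sup>2 \<le> C" for n
      using SUP_upper[of n UNIV "\<lambda>n. ennreal ((g n x)\<^sup>2)"] C by simp
    then have gle: "g n x \<le> sqrt C" for n
      using real_le_rsqrt by blast
    have "summable (\<lambda>k. norm (F (Suc k) x - F k x))"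
    proof (rule summableI_nonneg_bounded)
      show "(\<Sum>k<n. norm (F (Suc k) x - F k x)) \<le> sqrt C" for n
        using gle[of n] by (simp add: g_def)
    qed auto
    then have "summable (\<lambda>k. F (Suc k) x - F k x)" by (rule summable_norm_cancel)
    then have "convergent (\<lambda>n. (\<Sum>k<n. F (Suc k) x - F k x))"
      by (simp add: summable_iff_convergent)
    then have "convergent (\<lambda>n. F n x - F 0 x)"
      by (simp add: sum_lessThan_telescope[of "\<lambda>k. F k x"])
    then show ?case
      using convergent_add[OF _ convergent_const[of "F 0 x"], of "\<lambda>n. F n x - F 0 x"] by simp
  qed
  \<comment> \<open>Where the sequence diverges \<open>lim\<close> is unspecified; this happens only
    on a null set, and measurability of \<open>f\<close> does not depend on it.\<close>
  define f where "f x = lim (\<lambda>n. F n x)" for x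
  have f_meas [measurable]: "f \<in> borel_measurable M"
    unfolding f_def by measurable
  have lim: "AE x in M. (\<lambda>n. F n x) \<longlonglongrightarrow> f x"
    using conv by eventually_elim (simp add: f_def convergent_LIMSEQ_iff)
  define T where "T n = (\<Sum>k. a (k + n))" for n
  have T0: "0 \<le> T n" for n
    unfolding T_def using sma a0 by (intro suminf_nonneg) (auto simp: summable_iff_shift)
  have Fnm: "l2 M (\<lambda>x. F n x - F (n + m) x) \<le> T n" for n m
  proof -
    have "l2 M (\<lambda>x. F n x - F (n + m) x) \<le> (\<Sum>k<m. a (k + n))"
    proof (induction m)
      case (Suc m)
      have "l2 M (\<lambda>x. F n x - F (n + Suc m) x) \<le>
          l2 M (\<lambda>x. F n x - F (n + m) x) + l2 M (\<lambda>x. F (n + m) x - F (n + Suc m) x)"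
        by (intro l2_triangle F)
      also have "l2 M (\<lambda>x. F (n + m) x - F (n + Suc m) x) = a (m + n)"
        by (subst l2_minus_commute) (simp add: a_def add_ac)
      finally show ?case using Suc by simp
    qed (simp add: l2_def)
    also have "\<dots> \<le> T n"
      unfolding T_def using sma a0 by (intro sum_le_suminf) (auto simp: summable_iff_shift)
    finally show ?thesis .
  qed
  have tail: "sq M (\<lambda>x. F n x - f x) \<and> l2 M (\<lambda>x. F n x - f x) \<le> T n" for n
  proof -
    have "(\<integral>\<^sup>+x. ennreal ((norm (F n x - f x))\<^sup>2) \<partial>M) =
        (\<integral>\<^sup>+x. liminf (\<lambda>m. ennreal ((norm (F n x - F (n + m) x))\<^sup>2)) \<partial>M)"
    proof (rule nn_integral_cong_AE)
      show "AE x in M. ennreal ((norm (F n x - f x))\<^sup>2) = liminf (\<lambda>m. ennreal ((norm (F n x - F (n + m) x))\<^sup>2))"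
        using lim
      proof eventually_elim
        case (elim x)
        have "(\<lambda>m. F (n + m) x) \<longlonglongrightarrow> f x"
          using LIMSEQ_ignore_initial_segment[OF elim, of n] by (simp add: add_ac)
        then have "(\<lambda>m. ennreal ((norm (F n x - F (n + m) x))\<^sup>2)) \<longlonglongrightarrow> ennreal ((norm (F n x - f x))\<^sup>2)"
          by (intro tendsto_intros)
        then show ?case by (intro lim_imp_Liminf[symmetric] trivial_limit_sequentially)
      qed
    qed
    also have "\<dots> \<le> liminf (\<lambda>m. \<integral>\<^sup>+x. ennreal ((norm (F n x - F (n + m) x))\<^sup>2) \<partial>M)"
      by (intro nn_integral_liminf) auto
    also have "\<dots> = liminf (\<lambda>m. ennreal ((l2 M (\<lambda>x. F n x - F (n + m) x))\<^sup>2))"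
      using l2_power2_nn[OF sq_diff[OF F F]] by simp
    also have "\<dots> \<le> liminf (\<lambda>m. ennreal ((T n)\<^sup>2))"
      by (intro Liminf_mono always_eventually allI ennreal_leI power_mono Fnm) auto
    also have "\<dots> = ennreal ((T n)\<^sup>2)" by (simp add: Liminf_const)
    finally show ?thesis
      by (intro conjI sqI_nn) (auto simp: T0)
  qed
  have sqf: "sq M f"
    using sq_diff[OF F[of 0] conjunct1[OF tail[of 0]]] by simp
  have "T \<longlonglongrightarrow> 0"
    unfolding T_def by (rule suminf_exist_split2[OF sma])
  then have "(\<lambda>n. l2 M (\<lambda>x. F n x - f x)) \<longlonglongrightarrow> 0"
    by (rule Lim_null_comparison[rotated]) (use tail in auto)
  with sqf lim show ?thesis by (intro that)
qed

section \<open>Density, translations and the scalar Plancherel theorem\<close>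

text \<open>All \<open>F n\<close> and the limit lie below \<open>w\<close>, so the squared
  difference lies below 4 w^2 and dominated convergence applies to it.\<close>

lemma l2_dominated:
  fixes F :: "nat \<Rightarrow> 'a \<Rightarrow> 'b::euclidean_space" and w :: "'a \<Rightarrow> real"
  assumes w: "sq M w" and F: "\<And>n. F n \<in> borel_measurable M" and f: "f \<in> borel_measurable M"
    and lim: "AE x in M. (\<lambda>n. F n x) \<longlonglongrightarrow> f x"
    and le: "\<And>n. AE x in M. norm (F n x) \<le> w x"
  shows "sq M f" "\<And>n. sq M (F n)" "(\<lambda>n. l2 M (\<lambda>x. F n x - f x)) \<longlonglongrightarrow> 0"
proof -
  note [measurable] = f F
  have "AE x in M. \<forall>n. norm (F n x) \<le> w x"
    using le by (simp add: AE_all_countable)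
  then have fle: "AE x in M. norm (f x) \<le> w x" using lim
  proof eventually_elim
    case (elim x)
    then show ?case
      by (intro LIMSEQ_le_const2[OF tendsto_norm[OF elim(2)]]) auto
  qed
  show sf: "sq M f"
    by (rule sq_bound[OF w f, of 1]) (use fle in \<open>eventually_elim; simp\<close>)
  show sF: "sq M (F n)" for n
    by (rule sq_bound[OF w F, of n 1]) (use le[of n] in \<open>eventually_elim; simp\<close>)
  have "(\<lambda>n. LINT x|M. (norm (F n x - f x))\<^sup>2) \<longlonglongrightarrow> (LINT x|M. 0)"
  proof (rule integral_dominated_convergence)
    show "integrable M (\<lambda>x. 4 * (norm (w x))\<^sup>2)"
      using sqD_integrable[OF w] by simp
    show "AE x in M. (\<lambda>n. (norm (F n x - f x))\<^sup>2) \<longlonglongrightarrow> 0"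
      using lim
    proof eventually_elim
      case (elim x)
      then have "(\<lambda>n. (norm (F n x - f x))\<^sup>2) \<longlonglongrightarrow> (norm (f x - f x))\<^sup>2"
        by (intro tendsto_intros)
      then show ?case by simp
    qed
    show "AE x in M. norm ((norm (F n x - f x))\<^sup>2) \<le> 4 * (norm (w x))\<^sup>2" for n
      using le[of n] fle
    proof eventually_elim
      case (elim x)
      have "norm (F n x - f x) \<le> 2 * norm (w x)"
        using norm_triangle_ineq4[of "F n x" "f x"] elim by simp
      then have "(norm (F n x - f x))\<^sup>2 \<le> (2 * norm (w x))\<^sup>2" by (intro power_mono) auto
      then show ?case by (simp add: power_mult_distrib)
    qed
  qed auto
  then have "(\<lambda>n. sqrt (LINT x|M. (norm (F n x - f x))\<^sup>2)) \<longlonglongrightarrow> sqrt 0"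
    by (intro tendsto_intros) simp
  then show "(\<lambda>n. l2 M (\<lambda>x. F n x - f x)) \<longlonglongrightarrow> 0"
    by (simp add: l2_def)
qed

lemma sq_indicator_interval:
  "sq lborel (\<lambda>x::real. C * indicator {a..b} x :: real)"
proof -
  have "(norm (C * indicator {a..b} x :: real))\<^sup>2 = indicator {a..b} x *\<^sub>R C\<^sup>2" for x :: real
    by (simp add: indicator_def)
  moreover have "integrable lborel (\<lambda>x. indicator {a..b} x *\<^sub>R C\<^sup>2 :: real)"
    by (intro integrable_scaleR_left integrable_real_indicator) (auto simp: emeasure_lborel_Icc_eq)
  ultimately show ?thesis unfolding sq_def by simp
qed

text \<open>A Lebesgue measurable function is an almost everywhere limit of continuous ones.
  Projecting their values radially onto the ball of radius K and multiplying by a continuous cutoff,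
  equal to 1 on [-K, K] and to 0 outside [-K-1, K+1], makes them dominated. Neither operation
  changes the limit, since \<open>f\<close> is already bounded by K and supported in
  [-K, K].\<close>

lemma l2_approx_compact_continuous_bounded:
  fixes f :: "real \<Rightarrow> 'b::euclidean_space"
  assumes f: "f \<in> borel_measurable lborel" and K: "0 < K"
    and bd: "\<And>x. norm (f x) \<le> K" and supp: "\<And>x. \<bar>x\<bar> > K \<Longrightarrow> f x = 0" and e: "0 < e"
  obtains g where "continuous_on UNIV g" "\<And>x. \<bar>x\<bar> > K + 1 \<Longrightarrow> g x = 0" "\<And>x. norm (g x) \<le> K"
    "sq lborel g" "l2 lborel (\<lambda>x. f x - g x) < e"
proof -
  have "f \<in> borel_measurable lebesgue"
    using f by (intro borel_measurable_if_I measurable_completion) auto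
  then have "f measurable_on UNIV"
    by (rule lebesgue_measurable_imp_measurable_on) auto
  then obtain N g where N: "negligible N" and g: "\<And>n. continuous_on UNIV (g n)"
    and lim: "\<And>x. x \<notin> N \<Longrightarrow> (\<lambda>n. g n x) \<longlonglongrightarrow> f x"
    by (auto simp: measurable_on_def)
  define clip where "clip y = (K / max K (norm y)) *\<^sub>R y" for y :: 'b
  define cut where "cut x = max 0 (min 1 (K + 1 - \<bar>x\<bar>))" for x :: real
  define h where "h n x = cut x *\<^sub>R clip (g n x)" for n x
  have clip_c: "continuous_on UNIV clip"
    unfolding clip_def using K by (intro continuous_intros) (auto simp: max_def split: if_splits)
  have clip_le: "norm (clip y) \<le> K" for y
    using K by (auto simp: clip_def max_def field_simps)
  have cut: "0 \<le> cut x" "cut x \<le> 1" for x by (auto simp: cut_def)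
  have h_c: "continuous_on UNIV (h n)" for n
    unfolding h_def cut_def
    by (intro continuous_intros continuous_on_compose2[OF clip_c g]) auto
  then have h_meas: "h n \<in> borel_measurable lborel" for n
    by (simp add: borel_measurable_continuous_onI)
  have h0: "h n x = 0" if "\<bar>x\<bar> > K + 1" for n x
    using that by (simp add: h_def cut_def)
  have hle: "norm (h n x) \<le> K" for n x
    using mult_mono[OF cut(2)[of x] clip_le[of "g n x"]] cut by (simp add: h_def)
  have dom: "norm (h n x) \<le> K * indicator {-(K+1)..K+1} x" for n x
    using h0[of x n] hle[of n x] by (cases "\<bar>x\<bar> > K + 1") (auto simp: indicator_def)
  have h_lim: "AE x in lborel. (\<lambda>n. h n x) \<longlonglongrightarrow> f x"
  proof -
    have "AE x in lebesgue. x \<notin> N"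
      using N by (simp add: negligible_iff_null_sets AE_not_in)
    then have "AE x in lebesgue. (\<lambda>n. h n x) \<longlonglongrightarrow> f x"
    proof eventually_elim
      case (elim x)
      have "isCont clip (f x)"
        using clip_c by (simp add: continuous_on_eq_continuous_at)
      then have "(\<lambda>n. clip (g n x)) \<longlonglongrightarrow> clip (f x)"
        by (rule isCont_tendsto_compose[OF _ lim[OF elim]])
      then have "(\<lambda>n. h n x) \<longlonglongrightarrow> cut x *\<^sub>R clip (f x)"
        unfolding h_def by (intro tendsto_intros)
      also have "clip (f x) = f x"
        using bd[of x] K by (simp add: clip_def max_absorb1)
      also have "cut x *\<^sub>R f x = f x"
        using supp[of x] by (cases "\<bar>x\<bar> > K") (auto simp: cut_def)
      finally show ?case .
    qed
    then show ?thesis by (simp add: AE_completion_iff)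
  qed
  note dominated = l2_dominated[OF sq_indicator_interval h_meas f h_lim AE_I2[OF dom]]
  have sqh: "\<And>n. sq lborel (h n)" by (rule dominated(2))
  have "\<forall>\<^sub>F n in sequentially. l2 lborel (\<lambda>x. h n x - f x) < e"
    by (rule order_tendstoD(2)[OF dominated(3) e])
  then obtain n where "l2 lborel (\<lambda>x. h n x - f x) < e"
    using eventually_happens'[OF sequentially_bot] by blast
  then show ?thesis
    using h_c h0 hle sqh by (intro that[of "h n"]) (auto simp: l2_minus_commute[of lborel f])
qed

text \<open>Argument and value are cut at the same level n, so the truncated function meets both
  hypotheses of the preceding approximation with K = n.\<close>

lemma l2_approx_bounded_support:
  fixes f :: "real \<Rightarrow> 'b::euclidean_space"
  assumes f: "sq lborel f"
  shows "(\<lambda>n. l2 lborel (\<lambda>x. (if \<bar>x\<bar> \<le> real n \<and> norm (f x) \<le> real n then f x else 0) - f x)) \<longlonglongrightarrow> 0"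
    (is "(\<lambda>n. l2 lborel (\<lambda>x. ?F n x - f x)) \<longlonglongrightarrow> 0")
proof (rule l2_dominated(3)[OF sq_norm[OF f]])
  note [measurable] = sqD_measurable[OF f]
  show "?F n \<in> borel_measurable lborel" for n by measurable
  show "f \<in> borel_measurable lborel" by measurable
  show "AE x in lborel. (\<lambda>n. ?F n x) \<longlonglongrightarrow> f x"
  proof (rule AE_I2)
    fix x
    obtain m :: nat where "max \<bar>x\<bar> (norm (f x)) \<le> real m" using real_arch_simple by blast
    then have "\<forall>\<^sub>F n in sequentially. ?F n x = f x"
      by (intro eventually_sequentiallyI[of m]) auto
    then show "(\<lambda>n. ?F n x) \<longlonglongrightarrow> f x" by (rule tendsto_eventually)
  qed
qed auto

lemma l2_dense_compact_continuous:
  fixes f :: "real \<Rightarrow> 'b::euclidean_space"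
  assumes f: "sq lborel f" and e: "0 < e"
  obtains g K where "continuous_on UNIV g" "\<And>x. \<bar>x\<bar> > K \<Longrightarrow> g x = 0" "\<And>x. norm (g x) \<le> K"
    "sq lborel g" "l2 lborel (\<lambda>x. f x - g x) < e"
proof -
  let ?F = "\<lambda>n x. if \<bar>x\<bar> \<le> real n \<and> norm (f x) \<le> real n then f x else 0"
  note [measurable] = sqD_measurable[OF f]
  have "\<forall>\<^sub>F n in sequentially. l2 lborel (\<lambda>x. ?F n x - f x) < e / 2"
    using l2_approx_bounded_support[OF f] e by (intro order_tendstoD) auto
  then have "\<forall>\<^sub>F n in sequentially. l2 lborel (\<lambda>x. ?F n x - f x) < e / 2 \<and> 0 < n"
    using eventually_gt_at_top[of 0] by eventually_elim auto
  then obtain n where n: "l2 lborel (\<lambda>x. ?F n x - f x) < e / 2" "0 < n"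
    using eventually_happens'[OF sequentially_bot] by blast
  have sF: "sq lborel (?F n)"
    by (rule sq_bound[OF f, of _ 1]) auto
  obtain g where g: "continuous_on UNIV g" "\<And>x. \<bar>x\<bar> > real n + 1 \<Longrightarrow> g x = 0"
      "\<And>x. norm (g x) \<le> real n" "sq lborel g" "l2 lborel (\<lambda>x. ?F n x - g x) < e / 2"
    by (rule l2_approx_compact_continuous_bounded[of "?F n" "real n" "e/2"]) (use n e in auto)
  have "l2 lborel (\<lambda>x. f x - g x) \<le> l2 lborel (\<lambda>x. f x - ?F n x) + l2 lborel (\<lambda>x. ?F n x - g x)"
    by (intro l2_triangle f sF g)
  also have "\<dots> < e"
    using n(1) g(5) by (simp add: l2_minus_commute[of lborel f])
  finally show ?thesis
    by (intro that[of g "real n + 1"]) (use g in \<open>auto intro: order_trans[OF g(3)]\<close>)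
qed

section \<open>Continuity of translations in L2\<close>

lemma sq_shift:
  fixes f :: "real \<Rightarrow> 'b::euclidean_space"
  assumes f: "sq lborel f"
  shows "sq lborel (\<lambda>x. f (x + h))" "l2 lborel (\<lambda>x. f (x + h)) = l2 lborel f"
proof -
  note [measurable] = sqD_measurable[OF f]
  have "integrable lborel (\<lambda>x. (norm (f (h + 1 * x)))\<^sup>2)"
    by (rule lborel_integrable_real_affine) (use sqD_integrable[OF f] in auto)
  then show "sq lborel (\<lambda>x. f (x + h))"
    by (simp add: sq_def add.commute)
  show "l2 lborel (\<lambda>x. f (x + h)) = l2 lborel f"
    unfolding l2_def
    by (subst (2) lborel_integral_real_affine[where c=1 and t=h]) (auto simp: add.commute)
qed

text \<open>For continuous compactly supported functions this is dominated convergence. In general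
  such a g is chosen near f; translations are isometries, so the error f - g enters twice, whence
  the thirds of e.\<close>

lemma l2_translation_continuous:
  fixes f :: "real \<Rightarrow> 'b::euclidean_space" and h :: "nat \<Rightarrow> real"
  assumes f: "sq lborel f" and h: "h \<longlonglongrightarrow> 0"
  shows "(\<lambda>n. l2 lborel (\<lambda>x. f (x + h n) - f x)) \<longlonglongrightarrow> 0"
proof (rule LIMSEQ_I, simp)
  fix e :: real assume e: "0 < e"
  obtain g K where gc: "continuous_on UNIV g" and g0: "\<And>x. \<bar>x\<bar> > K \<Longrightarrow> g x = 0"
    and gle: "\<And>x. norm (g x) \<le> K" and gs: "sq lborel g" and fg: "l2 lborel (\<lambda>x. f x - g x) < e / 3"
    by (rule l2_dense_compact_continuous[OF f, of "e / 3"]) (use e in \<open>simp, blast\<close>)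
  note gs' = sq_shift[OF gs] and fs' = sq_shift[OF f]
  \<comment> \<open>A convergent sequence is bounded, so all translates of g are supported in one
    interval [-(K+C), K+C], which provides a common dominating function.\<close>
  obtain C where C: "\<And>n. \<bar>h n\<bar> \<le> C"
    using convergent_imp_Bseq[of h] h by (auto simp: convergent_def Bseq_def)
  have "(\<lambda>n. l2 lborel (\<lambda>x. g (x + h n) - g x)) \<longlonglongrightarrow> 0"
  proof (rule l2_dominated(3)[OF sq_indicator_interval[of K "-(K+C)" "K+C"]])
    show "AE x in lborel. (\<lambda>n. g (x + h n)) \<longlonglongrightarrow> g x"
    proof (rule AE_I2)
      fix x
      have "(\<lambda>n. x + h n) \<longlonglongrightarrow> x + 0" by (intro tendsto_intros h)
      moreover have "isCont g x" using gc by (simp add: continuous_on_eq_continuous_at)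
      ultimately show "(\<lambda>n. g (x + h n)) \<longlonglongrightarrow> g x" by (auto intro: isCont_tendsto_compose)
    qed
    show "AE x in lborel. norm (g (x + h n)) \<le> K * indicator {- (K + C)..K + C} x" for n
    proof (rule AE_I2)
      fix x
      show "norm (g (x + h n)) \<le> K * indicator {- (K + C)..K + C} x"
        using g0[of "x + h n"] gle[of "x + h n"] C[of n]
        by (cases "\<bar>x + h n\<bar> > K") (auto simp: indicator_def)
    qed
  qed (use sqD_measurable[OF gs] sqD_measurable[OF gs'(1)] in auto)
  then have "\<forall>\<^sub>F n in sequentially. l2 lborel (\<lambda>x. g (x + h n) - g x) < e / 3"
    by (rule order_tendstoD(2)) (use e in simp)
  then obtain n0 where n0: "\<And>n. n \<ge> n0 \<Longrightarrow> l2 lborel (\<lambda>x. g (x + h n) - g x) < e / 3"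
    by (auto simp: eventually_sequentially)
  have "l2 lborel (\<lambda>x. f (x + h n) - f x) < e" if "n \<ge> n0" for n
  proof -
    have "l2 lborel (\<lambda>x. f (x + h n) - f x) \<le>
        l2 lborel (\<lambda>x. f (x + h n) - g (x + h n)) + l2 lborel (\<lambda>x. g (x + h n) - f x)"
      by (intro l2_triangle f fs' gs')
    also have "l2 lborel (\<lambda>x. g (x + h n) - f x) \<le>
        l2 lborel (\<lambda>x. g (x + h n) - g x) + l2 lborel (\<lambda>x. g x - f x)"
      by (intro l2_triangle f gs gs')
    also have "l2 lborel (\<lambda>x. g x - f x) = l2 lborel (\<lambda>x. f x - g x)" by (rule l2_minus_commute)
    also have "l2 lborel (\<lambda>x. f (x + h n) - g (x + h n)) = l2 lborel (\<lambda>x. f x - g x)"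
      by (rule sq_shift(2)[OF sq_diff[OF f gs]])
    finally show ?thesis using fg n0[OF that] by simp
  qed
  then show "\<exists>n0. \<forall>n\<ge>n0. l2 lborel (\<lambda>x. f (x + h n) - f x) < e" by blast
qed


section \<open>Autocorrelation of a square-integrable function\<close>

definition autocorrelation :: "(real \<Rightarrow> complex) \<Rightarrow> real \<Rightarrow> complex" where
  "autocorrelation f x = (LBINT s. f (s + x) * cnj (f s))"

lemma borel_measurable_cnj [measurable]:
  assumes "f \<in> borel_measurable M"
  shows "(\<lambda>x. cnj (f x)) \<in> borel_measurable M"
  by (rule borel_measurable_continuous_on[OF _ assms]) (intro continuous_intros)

lemma autocorrelation_integrand_integrable:
  fixes f :: "real \<Rightarrow> complex"
  assumes f: "sq lborel f"
  shows "integrable lborel (\<lambda>s. f (s + x) * cnj (f s))"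
  by (rule Bochner_Integration.integrable_bound[OF integrable_norm_mult[OF sq_shift(1)[OF f, of x] f]])
    (use sqD_measurable[OF f] in \<open>auto simp: norm_mult\<close>)

lemma norm_autocorrelation_le:
  assumes f: "sq lborel f"
  shows "norm (autocorrelation f x) \<le> (l2 lborel f)\<^sup>2"
proof -
  have "norm (autocorrelation f x) \<le> (LBINT s. norm (f (s + x) * cnj (f s)))"
    unfolding autocorrelation_def by (rule integral_norm_bound)
  also have "\<dots> \<le> l2 lborel (\<lambda>s. f (s + x)) * l2 lborel f"
    using Cauchy_Schwarz_norm[OF sq_shift(1)[OF f, of x] f] by (simp add: norm_mult)
  finally show ?thesis by (simp add: sq_shift[OF f] power2_eq_square)
qed

lemma autocorrelation_0:
  assumes f: "sq lborel f"
  shows "autocorrelation f 0 = of_real ((l2 lborel f)\<^sup>2)"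
proof -
  have "(LBINT s. f s * cnj (f s)) = (LBINT s. complex_of_real ((norm (f s))\<^sup>2))"
    by (intro Bochner_Integration.integral_cong refl) (metis complex_norm_square)
  then show ?thesis
    unfolding autocorrelation_def l2_power2 by (simp only: integral_complex_of_real add_0_right)
qed

text \<open>By Cauchy-Schwarz the change from 0 to h is at most the L2 distance between f and its
  translate by h, times the norm of f. Continuity at the origin is what lets the widening Gaussians
  in Plancherel's theorem recover the value there, the squared norm of f.\<close>

lemma autocorrelation_continuous_0:
  assumes f: "sq lborel f" and h: "h \<longlonglongrightarrow> 0"
  shows "(\<lambda>n. autocorrelation f (h n)) \<longlonglongrightarrow> of_real ((l2 lborel f)\<^sup>2)"
proof -
  have le: "norm (autocorrelation f (h n) - autocorrelation f 0)
      \<le> l2 lborel (\<lambda>s. f (s + h n) - f s) * l2 lborel f" for n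
  proof -
    have "autocorrelation f (h n) - autocorrelation f 0 = (LBINT s. (f (s + h n) - f s) * cnj (f s))"
      unfolding autocorrelation_def
      using autocorrelation_integrand_integrable[OF f, of "h n"] autocorrelation_integrand_integrable[OF f, of 0]
      by (subst Bochner_Integration.integral_diff[symmetric]) (auto simp: algebra_simps)
    also have "norm \<dots> \<le> (LBINT s. norm ((f (s + h n) - f s) * cnj (f s)))"
      by (rule integral_norm_bound)
    also have "\<dots> \<le> l2 lborel (\<lambda>s. f (s + h n) - f s) * l2 lborel f"
      using Cauchy_Schwarz_norm[OF sq_diff[OF sq_shift(1)[OF f, of "h n"] f] f] by (simp add: norm_mult)
    finally show ?thesis .
  qed
  have "(\<lambda>n. l2 lborel (\<lambda>s. f (s + h n) - f s) * l2 lborel f) \<longlonglongrightarrow> 0"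
    by (intro tendsto_mult_left_zero l2_translation_continuous f h)
  then have "(\<lambda>n. autocorrelation f (h n) - autocorrelation f 0) \<longlonglongrightarrow> 0"
    by (rule Lim_null_comparison[rotated]) (use le in auto)
  then show ?thesis
    by (simp add: LIM_zero_iff autocorrelation_0[OF f])
qed

section \<open>Gaussians and their Fourier transforms\<close>

lemma integrable_gauss: "integrable lborel (\<lambda>x::real. exp (- x\<^sup>2 / 2))"
  and integral_gauss: "(LBINT x. exp (- (x::real)\<^sup>2 / 2)) = sqrt (2 * pi)"
proof -
  have *: "exp (- x\<^sup>2 / 2) = sqrt (2 * pi) * std_normal_density x" for x :: real
    by (simp add: std_normal_density_def)
  have "integrable lborel std_normal_density" "integral\<^sup>L lborel std_normal_density = 1"
    using integrable_std_normal_moment[of 0] integral_std_normal_moment_even[of 0] by simp_all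
  then show "integrable lborel (\<lambda>x::real. exp (- x\<^sup>2 / 2))"
      "(LBINT x. exp (- (x::real)\<^sup>2 / 2)) = sqrt (2 * pi)"
    unfolding * by simp_all
qed

text \<open>This is the characteristic function of the standard normal distribution, written as an
  integral against Lebesgue measure.\<close>

lemma fourier_gauss:
  fixes y :: real
  shows "(LBINT u. exp (\<i> * of_real (y * u)) * of_real (exp (- u\<^sup>2 / 2)))
    = of_real (sqrt (2 * pi) * exp (- y\<^sup>2 / 2))"
proof -
  have "complex_of_real (exp (- y\<^sup>2 / 2)) = (CLINT u|std_normal_distribution. iexp (y * u))"
    using fun_cong[OF char_std_normal_distribution, of y] by (simp add: char_def)
  also have "\<dots> = (LBINT u. std_normal_density u *\<^sub>R iexp (y * u))"
    by (rule integral_density) auto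
  also have "\<dots> = (LBINT u. of_real (1 / sqrt (2 * pi)) * (exp (\<i> * of_real (y * u)) * of_real (exp (- u\<^sup>2 / 2))))"
    by (intro Bochner_Integration.integral_cong refl) (simp add: std_normal_density_def scaleR_conv_of_real)
  also have "\<dots> = of_real (1 / sqrt (2 * pi)) * (LBINT u. (exp (\<i> * of_real (y * u)) * of_real (exp (- u\<^sup>2 / 2))))"
    by simp
  finally show ?thesis by (simp add: field_simps)
qed

text \<open>Substituting \<xi> = cu reduces to the unscaled case. The hypothesis on \<sigma> covers
  both signs of the transform; the result depends on \<sigma> only through its square.\<close>

lemma fourier_gauss_scaled:
  fixes x \<sigma> c :: real
  assumes c: "0 < c" and s: "\<sigma>\<^sup>2 = 1"
  shows "(LBINT \<xi>. exp (\<i> * of_real (\<sigma> * \<xi> * x)) * of_real (exp (- (\<xi> / c)\<^sup>2 / 2)))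
    = of_real (c * sqrt (2 * pi) * exp (- (c * x)\<^sup>2 / 2))"
proof -
  have "(LBINT \<xi>. exp (\<i> * of_real (\<sigma> * \<xi> * x)) * of_real (exp (- (\<xi> / c)\<^sup>2 / 2)))
    = \<bar>c\<bar> *\<^sub>R (LBINT u. exp (\<i> * of_real (\<sigma> * (0 + c * u) * x)) * of_real (exp (- ((0 + c * u) / c)\<^sup>2 / 2)))"
    by (rule lborel_integral_real_affine) (use c in simp)
  also have "(LBINT u. exp (\<i> * of_real (\<sigma> * (0 + c * u) * x)) * of_real (exp (- ((0 + c * u) / c)\<^sup>2 / 2)))
    = (LBINT u. exp (\<i> * of_real ((\<sigma> * c * x) * u)) * of_real (exp (- u\<^sup>2 / 2)))"
    by (intro Bochner_Integration.integral_cong refl) (use c in \<open>simp add: mult_ac\<close>)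
  also have "\<dots> = of_real (sqrt (2 * pi) * exp (- (\<sigma> * c * x)\<^sup>2 / 2))" by (rule fourier_gauss)
  finally show ?thesis
    using c s by (simp add: power_mult_distrib scaleR_conv_of_real mult_ac)
qed

lemma integrable_gauss_scaled:
  fixes c :: real
  assumes c: "0 < c"
  shows "integrable lborel (\<lambda>\<xi>. exp (- (\<xi> / c)\<^sup>2 / 2))"
  using lborel_integrable_real_affine[OF integrable_gauss, of "1 / c" 0] c by simp

text \<open>Writing \<open>\<bar>\<F>f\<bar>\<^sup>2\<close> as the Fourier transform of the autocorrelation, regularising with a Gaussian
  and letting its width tend to infinity.\<close>
proposition plancherel_scalar:
  fixes f :: "real \<Rightarrow> complex" and \<sigma> :: real
  assumes fi: "integrable lborel f" and fs: "sq lborel f" and s: "\<sigma>\<^sup>2 = 1"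
  defines "Ff \<equiv> \<lambda>\<xi>. LBINT t. exp (\<i> * of_real (\<sigma> * \<xi> * t)) * f t"
  shows "sq lborel Ff" "(l2 lborel Ff)\<^sup>2 = 2 * pi * (l2 lborel f)\<^sup>2"
proof -
  note [measurable] = sqD_measurable[OF fs]
  have [measurable]: "Ff \<in> borel_measurable lborel"
    unfolding Ff_def by measurable
  define A where "A = autocorrelation f"
  have A_meas [measurable]: "A \<in> borel_measurable lborel"
    unfolding A_def autocorrelation_def by measurable
  have norm_exp: "norm (exp (\<i> * complex_of_real r)) = 1" for r by simp
  have ei: "integrable lborel (\<lambda>t. exp (\<i> * of_real (\<sigma> * \<xi> * t)) * f t)" for \<xi>
    by (rule Bochner_Integration.integrable_bound[OF fi]) (auto simp: norm_mult)
  have pair: "integrable (lborel \<Otimes>\<^sub>M lborel) (\<lambda>(x, s). f (s + x) * cnj (f s))"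
  proof -
    \<comment> \<open>With s outermost, the inner integral of the norm over x is |f(s)| times the L1
      norm of f by translation invariance; swapping the variables afterwards gives the order used
      for the autocorrelation.\<close>
    have "integrable (lborel \<Otimes>\<^sub>M lborel) (\<lambda>(s, x). f (s + x) * cnj (f s))"
    proof (rule lborel_pair.Fubini_integrable)
      have "(LBINT x. norm (f (s + x) * cnj (f s))) = norm (f s) * (LBINT x. norm (f x))" for s
        using lborel_integral_real_affine[of 1 "\<lambda>x. norm (f x)" s] by (simp add: norm_mult)
      then show "integrable lborel (\<lambda>s. LBINT x. norm (case (s, x) of (s, x) \<Rightarrow> f (s + x) * cnj (f s)))"
        using fi by simp
      show "AE s in lborel. integrable lborel (\<lambda>x. case (s, x) of (s, x) \<Rightarrow> f (s + x) * cnj (f s))"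
        using lborel_integrable_real_affine[OF fi, of 1] by auto
    qed measurable
    from lborel_pair.integrable_product_swap[OF this] show ?thesis by (simp add: case_prod_beta)
  qed
  have Ai: "integrable lborel A"
    using lborel_pair.integrable_fst[OF pair] by (simp add: A_def autocorrelation_def[abs_def])
  have F2: "of_real ((norm (Ff \<xi>))\<^sup>2) = (LBINT x. exp (\<i> * of_real (\<sigma> * \<xi> * x)) * A x)" for \<xi>
  proof -
    define E where "E x = exp (\<i> * of_real (\<sigma> * \<xi> * x))" for x
    have E_meas [measurable]: "E \<in> borel_measurable borel" unfolding E_def by measurable
    have E_norm: "norm (E x) = 1" for x unfolding E_def by simp
    have E_add: "E (s + x) * cnj (E s) = E x" for s x
      unfolding E_def by (simp add: exp_cnj flip: exp_add) (simp add: algebra_simps)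
    have Ff: "Ff \<xi> = (LBINT t. E t * f t)" by (simp add: Ff_def E_def)
    have pairE: "integrable (lborel \<Otimes>\<^sub>M lborel) (\<lambda>(x, s). E x * (f (s + x) * cnj (f s)))"
      by (rule Bochner_Integration.integrable_bound[OF pair]) (auto simp: norm_mult E_norm)
    have "of_real ((norm (Ff \<xi>))\<^sup>2) = Ff \<xi> * cnj (Ff \<xi>)"
      by (metis complex_norm_square)
    also have "\<dots> = (LBINT s. (LBINT t. E t * f t) * cnj (E s * f s))"
    proof -
      have "cnj (Ff \<xi>) = (LBINT s. cnj (E s * f s))"
        unfolding Ff by (rule Bochner_Integration.integral_cnj[symmetric])
      then have "Ff \<xi> * cnj (Ff \<xi>) = Ff \<xi> * (LBINT s. cnj (E s * f s))" by simp
      also have "\<dots> = (LBINT s. Ff \<xi> * cnj (E s * f s))"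
        by (rule integral_mult_right_zero[symmetric])
      finally show ?thesis unfolding Ff .
    qed
    also have "\<dots> = (LBINT s. (LBINT x. E x * (f (s + x) * cnj (f s))))"
    proof (intro Bochner_Integration.integral_cong refl)
      fix s
      have "(LBINT t. E t * f t) * cnj (E s * f s) = (LBINT x. E (s + x) * f (s + x)) * cnj (E s * f s)"
        using lborel_integral_real_affine[of 1 "\<lambda>t. E t * f t" s] by simp
      also have "\<dots> = (LBINT x. (E (s + x) * f (s + x)) * cnj (E s * f s))" by simp
      also have "\<dots> = (LBINT x. E x * (f (s + x) * cnj (f s)))"
        by (intro Bochner_Integration.integral_cong refl) (subst E_add[symmetric, where s=s], simp add: mult_ac)
      finally show "(LBINT t. E t * f t) * cnj (E s * f s) = (LBINT x. E x * (f (s + x) * cnj (f s)))" .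
    qed
    also have "\<dots> = (LBINT x. LBINT s. E x * (f (s + x) * cnj (f s)))"
      by (rule lborel_pair.Fubini_integral) (use pairE in simp)
    also have "\<dots> = (LBINT x. E x * A x)"
      by (simp add: A_def autocorrelation_def)
    finally show ?thesis by (simp add: E_def)
  qed
  \<comment> \<open>\<open>Suc n\<close> keeps the width positive from n = 0 on. The functions
    increase to 1, as monotone convergence will require.\<close>
  define g where "g n \<xi> = exp (- (\<xi> / real (Suc n))\<^sup>2 / 2)" for n \<xi>
  have g_meas [measurable]: "g n \<in> borel_measurable borel" for n unfolding g_def by measurable
  have gi: "integrable lborel (g n)" for n
    unfolding g_def by (rule integrable_gauss_scaled) simp
  have Fle: "norm (Ff \<xi>) \<le> (LBINT t. norm (f t))" for \<xi>
  proof -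
    have "norm (Ff \<xi>) \<le> (LBINT t. norm (exp (\<i> * of_real (\<sigma> * \<xi> * t)) * f t))"
      unfolding Ff_def by (rule integral_norm_bound)
    then show ?thesis by (simp add: norm_mult)
  qed
  have Ji: "integrable lborel (\<lambda>\<xi>. (norm (Ff \<xi>))\<^sup>2 * g n \<xi>)" for n
  proof (rule Bochner_Integration.integrable_bound)
    show "integrable lborel (\<lambda>\<xi>. (LBINT t. norm (f t))\<^sup>2 * g n \<xi>)" using gi by simp
    have "(norm (Ff \<xi>))\<^sup>2 * g n \<xi> \<le> (LBINT t. norm (f t))\<^sup>2 * g n \<xi>" for \<xi>
      by (intro mult_right_mono power_mono Fle) (auto simp: g_def)
    then show "AE \<xi> in lborel. norm ((norm (Ff \<xi>))\<^sup>2 * g n \<xi>) \<le> norm ((LBINT t. norm (f t))\<^sup>2 * g n \<xi>)"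
      by (auto simp: g_def)
  qed measurable
  define J where "J n = (LBINT \<xi>. (norm (Ff \<xi>))\<^sup>2 * g n \<xi>)" for n
  \<comment> \<open>Fubini lets the \<xi>-integral act on the Gaussian alone. Its transform has
    height proportional to n + 1 and width 1/(n + 1), so rescaling x leaves a fixed Gaussian against
    A evaluated at points tending to 0.\<close>
  have J: "complex_of_real (J n) = (LBINT x. of_real (sqrt (2 * pi) * exp (- x\<^sup>2 / 2)) * A (x / real (Suc n)))" for n
  proof -
    let ?c = "real (Suc n)"
    have pairJ: "integrable (lborel \<Otimes>\<^sub>M lborel)
        (\<lambda>(\<xi>, x). exp (\<i> * of_real (\<sigma> * \<xi> * x)) * of_real (g n \<xi>) * A x)"
    proof (rule lborel_pair.Fubini_integrable)
      have "(LBINT x. norm (exp (\<i> * of_real (\<sigma> * \<xi> * x)) * of_real (g n \<xi>) * A x))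
          = g n \<xi> * (LBINT x. norm (A x))" for \<xi>
        by (simp add: norm_mult g_def)
      then show "integrable lborel (\<lambda>\<xi>. LBINT x. norm (case (\<xi>, x) of (\<xi>, x) \<Rightarrow>
          exp (\<i> * of_real (\<sigma> * \<xi> * x)) * of_real (g n \<xi>) * A x))"
        using gi by simp
      have "integrable lborel (\<lambda>x. exp (\<i> * of_real (\<sigma> * \<xi> * x)) * of_real (g n \<xi>) * A x)" for \<xi>
        by (rule Bochner_Integration.integrable_bound[OF integrable_mult_right[OF Ai, of "of_real (g n \<xi>)"]])
          (auto simp: norm_mult)
      then show "AE \<xi> in lborel. integrable lborel (\<lambda>x. case (\<xi>, x) of (\<xi>, x) \<Rightarrow>
          exp (\<i> * of_real (\<sigma> * \<xi> * x)) * of_real (g n \<xi>) * A x)" by simp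
    qed measurable
    have "complex_of_real (J n) = (LBINT \<xi>. of_real ((norm (Ff \<xi>))\<^sup>2) * of_real (g n \<xi>))"
      unfolding J_def of_real_mult[symmetric] by (rule integral_complex_of_real[symmetric])
    also have "\<dots> = (LBINT \<xi>. LBINT x. exp (\<i> * of_real (\<sigma> * \<xi> * x)) * of_real (g n \<xi>) * A x)"
      unfolding F2 by (simp add: mult_ac flip: integral_mult_right_zero)
    also have "\<dots> = (LBINT x. LBINT \<xi>. exp (\<i> * of_real (\<sigma> * \<xi> * x)) * of_real (g n \<xi>) * A x)"
      by (rule lborel_pair.Fubini_integral[symmetric]) (use pairJ in \<open>simp\<close>)
    also have "\<dots> = (LBINT x. of_real (?c * sqrt (2 * pi) * exp (- (?c * x)\<^sup>2 / 2)) * A x)"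
      unfolding g_def using fourier_gauss_scaled[of ?c \<sigma>, OF _ s] by simp
    also have "\<dots> = \<bar>1 / ?c\<bar> *\<^sub>R (LBINT x. of_real (?c * sqrt (2 * pi) * exp (- (?c * (0 + 1 / ?c * x))\<^sup>2 / 2)) * A (0 + 1 / ?c * x))"
      by (rule lborel_integral_real_affine) simp
    also have "\<dots> = (LBINT x. \<bar>1 / ?c\<bar> *\<^sub>R (of_real (?c * sqrt (2 * pi) * exp (- (?c * (0 + 1 / ?c * x))\<^sup>2 / 2)) * A (0 + 1 / ?c * x)))"
      by (rule integral_scaleR_right[symmetric])
    also have "\<dots> = (LBINT x. of_real (sqrt (2 * pi) * exp (- x\<^sup>2 / 2)) * A (x / ?c))"
      by (intro Bochner_Integration.integral_cong refl) (simp add: scaleR_conv_of_real del: of_nat_Suc)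
    finally show ?thesis .
  qed
  let ?B = "(l2 lborel f)\<^sup>2"
  have "(\<lambda>n. LBINT x. of_real (sqrt (2 * pi) * exp (- x\<^sup>2 / 2)) * A (x / real (Suc n)))
      \<longlonglongrightarrow> (LBINT x. of_real (sqrt (2 * pi) * exp (- x\<^sup>2 / 2)) * of_real ?B)"
  proof (rule integral_dominated_convergence)
    show "integrable lborel (\<lambda>x. sqrt (2 * pi) * ?B * exp (- x\<^sup>2 / 2))"
      using integrable_gauss by simp
    show "AE x in lborel. (\<lambda>n. of_real (sqrt (2 * pi) * exp (- x\<^sup>2 / 2)) * A (x / real (Suc n)))
        \<longlonglongrightarrow> of_real (sqrt (2 * pi) * exp (- x\<^sup>2 / 2)) * of_real ?B"
    proof (rule AE_I2, intro tendsto_mult tendsto_const)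
      fix x
      have "(\<lambda>n. x / real (Suc n)) \<longlonglongrightarrow> 0" by real_asymp
      then show "(\<lambda>n. A (x / real (Suc n))) \<longlonglongrightarrow> of_real ?B"
        unfolding A_def by (rule autocorrelation_continuous_0[OF fs])
    qed
    show "AE x in lborel. norm (of_real (sqrt (2 * pi) * exp (- x\<^sup>2 / 2)) * A (x / real (Suc n)))
        \<le> sqrt (2 * pi) * ?B * exp (- x\<^sup>2 / 2)" for n
      using norm_autocorrelation_le[OF fs] by (auto simp: norm_mult A_def mult_ac intro!: mult_left_mono)
  qed measurable
  also have "(LBINT x. of_real (sqrt (2 * pi) * exp (- x\<^sup>2 / 2)) * complex_of_real ?B)
      = of_real (LBINT x. sqrt (2 * pi) * ?B * exp (- x\<^sup>2 / 2))"
    unfolding integral_complex_of_real[symmetric] by (simp add: mult_ac)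
  also have "(LBINT x. sqrt (2 * pi) * ?B * exp (- x\<^sup>2 / 2)) = 2 * pi * ?B"
    using integral_gauss by simp
  finally have "(\<lambda>n. complex_of_real (J n)) \<longlonglongrightarrow> of_real (2 * pi * ?B)"
    by (simp only: J)
  then have Jlim: "J \<longlonglongrightarrow> 2 * pi * ?B"
    by (simp only: tendsto_of_real_iff)
  have g_inc: "incseq (\<lambda>n. g n \<xi>)" for \<xi>
    unfolding incseq_def g_def
    by (auto simp: power_divide intro!: divide_left_mono power_mono mult_pos_pos)
  have g_lim: "(\<lambda>n. g n \<xi>) \<longlonglongrightarrow> 1" for \<xi>
  proof -
    have "(\<lambda>n. \<xi> / real (Suc n)) \<longlonglongrightarrow> 0" by real_asymp
    then have "(\<lambda>n. exp (- (\<xi> / real (Suc n))\<^sup>2 / 2)) \<longlonglongrightarrow> exp (- 0\<^sup>2 / 2)"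
      by (intro tendsto_intros) auto
    then show ?thesis by (simp add: g_def)
  qed
  \<comment> \<open>Integrability of the squared transform is not known beforehand. Monotone
    convergence delivers it together with the value of the integral.\<close>
  have hb: "has_bochner_integral lborel (\<lambda>\<xi>. (norm (Ff \<xi>))\<^sup>2) (2 * pi * ?B)"
  proof (rule has_bochner_integral_monotone_convergence[OF Ji])
    show "AE \<xi> in lborel. incseq (\<lambda>n. (norm (Ff \<xi>))\<^sup>2 * g n \<xi>)"
      using g_inc by (auto simp: incseq_def intro!: mult_left_mono)
    have "(\<lambda>n. (norm (Ff \<xi>))\<^sup>2 * g n \<xi>) \<longlonglongrightarrow> (norm (Ff \<xi>))\<^sup>2 * 1" for \<xi>
      by (intro tendsto_intros g_lim)
    then show "AE \<xi> in lborel. (\<lambda>n. (norm (Ff \<xi>))\<^sup>2 * g n \<xi>) \<longlonglongrightarrow> (norm (Ff \<xi>))\<^sup>2" by simp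
    show "(\<lambda>n. LBINT \<xi>. (norm (Ff \<xi>))\<^sup>2 * g n \<xi>) \<longlonglongrightarrow> 2 * pi * ?B"
      using Jlim unfolding J_def[abs_def] .
  qed measurable
  then show "sq lborel Ff" "(l2 lborel Ff)\<^sup>2 = 2 * pi * ?B"
    by (auto simp: sq_def l2_power2 has_bochner_integral_iff)
qed

section \<open>The Fourier transform on vector-valued square-integrable functions\<close>

text \<open>Bounded bilinearity is what permits pulling a scalar factor or a fixed vector out of a
  Bochner integral.\<close>

lemma bounded_bilinear_cscale: "bounded_bilinear (cscale :: complex \<Rightarrow> complex ^ 'n \<Rightarrow> complex ^ 'n)"
proof
  show "\<exists>K. \<forall>a (b :: complex ^ 'n). norm (cscale a b) \<le> norm a * norm b * K"
  proof (intro exI allI)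
    fix a :: complex and b :: "complex ^ 'n"
    have "norm (cscale a b) = norm a * norm b"
      by (simp add: cscale_def norm_vec_def norm_mult L2_set_right_distrib)
    then show "norm (cscale a b) \<le> norm a * norm b * 1" by simp
  qed
qed (auto simp: cscale_def vec_eq_iff algebra_simps)

lemma norm_cscale [simp]: "norm (cscale c v) = norm c * norm v"
  by (simp add: cscale_def norm_vec_def norm_mult L2_set_right_distrib)

lemma cscale_nth [simp]: "cscale c v $ i = c * v $ i"
  by (simp add: cscale_def)

lemma cscale_cscale: "cscale a (cscale b v) = cscale (a * b) v"
  by (simp add: vec_eq_iff mult.assoc)

lemma cscale_1 [simp]: "cscale 1 v = v"
  by (simp add: vec_eq_iff)

lemma cscale_scaleR: "cscale a (r *\<^sub>R v) = r *\<^sub>R cscale a v"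
  "r *\<^sub>R cscale a v = cscale (of_real r * a) v"
  by (simp_all add: vec_eq_iff scaleR_conv_of_real[where 'a=complex])

lemma cscale_diff: "cscale a (v - w) = cscale a v - cscale a w"
  by (simp add: vec_eq_iff algebra_simps)

text \<open>For the real inner product, the adjoint of multiplication by a complex number is
  multiplication by its conjugate.\<close>

lemma inner_cscale: "cscale a v \<bullet> w = v \<bullet> cscale (cnj a) w"
  unfolding inner_vec_def
  by (intro sum.cong refl) (simp add: inner_complex_def algebra_simps)

lemma borel_measurable_cscale [measurable (raw)]:
  assumes "c \<in> borel_measurable M" "v \<in> borel_measurable M"
  shows "(\<lambda>x. cscale (c x) (v x)) \<in> borel_measurable M"
  by (rule borel_measurable_continuous_Pair[OF assms])
    (intro bounded_bilinear.continuous_on[OF bounded_bilinear_cscale] continuous_intros)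

text \<open>The bridge from the completed measure to Borel functions, to which Fubini on products of
  \<open>lborel\<close> applies. The completion result is about real-valued functions, so
  representatives are chosen for each coordinate and reassembled along the finite basis.\<close>

lemma lborel_representative:
  fixes g :: "'a::euclidean_space \<Rightarrow> 'b::euclidean_space"
  assumes "g \<in> borel_measurable lebesgue"
  obtains g' where "g' \<in> borel_measurable lborel" "AE x in lebesgue. g x = g' x"
proof -
  have "\<exists>h. h \<in> borel_measurable lborel \<and> (AE x in lborel. g x \<bullet> b = h x)" for b
    using completion_ex_borel_measurable_real[of "\<lambda>x. g x \<bullet> b" lborel] assms by auto
  then obtain h where h: "\<And>b. h b \<in> borel_measurable lborel" "\<And>b. AE x in lborel. g x \<bullet> b = h b x"
    by metis
  define g' where "g' x = (\<Sum>b\<in>Basis. h b x *\<^sub>R b)" for x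
  have "g' \<in> borel_measurable lborel"
    unfolding g'_def using h(1) by (intro borel_measurable_sum borel_measurable_scaleR) auto
  moreover have "AE x in lborel. \<forall>b\<in>Basis. g x \<bullet> b = h b x"
    using h(2) by (intro AE_finite_allI) auto
  then have "AE x in lborel. g x = g' x"
    by eventually_elim (metis (no_types, lifting) euclidean_representation g'_def sum.cong)
  then have "AE x in lebesgue. g x = g' x" by (rule AE_completion)
  ultimately show ?thesis by (rule that)
qed

lemma measurable_lebesgue_lborel: "f \<in> borel_measurable lborel \<Longrightarrow> f \<in> borel_measurable lebesgue"
  by (intro measurable_completion) auto

lemma sq_lebesgue_iff: "f \<in> borel_measurable lborel \<Longrightarrow> sq lebesgue f \<longleftrightarrow> sq lborel f"
  unfolding sq_def by (auto simp: integrable_completion measurable_lebesgue_lborel)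

lemma l2_lebesgue_eq: "f \<in> borel_measurable lborel \<Longrightarrow> l2 lebesgue f = l2 lborel f"
  unfolding l2_def by (subst integral_completion) auto

section \<open>The unitary Fourier integral on integrable functions\<close>

definition fker :: "real \<Rightarrow> complex" where
  "fker r = exp (\<i> * of_real r) / of_real (sqrt (2 * pi))"

lemma borel_measurable_fker [measurable]: "fker \<in> borel_measurable borel"
  unfolding fker_def by measurable

lemma norm_fker: "cmod (fker r) = 1 / sqrt (2 * pi)"
  by (simp add: fker_def norm_divide)

lemma cnj_fker: "cnj (fker r) = fker (- r)"
  by (simp add: fker_def exp_cnj)

lemma fker_lebesgue: "(\<lambda>t. fker (c * t)) \<in> borel_measurable lebesgue"
  by (rule measurable_lebesgue_lborel) measurable

text \<open>The sign parameter lets one development serve the transform and its inverse. For a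
  non-integrable \<open>g\<close> the integral is 0 by convention, so only integrable functions and
  truncations are fed to it in what follows.\<close>

definition ft :: "real \<Rightarrow> (real \<Rightarrow> complex ^ 'n) \<Rightarrow> real \<Rightarrow> complex ^ 'n" where
  "ft \<sigma> g \<xi> = (LINT t|lebesgue. cscale (fker (\<sigma> * \<xi> * t)) (g t))"

definition cutoff :: "real \<Rightarrow> (real \<Rightarrow> 'b::real_vector) \<Rightarrow> real \<Rightarrow> 'b" where
  "cutoff R g t = indicator {-R..R} t *\<^sub>R g t"

lemma ft_cong_AE:
  assumes "f \<in> borel_measurable lebesgue" "g \<in> borel_measurable lebesgue" "AE t in lebesgue. f t = g t"
  shows "ft \<sigma> f = ft \<sigma> g"
proof
  fix \<xi>
  note [measurable] = assms(1,2)
  note [measurable] = fker_lebesgue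
  show "ft \<sigma> f \<xi> = ft \<sigma> g \<xi>"
    unfolding ft_def by (intro integral_cong_AE) (use assms in \<open>auto elim!: eventually_mono\<close>)
qed

lemma ft_integrable:
  assumes "integrable lebesgue g"
  shows "integrable lebesgue (\<lambda>t. cscale (fker (\<sigma> * \<xi> * t)) (g t))"
proof -
  note [measurable] = borel_measurable_integrable[OF assms]
  note [measurable] = fker_lebesgue
  show ?thesis
    by (rule Bochner_Integration.integrable_bound[OF integrable_scaleR_right[OF assms, of "1 / sqrt (2 * pi)"]])
      (auto simp: norm_fker)
qed

lemma ft_diff:
  assumes "integrable lebesgue f" "integrable lebesgue g"
  shows "ft \<sigma> (\<lambda>t. f t - g t) = (\<lambda>\<xi>. ft \<sigma> f \<xi> - ft \<sigma> g \<xi>)"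
  unfolding ft_def cscale_diff
  by (intro ext Bochner_Integration.integral_diff ft_integrable assms)

lemma ft_lborel:
  assumes "g \<in> borel_measurable lborel"
  shows "ft \<sigma> g \<xi> = (LBINT t. cscale (fker (\<sigma> * \<xi> * t)) (g t))"
proof -
  note [measurable] = assms
  show ?thesis unfolding ft_def by (subst integral_completion) measurable
qed

lemma ft_borel_measurable:
  assumes "g \<in> borel_measurable lborel"
  shows "ft \<sigma> g \<in> borel_measurable lborel"
proof -
  note [measurable] = assms
  show ?thesis unfolding ft_lborel[OF assms, abs_def] by measurable
qed

text \<open>Squared norms add over the coordinates, which reduces the claim to scalars; the factor 2
  pi of the scalar identity is absorbed by the normalisation of \<open>fker\<close>.\<close>

lemma plancherel_lborel:
  fixes g :: "real \<Rightarrow> complex ^ 'n"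
  assumes gi: "integrable lborel g" and gs: "sq lborel g" and s: "\<sigma>\<^sup>2 = 1"
  shows "sq lborel (ft \<sigma> g)" "l2 lborel (ft \<sigma> g) = l2 lborel g"
proof -
  note g_meas [measurable] = sqD_measurable[OF gs]
  have nth: "bounded_linear (\<lambda>v :: complex ^ 'n. v $ i)" for i by (rule bounded_linear_vec_nth)
  have ei: "integrable lborel (\<lambda>t. cscale (fker (\<sigma> * \<xi> * t)) (g t))" for \<xi>
    using ft_integrable[of g \<sigma> \<xi>] gi by (simp add: integrable_completion)
  define F where "F i \<xi> = (LBINT t. exp (\<i> * of_real (\<sigma> * \<xi> * t)) * g t $ i)" for i \<xi>
  have comp: "ft \<sigma> g \<xi> $ i = F i \<xi> / of_real (sqrt (2 * pi))" for \<xi> i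
    unfolding ft_lborel[OF g_meas] F_def
    by (subst integral_bounded_linear[OF nth ei, symmetric]) (simp add: fker_def)
  have gis: "sq lborel (\<lambda>t. g t $ i)" for i
  proof (rule sq_bound[OF gs, of _ 1])
    show "(\<lambda>t. g t $ i) \<in> borel_measurable lborel"
      by (rule borel_measurable_continuous_on[OF _ g_meas]) (intro continuous_intros)
  qed (simp add: Finite_Cartesian_Product.norm_nth_le)
  have gii: "integrable lborel (\<lambda>t. g t $ i)" for i
    by (rule integrable_bounded_linear[OF nth gi])
  note pl = plancherel_scalar[OF gii gis s, folded F_def]
  have n2: "(norm v)\<^sup>2 = (\<Sum>i\<in>UNIV. (norm (v $ i))\<^sup>2)" for v :: "complex ^ 'n"
    by (simp add: norm_vec_def L2_set_def sum_nonneg)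
  have eq: "(norm (ft \<sigma> g \<xi>))\<^sup>2 = (\<Sum>i\<in>UNIV. (norm (F i \<xi>))\<^sup>2 / (2 * pi))" for \<xi>
    unfolding n2 comp by (simp add: norm_divide power_divide)
  have "integrable lborel (\<lambda>\<xi>. \<Sum>i\<in>UNIV. (norm (F i \<xi>))\<^sup>2 / (2 * pi))"
    using sqD_integrable[OF pl(1)] by auto
  then show "sq lborel (ft \<sigma> g)"
    unfolding sq_def eq using ft_borel_measurable[OF g_meas] by auto
  have "(l2 lborel (ft \<sigma> g))\<^sup>2 = (\<Sum>i\<in>UNIV. (l2 lborel (F i))\<^sup>2 / (2 * pi))"
    unfolding l2_power2 eq using sqD_integrable[OF pl(1)] by (subst Bochner_Integration.integral_sum) auto
  also have "\<dots> = (\<Sum>i\<in>UNIV. (l2 lborel (\<lambda>t. g t $ i))\<^sup>2)"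
    by (simp add: pl(2))
  also have "\<dots> = (l2 lborel g)\<^sup>2"
    unfolding l2_power2 n2 using sqD_integrable[OF gis] by (subst Bochner_Integration.integral_sum) auto
  finally show "l2 lborel (ft \<sigma> g) = l2 lborel g"
    by (simp add: power2_eq_iff_nonneg)
qed

text \<open>Replacing g by a Borel representative leaves \<open>ft \<sigma> g\<close> unchanged at
  every point, since only integrals over t are involved.\<close>

lemma plancherel:
  fixes g :: "real \<Rightarrow> complex ^ 'n"
  assumes gi: "integrable lebesgue g" and gs: "sq lebesgue g" and s: "\<sigma>\<^sup>2 = 1"
  shows "sq lebesgue (ft \<sigma> g)" "l2 lebesgue (ft \<sigma> g) = l2 lebesgue g"
proof -
  note g_meas = sqD_measurable[OF gs]
  obtain g' where g': "g' \<in> borel_measurable lborel" "AE x in lebesgue. g x = g' x"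
    using lborel_representative[OF g_meas] .
  note g'm = measurable_lebesgue_lborel[OF g'(1)]
  have "integrable lebesgue g'"
    using integrable_cong_AE_imp[OF gi g'm] g'(2) by (auto elim: eventually_mono)
  then have i: "integrable lborel g'" using g'(1) by (simp add: integrable_completion)
  have s': "sq lborel g'"
    using sq_cong_AE[OF gs g'm g'(2)] g'(1) by (simp add: sq_lebesgue_iff)
  have eq: "ft \<sigma> g = ft \<sigma> g'" by (rule ft_cong_AE[OF g_meas g'm g'(2)])
  note m = ft_borel_measurable[OF g'(1)]
  show "sq lebesgue (ft \<sigma> g)"
    unfolding eq sq_lebesgue_iff[OF m] by (rule plancherel_lborel[OF i s' s])
  show "l2 lebesgue (ft \<sigma> g) = l2 lebesgue g"
    unfolding eq l2_lebesgue_eq[OF m] plancherel_lborel[OF i s' s] l2_cong_AE[OF g_meas g'm g'(2)]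
      l2_lebesgue_eq[OF g'(1)] ..
qed

text \<open>Fubini moves the kernel from one factor to the other, where it appears conjugated, that
  is, with the opposite sign. Integrability on the product comes from the bound |f(x)| |h(t)| / sqrt
  (2 pi).\<close>

lemma ft_adjoint_lborel:
  fixes f h :: "real \<Rightarrow> complex ^ 'n"
  assumes f: "integrable lborel f" and h: "integrable lborel h"
  shows "(LBINT x. f x \<bullet> ft (-\<sigma>) h x) = (LBINT x. ft \<sigma> f x \<bullet> h x)"
proof -
  note fm [measurable] = borel_measurable_integrable[OF f]
  note hm [measurable] = borel_measurable_integrable[OF h]
  have ei: "integrable lborel (\<lambda>t. cscale (fker (r * t)) (g t))" if "integrable lborel g" for r and g :: "real \<Rightarrow> complex ^ 'n"
  proof -
    note [measurable] = borel_measurable_integrable[OF that]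
    show ?thesis
      by (rule Bochner_Integration.integrable_bound[OF integrable_scaleR_right[OF that, of "1 / sqrt (2 * pi)"]])
        (auto simp: norm_fker)
  qed
  have eq: "f x \<bullet> cscale (fker (-\<sigma> * x * t)) (h t) = cscale (fker (\<sigma> * t * x)) (f x) \<bullet> h t" for x t
    by (simp add: inner_cscale cnj_fker mult_ac)
  have pair: "integrable (lborel \<Otimes>\<^sub>M lborel) (\<lambda>(x, t). f x \<bullet> cscale (fker (-\<sigma> * x * t)) (h t))"
  proof (rule lborel_pair.Fubini_integrable)
    have *: "norm (f x \<bullet> cscale (fker (-\<sigma> * x * t)) (h t)) \<le> norm (f x) * norm (h t) / sqrt (2 * pi)" for x t
      using Cauchy_Schwarz_ineq2[of "f x" "cscale (fker (-\<sigma> * x * t)) (h t)"] by (simp add: norm_fker)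
    have i: "integrable lborel (\<lambda>t. f x \<bullet> cscale (fker (-\<sigma> * x * t)) (h t))" for x
      by (rule integrable_inner_right[OF ei[OF h]])
    then show "AE x in lborel. integrable lborel (\<lambda>t. case (x, t) of (x, t) \<Rightarrow> f x \<bullet> cscale (fker (-\<sigma> * x * t)) (h t))"
      by simp
    have "integrable lborel (\<lambda>x. LBINT t. norm (f x \<bullet> cscale (fker (-\<sigma> * x * t)) (h t)))"
    proof (rule Bochner_Integration.integrable_bound)
      show "integrable lborel (\<lambda>x. norm (f x) * ((LBINT t. norm (h t)) / sqrt (2 * pi)))"
        using f by simp
      have "(LBINT t. norm (f x \<bullet> cscale (fker (-\<sigma> * x * t)) (h t))) \<le> (LBINT t. norm (f x) * norm (h t) / sqrt (2 * pi))" for x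
        by (intro integral_mono integrable_norm i * integrable_divide integrable_mult_right h)
      then show "AE x in lborel. norm (LBINT t. norm (f x \<bullet> cscale (fker (-\<sigma> * x * t)) (h t))) \<le>
          norm (norm (f x) * ((LBINT t. norm (h t)) / sqrt (2 * pi)))"
        by (auto simp: abs_mult)
    qed measurable
    then show "integrable lborel (\<lambda>x. LBINT t. norm (case (x, t) of (x, t) \<Rightarrow> f x \<bullet> cscale (fker (-\<sigma> * x * t)) (h t)))"
      by simp
  qed measurable
  have "(LBINT x. f x \<bullet> ft (-\<sigma>) h x) = (LBINT x. LBINT t. f x \<bullet> cscale (fker (-\<sigma> * x * t)) (h t))"
    unfolding ft_lborel[OF hm]
    by (intro Bochner_Integration.integral_cong refl integral_inner_right[OF ei[OF h], symmetric])
  also have "\<dots> = (LBINT t. LBINT x. f x \<bullet> cscale (fker (-\<sigma> * x * t)) (h t))"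
    by (rule lborel_pair.Fubini_integral[symmetric]) (use pair in simp)
  also have "\<dots> = (LBINT t. LBINT x. cscale (fker (\<sigma> * t * x)) (f x) \<bullet> h t)"
    unfolding eq ..
  also have "\<dots> = (LBINT x. ft \<sigma> f x \<bullet> h x)"
    unfolding ft_lborel[OF fm]
    by (intro Bochner_Integration.integral_cong refl integral_inner_left[OF ei[OF f]])
  finally show ?thesis .
qed

lemma ft_adjoint:
  fixes f h :: "real \<Rightarrow> complex ^ 'n"
  assumes f: "integrable lebesgue f" and h: "integrable lebesgue h"
  shows "(LINT x|lebesgue. f x \<bullet> ft (-\<sigma>) h x) = (LINT x|lebesgue. ft \<sigma> f x \<bullet> h x)"
proof -
  note fm = borel_measurable_integrable[OF f] and hm = borel_measurable_integrable[OF h]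
  obtain f' where f': "f' \<in> borel_measurable lborel" "AE x in lebesgue. f x = f' x"
    using lborel_representative[OF fm] .
  obtain h' where h': "h' \<in> borel_measurable lborel" "AE x in lebesgue. h x = h' x"
    using lborel_representative[OF hm] .
  note f'm = measurable_lebesgue_lborel[OF f'(1)] and h'm = measurable_lebesgue_lborel[OF h'(1)]
  have i: "integrable lborel f'" "integrable lborel h'"
    using integrable_cong_AE_imp[OF f f'm] integrable_cong_AE_imp[OF h h'm] f' h'
    by (auto elim: eventually_mono simp: integrable_completion)
  note [measurable] = ft_borel_measurable[OF f'(1)] ft_borel_measurable[OF h'(1)] f'(1) h'(1)
  note fm [measurable] hm [measurable] f'm [measurable] h'm [measurable]
    measurable_lebesgue_lborel[OF ft_borel_measurable[OF f'(1)], measurable]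
    measurable_lebesgue_lborel[OF ft_borel_measurable[OF h'(1)], measurable]
  have "(LINT x|lebesgue. f x \<bullet> ft (-\<sigma>) h x) = (LINT x|lebesgue. f' x \<bullet> ft (-\<sigma>) h' x)"
    unfolding ft_cong_AE[OF hm h'm h'(2)] by (intro integral_cong_AE) (use f' in \<open>auto elim!: eventually_mono\<close>)
  also have "\<dots> = (LBINT x. f' x \<bullet> ft (-\<sigma>) h' x)" by (rule integral_completion) measurable
  also have "\<dots> = (LBINT x. ft \<sigma> f' x \<bullet> h' x)" by (rule ft_adjoint_lborel[OF i])
  also have "\<dots> = (LINT x|lebesgue. ft \<sigma> f' x \<bullet> h' x)" by (rule integral_completion[symmetric]) measurable
  also have "\<dots> = (LINT x|lebesgue. ft \<sigma> f x \<bullet> h x)"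
    unfolding ft_cong_AE[OF fm f'm f'(2)] by (intro integral_cong_AE) (use h' in \<open>auto elim!: eventually_mono\<close>)
  finally show ?thesis .
qed


section \<open>Truncation to bounded intervals and limits in L2\<close>

lemma norm_cut_le: "norm (cutoff R g t) \<le> norm (g t)"
  by (simp add: cutoff_def indicator_def)

lemma cut_measurable:
  fixes g :: "real \<Rightarrow> 'b::euclidean_space"
  assumes "g \<in> borel_measurable lebesgue"
  shows "cutoff R g \<in> borel_measurable lebesgue"
  unfolding cutoff_def[abs_def] using assms
  by (intro borel_measurable_scaleR measurable_lebesgue_lborel[OF borel_measurable_indicator]) auto

lemma cut_diff: "cutoff R (\<lambda>t. f t - g t) = (\<lambda>t. cutoff R f t - cutoff R g t)"
  by (simp add: cutoff_def[abs_def] scaleR_diff_right)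

lemma sq_cut:
  assumes g: "sq lebesgue g"
  shows "sq lebesgue (cutoff R g)"
proof (rule sq_bound(1)[OF g, where C=1])
  show "cutoff R g \<in> borel_measurable lebesgue"
    by (rule cut_measurable[OF sqD_measurable[OF g]])
qed (simp add: norm_cut_le)

text \<open>The indicator of a bounded interval is square-integrable, so its product with
  \<open>g\<close> is integrable. This is why the transform of a truncation is a genuine
  integral.\<close>

lemma integrable_cut:
  assumes g: "sq lebesgue g"
  shows "integrable lebesgue (cutoff R g)"
proof (rule Bochner_Integration.integrable_bound)
  have "sq lebesgue (\<lambda>x. 1 * indicator {-R..R} x :: real)"
    using sq_indicator_interval[of 1 "-R" R] by (subst sq_lebesgue_iff) auto
  from integrable_norm_mult[OF this g]
  show "integrable lebesgue (\<lambda>x. norm (indicator {-R..R} x :: real) * norm (g x))" by simp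
  show "cutoff R g \<in> borel_measurable lebesgue"
    by (rule cut_measurable[OF sqD_measurable[OF g]])
qed (simp add: cutoff_def)

text \<open>Dominated convergence handles integer radii; the tail decreases with the radius, which
  extends the limit to all real radii.\<close>

lemma l2_cut_tendsto:
  assumes g: "sq lebesgue g"
  shows "((\<lambda>R. l2 lebesgue (\<lambda>t. g t - cutoff R g t)) \<longlongrightarrow> 0) at_top"
proof -
  have "(\<lambda>n. l2 lebesgue (\<lambda>t. cutoff (real n) g t - g t)) \<longlonglongrightarrow> 0"
  proof (rule l2_dominated(3)[OF sq_norm[OF g] cut_measurable[OF sqD_measurable[OF g]] sqD_measurable[OF g]])
    show "AE t in lebesgue. (\<lambda>n. cutoff (real n) g t) \<longlonglongrightarrow> g t"
    proof (rule AE_I2)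
      fix t
      obtain m :: nat where "\<bar>t\<bar> \<le> real m" using real_arch_simple by blast
      then have "\<forall>\<^sub>F n in sequentially. cutoff (real n) g t = g t"
        by (intro eventually_sequentiallyI[of m]) (auto simp: cutoff_def indicator_def)
      then show "(\<lambda>n. cutoff (real n) g t) \<longlonglongrightarrow> g t" by (rule tendsto_eventually)
    qed
  qed (simp add: norm_cut_le)
  then have lim: "(\<lambda>n. l2 lebesgue (\<lambda>t. g t - cutoff (real n) g t)) \<longlonglongrightarrow> 0"
    by (simp add: l2_minus_commute[of lebesgue g])
  have mono: "l2 lebesgue (\<lambda>t. g t - cutoff R g t) \<le> l2 lebesgue (\<lambda>t. g t - cutoff S g t)" if "S \<le> R" for R S
  proof -
    have "norm (g t - cutoff R g t) \<le> 1 * norm (g t - cutoff S g t)" for t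
      using that by (auto simp: cutoff_def indicator_def)
    then show ?thesis
      using sq_bound(2)[OF sq_diff[OF g sq_cut[OF g, of S]] sqD_measurable[OF sq_diff[OF g sq_cut[OF g, of R]]], of 1]
      by auto
  qed
  show ?thesis
  proof (rule tendstoI)
    fix e :: real assume e: "0 < e"
    have "\<forall>\<^sub>F n in sequentially. l2 lebesgue (\<lambda>t. g t - cutoff (real n) g t) < e"
      by (rule order_tendstoD(2)[OF lim e])
    then obtain n :: nat where n: "l2 lebesgue (\<lambda>t. g t - cutoff (real n) g t) < e"
      using eventually_happens'[OF sequentially_bot] by blast
    show "\<forall>\<^sub>F R in at_top. dist (l2 lebesgue (\<lambda>t. g t - cutoff R g t)) 0 < e"
      using eventually_ge_at_top[of "real n"]
      by eventually_elim (use mono n in \<open>auto intro: le_less_trans\<close>)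
  qed
qed

lemma l2_tendsto:
  assumes f: "\<And>x. sq M (f x)" and g: "sq M g" and lim: "((\<lambda>x. l2 M (\<lambda>t. g t - f x t)) \<longlongrightarrow> 0) F"
  shows "((\<lambda>x. l2 M (f x)) \<longlongrightarrow> l2 M g) F"
proof -
  have "((\<lambda>x. l2 M (f x) - l2 M g) \<longlongrightarrow> 0) F"
  proof (rule Lim_null_comparison[OF _ lim])
    show "\<forall>\<^sub>F x in F. norm (l2 M (f x) - l2 M g) \<le> l2 M (\<lambda>t. g t - f x t)"
      using l2_abs_diff_le[OF f g] by (simp add: l2_minus_commute[of M g])
  qed
  then show ?thesis by (simp add: LIM_zero_iff)
qed

text \<open>Norm convergence implies weak convergence, by Cauchy-Schwarz. It carries the adjoint
  identity from truncations to the extended transform.\<close>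

lemma inner_l2_tendsto:
  assumes f: "\<And>x. sq M (f x)" and g: "sq M g" and h: "sq M h"
    and lim: "((\<lambda>x. l2 M (\<lambda>t. g t - f x t)) \<longlongrightarrow> 0) F"
  shows "((\<lambda>x. LINT t|M. f x t \<bullet> h t) \<longlongrightarrow> (LINT t|M. g t \<bullet> h t)) F"
proof -
  have *: "\<bar>(LINT t|M. f x t \<bullet> h t) - (LINT t|M. g t \<bullet> h t)\<bar> \<le> l2 M (\<lambda>t. g t - f x t) * l2 M h" for x
  proof -
    have "(LINT t|M. f x t \<bullet> h t) - (LINT t|M. g t \<bullet> h t) = (LINT t|M. (f x t - g t) \<bullet> h t)"
      unfolding inner_diff_left
      by (rule Bochner_Integration.integral_diff[symmetric]; rule integrable_inner_sq[OF _ h]; rule f g)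
    also have "\<bar>\<dots>\<bar> \<le> l2 M (\<lambda>t. f x t - g t) * l2 M h"
      by (rule abs_integral_inner_le[OF sq_diff[OF f g] h])
    finally show ?thesis by (simp add: l2_minus_commute[of M g])
  qed
  have "((\<lambda>x. l2 M (\<lambda>t. g t - f x t) * l2 M h) \<longlongrightarrow> 0) F"
    by (rule tendsto_mult_left_zero[OF lim])
  then have "((\<lambda>x. (LINT t|M. f x t \<bullet> h t) - (LINT t|M. g t \<bullet> h t)) \<longlongrightarrow> 0) F"
    by (rule Lim_null_comparison[rotated]) (use * in simp)
  then show ?thesis by (simp add: LIM_zero_iff)
qed

text \<open>\<open>Frel \<sigma> g G\<close>: the square-integrable extension of \<^const>\<open>ft\<close> maps \<open>g\<close> to \<open>G\<close>; the sign \<open>\<sigma> = -1\<close> gives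
  the Fourier transform, \<open>\<sigma> = 1\<close> its inverse.\<close>
definition Frel :: "real \<Rightarrow> (real \<Rightarrow> complex ^ 'n) \<Rightarrow> (real \<Rightarrow> complex ^ 'n) \<Rightarrow> bool" where
  "Frel \<sigma> g G \<longleftrightarrow> sq lebesgue g \<and> sq lebesgue G \<and>
     ((\<lambda>R. l2 lebesgue (\<lambda>\<xi>. G \<xi> - ft \<sigma> (cutoff R g) \<xi>)) \<longlongrightarrow> 0) at_top"

lemma FrelD:
  assumes "Frel \<sigma> g G"
  shows "sq lebesgue g" "sq lebesgue G"
    "((\<lambda>R. l2 lebesgue (\<lambda>\<xi>. G \<xi> - ft \<sigma> (cutoff R g) \<xi>)) \<longlongrightarrow> 0) at_top"
  using assms by (auto simp: Frel_def)

section \<open>The unitary extension of the Fourier transform as a relation\<close>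

context
  fixes \<sigma> :: real
  assumes s: "\<sigma>\<^sup>2 = 1"
begin

lemma sq_ft_cut: "sq lebesgue g \<Longrightarrow> sq lebesgue (ft \<sigma> (cutoff R g))"
  and l2_ft_cut: "sq lebesgue g \<Longrightarrow> l2 lebesgue (ft \<sigma> (cutoff R g)) = l2 lebesgue (cutoff R g)"
  by (intro plancherel integrable_cut sq_cut s; assumption)+

text \<open>The norms of the transformed truncations converge both to the norm of G, by definition
  of the relation, and to the norm of g, by Plancherel for truncations.\<close>

lemma Frel_isometry:
  assumes "Frel \<sigma> g G"
  shows "l2 lebesgue G = l2 lebesgue g"
proof (rule tendsto_unique[OF trivial_limit_at_top_linorder])
  note g = FrelD[OF assms]
  show "((\<lambda>R. l2 lebesgue (ft \<sigma> (cutoff R g))) \<longlongrightarrow> l2 lebesgue G) at_top"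
    by (rule l2_tendsto[OF sq_ft_cut[OF g(1)] g(2,3)])
  show "((\<lambda>R. l2 lebesgue (ft \<sigma> (cutoff R g))) \<longlongrightarrow> l2 lebesgue g) at_top"
    unfolding l2_ft_cut[OF g(1)] by (rule l2_tendsto[OF sq_cut[OF g(1)] g(1) l2_cut_tendsto[OF g(1)]])
qed

lemma Frel_diff:
  assumes f: "Frel \<sigma> f F" and g: "Frel \<sigma> g G"
  shows "Frel \<sigma> (\<lambda>t. f t - g t) (\<lambda>\<xi>. F \<xi> - G \<xi>)"
proof -
  note f = FrelD[OF f] and g = FrelD[OF g]
  have "((\<lambda>R. l2 lebesgue (\<lambda>\<xi>. (F \<xi> - G \<xi>) - ft \<sigma> (cutoff R (\<lambda>t. f t - g t)) \<xi>)) \<longlongrightarrow> 0) at_top"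
  proof (rule Lim_null_comparison)
    show "((\<lambda>R. l2 lebesgue (\<lambda>\<xi>. F \<xi> - ft \<sigma> (cutoff R f) \<xi>) + l2 lebesgue (\<lambda>\<xi>. G \<xi> - ft \<sigma> (cutoff R g) \<xi>)) \<longlongrightarrow> 0) at_top"
      by (rule tendsto_add_zero[OF f(3) g(3)])
    have "l2 lebesgue (\<lambda>\<xi>. (F \<xi> - G \<xi>) - ft \<sigma> (cutoff R (\<lambda>t. f t - g t)) \<xi>) \<le>
        l2 lebesgue (\<lambda>\<xi>. F \<xi> - ft \<sigma> (cutoff R f) \<xi>) + l2 lebesgue (\<lambda>\<xi>. G \<xi> - ft \<sigma> (cutoff R g) \<xi>)" for R
    proof -
      have *: "(F \<xi> - G \<xi>) - ft \<sigma> (cutoff R (\<lambda>t. f t - g t)) \<xi> = (F \<xi> - ft \<sigma> (cutoff R f) \<xi>) - (G \<xi> - ft \<sigma> (cutoff R g) \<xi>)" for \<xi>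
        unfolding cut_diff ft_diff[OF integrable_cut[OF f(1)] integrable_cut[OF g(1)]] by simp
      show ?thesis
        unfolding *
        using l2_diff_triangle[OF sq_diff[OF f(2) sq_ft_cut[OF f(1), of R]] sq_diff[OF g(2) sq_ft_cut[OF g(1), of R]]] .
    qed
    then show "\<forall>\<^sub>F R in at_top. norm (l2 lebesgue (\<lambda>\<xi>. (F \<xi> - G \<xi>) - ft \<sigma> (cutoff R (\<lambda>t. f t - g t)) \<xi>)) \<le>
        l2 lebesgue (\<lambda>\<xi>. F \<xi> - ft \<sigma> (cutoff R f) \<xi>) + l2 lebesgue (\<lambda>\<xi>. G \<xi> - ft \<sigma> (cutoff R g) \<xi>)"
      by simp
  qed
  then show ?thesis
    unfolding Frel_def using sq_diff f g by blast
qed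

lemma Frel_cong_AE:
  assumes f: "Frel \<sigma> f F" and g: "g \<in> borel_measurable lebesgue" "AE t in lebesgue. f t = g t"
    and G: "G \<in> borel_measurable lebesgue" "AE t in lebesgue. F t = G t"
  shows "Frel \<sigma> g G"
proof -
  note f = FrelD[OF f]
  have sg: "sq lebesgue g" and sG: "sq lebesgue G"
    using sq_cong_AE[OF f(1) g] sq_cong_AE[OF f(2) G] by auto
  have eq: "ft \<sigma> (cutoff R f) = ft \<sigma> (cutoff R g)" for R
    by (rule ft_cong_AE) (use f(1) g in \<open>auto intro!: cut_measurable simp: sq_def cutoff_def elim!: eventually_mono\<close>)
  have "l2 lebesgue (\<lambda>\<xi>. F \<xi> - ft \<sigma> (cutoff R f) \<xi>) = l2 lebesgue (\<lambda>\<xi>. G \<xi> - ft \<sigma> (cutoff R g) \<xi>)" for R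
    unfolding eq
    by (intro l2_cong_AE sqD_measurable[OF sq_diff] f sG sq_ft_cut sg) (use G(2) in \<open>auto elim!: eventually_mono\<close>)
  then show ?thesis using f(3) sg sG by (simp add: Frel_def)
qed

text \<open>The difference of two images of g is an image of 0, hence has norm 0 by
  isometry.\<close>

lemma Frel_unique:
  assumes "Frel \<sigma> g G" "Frel \<sigma> g H"
  shows "AE \<xi> in lebesgue. G \<xi> = H \<xi>"
proof -
  have "Frel \<sigma> (\<lambda>t. g t - g t) (\<lambda>\<xi>. G \<xi> - H \<xi>)" by (rule Frel_diff[OF assms])
  from Frel_isometry[OF this] FrelD(2)[OF this] show ?thesis
    by (auto simp: l2_eq_0_iff l2_def[of _ "\<lambda>_. 0"])
qed

text \<open>By linearity and Plancherel the error of the truncated transform has exactly the norm of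
  the tail of g, so on integrable functions the extension is given by the integral itself.\<close>

lemma Frel_L1:
  assumes gi: "integrable lebesgue g" and gs: "sq lebesgue g"
  shows "Frel \<sigma> g (ft \<sigma> g)"
proof -
  have "l2 lebesgue (\<lambda>\<xi>. ft \<sigma> g \<xi> - ft \<sigma> (cutoff R g) \<xi>) = l2 lebesgue (\<lambda>t. g t - cutoff R g t)" for R
    unfolding ft_diff[OF gi integrable_cut[OF gs], symmetric, THEN fun_cong]
    by (intro plancherel s sq_diff sq_cut gs Bochner_Integration.integrable_diff gi integrable_cut)
  then show ?thesis
    unfolding Frel_def using plancherel[OF gi gs s] l2_cut_tendsto[OF gs] gs by simp
qed

text \<open>The completeness lemma asks for summable increments, so radii are picked along which the
  tails of g fall below powers of 1/2. By Plancherel the distance of two transformed truncations is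
  at most the sum of the two tails.\<close>

lemma Frel_exists:
  assumes g: "sq lebesgue g"
  obtains G where "Frel \<sigma> g G"
proof -
  define tl where "tl R = l2 lebesgue (\<lambda>t. g t - cutoff R g t)" for R
  have tl: "(tl \<longlongrightarrow> 0) at_top"
    unfolding tl_def by (rule l2_cut_tendsto[OF g])
  have "\<exists>R. tl R < (1/2) ^ k" for k :: nat
  proof -
    have "\<forall>\<^sub>F R in at_top. tl R < (1/2) ^ k"
      by (rule order_tendstoD(2)[OF tl]) simp
    then show ?thesis using eventually_happens'[OF trivial_limit_at_top_linorder] by blast
  qed
  then obtain r where r: "\<And>k::nat. tl (r k) < (1/2) ^ k" by metis
  define F where "F k = ft \<sigma> (cutoff (r k) g)" for k
  have F: "sq lebesgue (F k)" for k unfolding F_def by (rule sq_ft_cut[OF g])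
  have dist: "l2 lebesgue (\<lambda>\<xi>. ft \<sigma> (cutoff R g) \<xi> - ft \<sigma> (cutoff S g) \<xi>) \<le> tl R + tl S" for R S
  proof -
    have "l2 lebesgue (\<lambda>\<xi>. ft \<sigma> (cutoff R g) \<xi> - ft \<sigma> (cutoff S g) \<xi>) = l2 lebesgue (\<lambda>t. cutoff R g t - cutoff S g t)"
      unfolding ft_diff[OF integrable_cut[OF g] integrable_cut[OF g], symmetric, THEN fun_cong]
      by (intro plancherel s sq_diff sq_cut g Bochner_Integration.integrable_diff integrable_cut)
    also have "\<dots> \<le> l2 lebesgue (\<lambda>t. cutoff R g t - g t) + l2 lebesgue (\<lambda>t. g t - cutoff S g t)"
      by (intro l2_triangle sq_cut g)
    finally show ?thesis by (simp add: tl_def l2_minus_commute[of lebesgue g])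
  qed
  have sm: "summable (\<lambda>k. l2 lebesgue (\<lambda>\<xi>. F (Suc k) \<xi> - F k \<xi>))"
  proof (rule summable_comparison_test')
    show "summable (\<lambda>k. 2 * (1/2::real) ^ k)" by (intro summable_mult summable_geometric) simp
    show "norm (l2 lebesgue (\<lambda>\<xi>. F (Suc k) \<xi> - F k \<xi>)) \<le> 2 * (1/2) ^ k" if "0 \<le> k" for k
    proof -
      have "tl (r (Suc k)) \<le> (1/2) ^ k"
        using r[of "Suc k"] by (intro order_trans[OF less_imp_le[OF r[of "Suc k"]]]) (simp add: power_decreasing)
      then show ?thesis using dist[of "r (Suc k)" "r k"] r[of k] by (simp add: F_def)
    qed
  qed
  obtain G where G: "sq lebesgue G" "(\<lambda>k. l2 lebesgue (\<lambda>\<xi>. F k \<xi> - G \<xi>)) \<longlonglongrightarrow> 0"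
    by (rule l2_complete[OF F sm])
  \<comment> \<open>Comparing radius R with the chosen radii and letting k tend to infinity bounds
    the error by the tail at R, which upgrades convergence along the chosen radii to convergence
    over all real R.\<close>
  have le: "l2 lebesgue (\<lambda>\<xi>. G \<xi> - ft \<sigma> (cutoff R g) \<xi>) \<le> tl R" for R
  proof (rule LIMSEQ_le_const)
    have "(\<lambda>k. (1/2::real) ^ k) \<longlonglongrightarrow> 0" by (rule LIMSEQ_power_zero) simp
    with G(2) have "(\<lambda>k. l2 lebesgue (\<lambda>\<xi>. F k \<xi> - G \<xi>) + ((1/2) ^ k + tl R)) \<longlonglongrightarrow> 0 + (0 + tl R)"
      by (intro tendsto_add tendsto_const)
    then show "(\<lambda>k. l2 lebesgue (\<lambda>\<xi>. F k \<xi> - G \<xi>) + ((1/2) ^ k + tl R)) \<longlonglongrightarrow> tl R" by simp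
    have "l2 lebesgue (\<lambda>\<xi>. G \<xi> - ft \<sigma> (cutoff R g) \<xi>) \<le> l2 lebesgue (\<lambda>\<xi>. F k \<xi> - G \<xi>) + ((1/2) ^ k + tl R)" for k
    proof -
      have "l2 lebesgue (\<lambda>\<xi>. G \<xi> - ft \<sigma> (cutoff R g) \<xi>) \<le>
          l2 lebesgue (\<lambda>\<xi>. G \<xi> - F k \<xi>) + l2 lebesgue (\<lambda>\<xi>. F k \<xi> - ft \<sigma> (cutoff R g) \<xi>)"
        by (intro l2_triangle G F sq_ft_cut g)
      then show ?thesis
        using dist[of "r k" R] r[of k] by (simp add: F_def l2_minus_commute[of lebesgue G])
    qed
    then show "\<exists>N. \<forall>k\<ge>N. l2 lebesgue (\<lambda>\<xi>. G \<xi> - ft \<sigma> (cutoff R g) \<xi>) \<le> l2 lebesgue (\<lambda>\<xi>. F k \<xi> - G \<xi>) + ((1/2) ^ k + tl R)"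
      by blast
  qed
  have "((\<lambda>R. l2 lebesgue (\<lambda>\<xi>. G \<xi> - ft \<sigma> (cutoff R g) \<xi>)) \<longlongrightarrow> 0) at_top"
    by (rule Lim_null_comparison[OF _ tl]) (use le in simp)
  with g G(1) show ?thesis by (intro that[of G]) (simp add: Frel_def)
qed

text \<open>Closedness of the graph: if H is the transform of g, then by isometry F n - H has the
  norm of f n - g, so F n tends to H as well as to G.\<close>

lemma Frel_limit:
  assumes rel: "\<And>n. Frel \<sigma> (f n) (F n)" and g: "sq lebesgue g" and G: "sq lebesgue G"
    and lim: "(\<lambda>n. l2 lebesgue (\<lambda>t. f n t - g t)) \<longlonglongrightarrow> 0" "(\<lambda>n. l2 lebesgue (\<lambda>\<xi>. F n \<xi> - G \<xi>)) \<longlonglongrightarrow> 0"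
  shows "Frel \<sigma> g G"
proof -
  obtain H where H: "Frel \<sigma> g H" by (rule Frel_exists[OF g])
  note HD = FrelD[OF H] and FD = FrelD[OF rel]
  have "l2 lebesgue (\<lambda>\<xi>. H \<xi> - G \<xi>) \<le> 0"
  proof (rule LIMSEQ_le_const)
    show "(\<lambda>n. l2 lebesgue (\<lambda>t. f n t - g t) + l2 lebesgue (\<lambda>\<xi>. F n \<xi> - G \<xi>)) \<longlonglongrightarrow> 0"
      by (rule tendsto_add_zero[OF lim])
    have "l2 lebesgue (\<lambda>\<xi>. H \<xi> - G \<xi>) \<le> l2 lebesgue (\<lambda>t. f n t - g t) + l2 lebesgue (\<lambda>\<xi>. F n \<xi> - G \<xi>)" for n
      using l2_triangle[OF HD(2) FD(2)[of n] G] Frel_isometry[OF Frel_diff[OF rel[of n] H]]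
      by (simp add: l2_minus_commute[of lebesgue H])
    then show "\<exists>N. \<forall>n\<ge>N. l2 lebesgue (\<lambda>\<xi>. H \<xi> - G \<xi>) \<le>
        l2 lebesgue (\<lambda>t. f n t - g t) + l2 lebesgue (\<lambda>\<xi>. F n \<xi> - G \<xi>)" by blast
  qed
  then have "l2 lebesgue (\<lambda>\<xi>. H \<xi> - G \<xi>) = 0" by (simp add: antisym)
  then have "AE \<xi> in lebesgue. H \<xi> = G \<xi>"
    using l2_eq_0_iff[OF sq_diff[OF HD(2) G]] by simp
  then show ?thesis
    by (intro Frel_cong_AE[OF H]) (use g G in \<open>auto simp: sq_def\<close>)
qed

end

text \<open>By Plancherel, \<open>\<parallel>g - \<F>\<^sup>*G\<^sub>R\<parallel>\<^sup>2 = \<parallel>g\<parallel>\<^sup>2 - 2\<langle>g, \<F>\<^sup>*G\<^sub>R\<rangle> + \<parallel>G\<^sub>R\<parallel>\<^sup>2\<close> for the truncation \<open>G\<^sub>R\<close> of \<open>G\<close>, and the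
  adjoint identity turns the inner product into \<open>\<langle>G, G\<^sub>R\<rangle> = \<parallel>G\<^sub>R\<parallel>\<^sup>2\<close>.\<close>
theorem Frel_inverse:
  assumes s: "\<sigma>\<^sup>2 = 1" and rel: "Frel \<sigma> g G"
  shows "Frel (- \<sigma>) G g"
proof -
  have s': "(- \<sigma>)\<^sup>2 = 1" using s by simp
  note gG = FrelD[OF rel]
  have key: "(LINT t|lebesgue. g t \<bullet> ft (-\<sigma>) (cutoff R G) t) = (l2 lebesgue (cutoff R G))\<^sup>2" for R
  proof (rule tendsto_unique[OF trivial_limit_at_top_linorder])
    show "((\<lambda>S. LINT t|lebesgue. cutoff S g t \<bullet> ft (-\<sigma>) (cutoff R G) t) \<longlongrightarrow>
        (LINT t|lebesgue. g t \<bullet> ft (-\<sigma>) (cutoff R G) t)) at_top"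
      by (rule inner_l2_tendsto[OF sq_cut[OF gG(1)] gG(1) sq_ft_cut[OF s' gG(2)] l2_cut_tendsto[OF gG(1)]])
    have "(LINT t|lebesgue. cutoff S g t \<bullet> ft (-\<sigma>) (cutoff R G) t) = (LINT t|lebesgue. ft \<sigma> (cutoff S g) t \<bullet> cutoff R G t)" for S
      by (rule ft_adjoint[OF integrable_cut[OF gG(1)] integrable_cut[OF gG(2)]])
    moreover have "((\<lambda>S. LINT t|lebesgue. ft \<sigma> (cutoff S g) t \<bullet> cutoff R G t) \<longlongrightarrow>
        (LINT t|lebesgue. G t \<bullet> cutoff R G t)) at_top"
      by (rule inner_l2_tendsto[OF sq_ft_cut[OF s gG(1)] gG(2) sq_cut[OF gG(2)] gG(3)])
    moreover have "(LINT t|lebesgue. G t \<bullet> cutoff R G t) = (l2 lebesgue (cutoff R G))\<^sup>2"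
      unfolding l2_power2
      by (intro Bochner_Integration.integral_cong refl) (simp add: cutoff_def indicator_def power2_norm_eq_inner)
    ultimately show "((\<lambda>S. LINT t|lebesgue. cutoff S g t \<bullet> ft (-\<sigma>) (cutoff R G) t) \<longlongrightarrow> (l2 lebesgue (cutoff R G))\<^sup>2) at_top"
      by simp
  qed
  have "(l2 lebesgue (\<lambda>t. g t - ft (-\<sigma>) (cutoff R G) t))\<^sup>2 = (l2 lebesgue G)\<^sup>2 - (l2 lebesgue (cutoff R G))\<^sup>2" for R
    unfolding l2_diff_power2[OF gG(1) sq_ft_cut[OF s' gG(2)]] key l2_ft_cut[OF s' gG(2)] Frel_isometry[OF s rel]
    by simp
  from this[symmetric] have eq: "l2 lebesgue (\<lambda>t. g t - ft (-\<sigma>) (cutoff R G) t) = sqrt ((l2 lebesgue G)\<^sup>2 - (l2 lebesgue (cutoff R G))\<^sup>2)" for R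
    by simp
  have "((\<lambda>R. sqrt ((l2 lebesgue G)\<^sup>2 - (l2 lebesgue (cutoff R G))\<^sup>2)) \<longlongrightarrow> sqrt ((l2 lebesgue G)\<^sup>2 - (l2 lebesgue G)\<^sup>2)) at_top"
    by (intro tendsto_intros l2_tendsto sq_cut gG(2) l2_cut_tendsto)
  then show ?thesis
    using gG by (simp add: Frel_def eq)
qed

section \<open>The kernel of fractional integration\<close>

text \<open>The integrand of Euler's Gamma integral at rate \<rho>, set to 0 for s \<le> 0; this
  one-sidedness later yields the support of the solution.\<close>

definition gamma_weight :: "real \<Rightarrow> real \<Rightarrow> real \<Rightarrow> real" where
  "gamma_weight \<rho> \<beta> s = (if 0 < s then s powr (\<beta> - 1) * exp (- \<rho> * s) else 0)"

definition gamma_transform :: "real \<Rightarrow> real \<Rightarrow> real \<Rightarrow> complex" where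
  "gamma_transform \<rho> \<beta> \<xi> = (LBINT s. of_real (gamma_weight \<rho> \<beta> s) * exp (\<i> * of_real (- \<xi> * s)))"

lemma gamma_weight_nonneg: "0 \<le> gamma_weight \<rho> \<beta> s"
  by (simp add: gamma_weight_def)

lemma borel_measurable_gamma_weight [measurable]: "gamma_weight \<rho> \<beta> \<in> borel_measurable borel"
  unfolding gamma_weight_def[abs_def] by measurable

text \<open>Euler's integral after the substitution t = \<rho> s.\<close>

lemma gamma_weight_integral:
  assumes "0 < \<rho>" "0 < \<beta>"
  shows "integrable lborel (gamma_weight \<rho> \<beta>)"
    "(LBINT s. gamma_weight \<rho> \<beta> s) = Gamma \<beta> / \<rho> powr \<beta>"
proof -
  define h where "h t = indicator {0..} t * t powr (\<beta> - 1) / exp t" for t :: real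
  have [measurable]: "h \<in> borel_measurable borel" unfolding h_def by measurable
  have "ennreal (Gamma \<beta>) = (\<integral>\<^sup>+t. ennreal (h t) \<partial>lborel)"
    unfolding h_def by (rule Gamma_conv_nn_integral_real[OF assms(2)])
  then have hb: "has_bochner_integral lborel h (Gamma \<beta>)"
    using assms by (intro has_bochner_integral_nn_integral) (auto simp: h_def Gamma_real_pos less_imp_le)
  have eq: "h (0 + \<rho> * s) = \<rho> powr (\<beta> - 1) * gamma_weight \<rho> \<beta> s" for s
    using assms by (auto simp: h_def gamma_weight_def indicator_def powr_mult exp_minus field_simps zero_le_mult_iff)
  have p: "\<rho> powr (\<beta> - 1) > 0" using assms by simp
  have "integrable lborel (\<lambda>s. \<rho> powr (\<beta> - 1) * gamma_weight \<rho> \<beta> s)"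
    using lborel_integrable_real_affine[of h \<rho> 0] hb assms unfolding eq by (simp add: has_bochner_integral_iff)
  then show "integrable lborel (gamma_weight \<rho> \<beta>)"
    using p by simp
  have "Gamma \<beta> = \<rho> * (\<rho> powr (\<beta> - 1) * (LBINT s. gamma_weight \<rho> \<beta> s))"
    using lborel_integral_real_affine[of \<rho> h 0] hb assms unfolding eq by (simp add: has_bochner_integral_iff)
  also have "\<dots> = \<rho> powr \<beta> * (LBINT s. gamma_weight \<rho> \<beta> s)"
    using assms by (simp add: powr_diff)
  finally show "(LBINT s. gamma_weight \<rho> \<beta> s) = Gamma \<beta> / \<rho> powr \<beta>"
    using assms by (simp add: field_simps)
qed

lemma gamma_weight_Suc: "gamma_weight \<rho> (\<beta> + 1) s = s * gamma_weight \<rho> \<beta> s"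
  by (simp add: gamma_weight_def powr_diff)

lemma gamma_transform_integrable:
  assumes "0 < \<rho>" "0 < \<beta>"
  shows "integrable lborel (\<lambda>s. of_real (gamma_weight \<rho> \<beta> s) * exp (\<i> * of_real (- \<xi> * s)))"
  by (rule Bochner_Integration.integrable_bound[OF gamma_weight_integral(1)[OF assms]])
    (auto simp: norm_mult)

text \<open>Integration by parts for s^\<beta> e^(-zs) with z = \<rho> + i\<xi>: the derivative of
  this function combines the integrands of both sides, and its boundary values vanish. It is the
  functional equation of Gamma along a complex line.\<close>

lemma gamma_transform_recurrence:
  assumes "0 < \<rho>" "0 < \<beta>"
  shows "Complex \<rho> \<xi> * gamma_transform \<rho> (\<beta> + 1) \<xi> = of_real \<beta> * gamma_transform \<rho> \<beta> \<xi>"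
proof -
  define z where "z = Complex \<rho> \<xi>"
  define F where "F s = of_real (s powr \<beta>) * exp (- z * of_real s)" for s :: real
  define f where "f s = of_real \<beta> * (of_real (s powr (\<beta> - 1)) * exp (- z * of_real s)) - z * (of_real (s powr \<beta>) * exp (- z * of_real s))" for s :: real
  have ez: "exp (- z * of_real s) = of_real (exp (- \<rho> * s)) * exp (\<i> * of_real (- \<xi> * s))" for s
    unfolding z_def by (simp add: Complex_eq algebra_simps flip: exp_add exp_of_real)
  have w: "of_real (gamma_weight \<rho> b s) * exp (\<i> * of_real (- \<xi> * s)) = indicator {0<..} s *\<^sub>R (of_real (s powr (b - 1)) * exp (- z * of_real s))" for s b
    unfolding ez by (simp add: gamma_weight_def indicator_def)
  have f_eq: "indicator {0<..} s *\<^sub>R f s = of_real \<beta> * (of_real (gamma_weight \<rho> \<beta> s) * exp (\<i> * of_real (- \<xi> * s)))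
      - z * (of_real (gamma_weight \<rho> (\<beta> + 1) s) * exp (\<i> * of_real (- \<xi> * s)))" for s
    unfolding w by (simp add: f_def indicator_def)
  note gi = gamma_transform_integrable[OF assms, of \<xi>] gamma_transform_integrable[OF assms(1), of "\<beta> + 1" \<xi>]
  have fi: "set_integrable lborel {0<..} f"
    unfolding set_integrable_def f_eq using gi assms by (intro Bochner_Integration.integrable_diff integrable_mult_right) auto
  have normF: "norm (F s) = s powr \<beta> * exp (- \<rho> * s)" for s
    unfolding F_def ez by (simp add: norm_mult)
  \<comment> \<open>The boundary value at 0 vanishes because \<beta> > 0, the one at infinity
    because \<rho> > 0.\<close>
  have "(LBINT s=ereal 0..\<infinity>. f s) = 0 - 0"
  proof (rule interval_integral_FTC_integrable[where F=F])
    fix x assume "ereal 0 < ereal x"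
    then have x: "0 < x" by simp
    have "((\<lambda>s. s powr \<beta>) has_real_derivative \<beta> * x powr (\<beta> - 1)) (at x)"
      using has_real_derivative_powr[OF x] by simp
    then have 1: "((\<lambda>s. of_real (s powr \<beta>)) has_vector_derivative complex_of_real (\<beta> * x powr (\<beta> - 1))) (at x)"
      by (intro has_vector_derivative_of_real has_real_derivative_iff_has_vector_derivative[THEN iffD1])
    have "((\<lambda>s. exp (- z * s)) has_field_derivative exp (- z * of_real x) * (- z)) (at (of_real x))"
      by (auto intro!: derivative_eq_intros)
    from has_vector_derivative_real_field[OF this]
    have 2: "((\<lambda>s. exp (- z * of_real s)) has_vector_derivative exp (- z * of_real x) * (- z)) (at x)" .
    show "(F has_vector_derivative f x) (at x)"
      unfolding F_def using has_vector_derivative_mult[OF 1 2] by (simp add: f_def algebra_simps)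
    show "isCont f x"
      unfolding f_def using x by (intro continuous_intros) auto
  next
    show "set_integrable lborel (einterval (ereal 0) \<infinity>) f" using fi by simp
    have "((\<lambda>s. s powr \<beta> * exp (- \<rho> * s)) \<longlongrightarrow> 0) (at_right 0)"
      using assms by real_asymp
    then have "(F \<longlongrightarrow> 0) (at_right 0)"
      unfolding normF[symmetric] by (rule tendsto_norm_zero_cancel)
    then show "((F \<circ> real_of_ereal) \<longlongrightarrow> 0) (at_right (ereal 0))"
      by (simp add: ereal_tendsto_simps)
    have "((\<lambda>s. s powr \<beta> * exp (- \<rho> * s)) \<longlongrightarrow> 0) at_top"
      using assms by real_asymp
    then have "(F \<longlongrightarrow> 0) at_top"
      unfolding normF[symmetric] by (rule tendsto_norm_zero_cancel)
    then show "((F \<circ> real_of_ereal) \<longlongrightarrow> 0) (at_left \<infinity>)"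
      by (simp add: ereal_tendsto_simps)
  qed auto
  also have "(LBINT s=ereal 0..\<infinity>. f s) = (LBINT s. indicator {0<..} s *\<^sub>R f s)"
    by (simp add: interval_lebesgue_integral_def set_lebesgue_integral_def)
  also have "\<dots> = of_real \<beta> * gamma_transform \<rho> \<beta> \<xi> - z * gamma_transform \<rho> (\<beta> + 1) \<xi>"
    unfolding f_eq gamma_transform_def
    using gi assms by (subst Bochner_Integration.integral_diff) auto
  finally show ?thesis by (simp add: z_def)
qed

text \<open>Differentiation under the integral, with an explicit remainder: |e^(ix) - 1 - ix| \<le>
  x^2 / 2 at x = -hs bounds the linearisation error by a constant times h^2.\<close>

lemma gamma_transform_derivative:
  assumes "0 < \<rho>" "0 < \<beta>"
  shows "(gamma_transform \<rho> \<beta> has_vector_derivative (- \<i> * gamma_transform \<rho> (\<beta> + 1) \<xi>)) (at \<xi>)"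
proof -
  let ?w = "\<lambda>b s. complex_of_real (gamma_weight \<rho> b s)" and ?e = "\<lambda>x. exp (\<i> * complex_of_real x)"
  \<comment> \<open>The second-order remainder contributes a factor s^2, which raises the exponent
    from \<beta> to \<beta> + 2; the integral of that weight is finite.\<close>
  define C where "C = (LBINT s. gamma_weight \<rho> (\<beta> + 1 + 1) s) / 2"
  have C: "norm (gamma_transform \<rho> \<beta> (\<xi> + h) - gamma_transform \<rho> \<beta> \<xi> - h *\<^sub>R (- \<i> * gamma_transform \<rho> (\<beta> + 1) \<xi>)) \<le> C * h\<^sup>2" for h
  proof -
    note gi = gamma_transform_integrable[OF assms, of \<xi>] gamma_transform_integrable[OF assms, of "\<xi> + h"]
      gamma_transform_integrable[OF assms(1), of "\<beta> + 1" \<xi>]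
    have i2: "integrable lborel (gamma_weight \<rho> (\<beta> + 1 + 1))"
      using assms by (intro gamma_weight_integral) auto
    define D where "D s = ?w \<beta> s * ?e (- (\<xi> + h) * s) - ?w \<beta> s * ?e (- \<xi> * s) - (- \<i> * of_real h) * (?w (\<beta> + 1) s * ?e (- \<xi> * s))" for s
    have Di: "integrable lborel D"
      unfolding D_def using gi assms by (intro Bochner_Integration.integrable_diff integrable_mult_right) auto
    have "gamma_transform \<rho> \<beta> (\<xi> + h) - gamma_transform \<rho> \<beta> \<xi> - h *\<^sub>R (- \<i> * gamma_transform \<rho> (\<beta> + 1) \<xi>) = (LBINT s. D s)"
      unfolding D_def gamma_transform_def
      using gi assms by (simp add: scaleR_conv_of_real)
    also have "norm \<dots> \<le> (LBINT s. norm (D s))" by (rule integral_norm_bound)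
    also have "\<dots> \<le> (LBINT s. gamma_weight \<rho> (\<beta> + 1 + 1) s * (h\<^sup>2 / 2))"
    proof (intro integral_mono integrable_norm Di integrable_mult_left i2)
      fix s
      have eq: "D s = ?w \<beta> s * ?e (- \<xi> * s) * (?e (- h * s) - (\<Sum>k\<le>1. (\<i> * of_real (- h * s)) ^ k / fact k))"
        unfolding D_def gamma_weight_Suc by (simp add: algebra_simps exp_add exp_diff exp_minus field_simps)
      have "norm (D s) = gamma_weight \<rho> \<beta> s * norm (?e (- h * s) - (\<Sum>k\<le>1. (\<i> * of_real (- h * s)) ^ k / fact k))"
        unfolding eq norm_mult by (simp add: gamma_weight_nonneg)
      also have "\<dots> \<le> gamma_weight \<rho> \<beta> s * (\<bar>- h * s\<bar> ^ Suc 1 / fact (Suc 1))"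
        by (intro mult_left_mono iexp_approx1 gamma_weight_nonneg)
      also have "\<dots> = gamma_weight \<rho> (\<beta> + 1 + 1) s * (h\<^sup>2 / 2)"
        unfolding gamma_weight_Suc by (simp add: power2_eq_square abs_mult_self_eq algebra_simps)
      finally show "norm (D s) \<le> gamma_weight \<rho> (\<beta> + 1 + 1) s * (h\<^sup>2 / 2)" .
    qed
    also have "\<dots> = C * h\<^sup>2" by (simp add: C_def)
    finally show ?thesis .
  qed
  show ?thesis
    unfolding has_vector_derivative_def has_derivative_at
  proof (intro conjI bounded_linear_scaleR_left)
    have lim: "(\<lambda>h. C * \<bar>h\<bar>) \<midarrow>0\<rightarrow> 0"
      by (auto intro!: tendsto_eq_intros)
    show "(\<lambda>h. norm (gamma_transform \<rho> \<beta> (\<xi> + h) - gamma_transform \<rho> \<beta> \<xi> - h *\<^sub>R (- \<i> * gamma_transform \<rho> (\<beta> + 1) \<xi>)) / norm h) \<midarrow>0\<rightarrow> 0"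
    proof (rule Lim_null_comparison[OF _ lim])
      show "\<forall>\<^sub>F h in at 0. norm (norm (gamma_transform \<rho> \<beta> (\<xi> + h) - gamma_transform \<rho> \<beta> \<xi> - h *\<^sub>R (- \<i> * gamma_transform \<rho> (\<beta> + 1) \<xi>)) / norm h) \<le> C * \<bar>h\<bar>"
        unfolding eventually_at_filter
      proof (intro always_eventually allI impI)
        fix h :: real assume "h \<noteq> 0"
        then show "norm (norm (gamma_transform \<rho> \<beta> (\<xi> + h) - gamma_transform \<rho> \<beta> \<xi> - h *\<^sub>R (- \<i> * gamma_transform \<rho> (\<beta> + 1) \<xi>)) / norm h) \<le> C * \<bar>h\<bar>"
          using C[of h] by (simp add: divide_le_eq power2_eq_square mult.assoc)
      qed
    qed
  qed
qed

text \<open>By the recurrence, \<open>z\<^sup>\<beta>\<close> times the transform has zero derivative along the line \<open>z = \<rho> + i\<xi>\<close>.\<close>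
theorem gamma_transform_eq:
  assumes "0 < \<rho>" "0 < \<beta>"
  shows "Complex \<rho> \<xi> powr of_real \<beta> * gamma_transform \<rho> \<beta> \<xi> = Gamma (of_real \<beta>)"
proof -
  define g where "g x = Complex \<rho> x powr of_real \<beta> * gamma_transform \<rho> \<beta> x" for x
  have d: "(g has_vector_derivative 0) (at x within UNIV)" for x
  proof -
    let ?z = "Complex \<rho> x"
    have nz: "?z \<noteq> 0" using assms by (simp add: complex_eq_iff)
    have "((\<lambda>x. of_real \<rho> + \<i> * of_real x) has_vector_derivative \<i>) (at x)"
      by (auto intro!: derivative_eq_intros)
    then have 1: "((\<lambda>x. Complex \<rho> x) has_vector_derivative \<i>) (at x)"
      by (simp add: Complex_eq)
    \<comment> \<open>The real part \<rho> is positive, so the line stays away from the branch cut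
      of the principal power.\<close>
    have 2: "((\<lambda>z. z powr of_real \<beta>) has_field_derivative (of_real \<beta> * ?z powr (of_real \<beta> - 1))) (at ?z)"
      using assms by (intro has_field_derivative_powr) (auto simp: complex_nonpos_Reals_iff)
    have 3: "((\<lambda>x. Complex \<rho> x powr of_real \<beta>) has_vector_derivative \<i> * (of_real \<beta> * ?z powr (of_real \<beta> - 1))) (at x)"
      using field_vector_diff_chain_at[OF 1 2] by (simp add: o_def)
    have "(g has_vector_derivative (?z powr of_real \<beta> * (- \<i> * gamma_transform \<rho> (\<beta> + 1) x)
        + \<i> * (of_real \<beta> * ?z powr (of_real \<beta> - 1)) * gamma_transform \<rho> \<beta> x)) (at x)"
      unfolding g_def by (rule has_vector_derivative_mult[OF 3 gamma_transform_derivative[OF assms]])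
    also have "?z powr of_real \<beta> * (- \<i> * gamma_transform \<rho> (\<beta> + 1) x)
        + \<i> * (of_real \<beta> * ?z powr (of_real \<beta> - 1)) * gamma_transform \<rho> \<beta> x
      = \<i> * ?z powr (of_real \<beta> - 1) * (of_real \<beta> * gamma_transform \<rho> \<beta> x - ?z * gamma_transform \<rho> (\<beta> + 1) x)"
      using nz by (simp add: powr_diff field_simps)
    also have "\<dots> = 0"
      by (simp add: gamma_transform_recurrence[OF assms])
    finally show ?thesis .
  qed
  obtain c where c: "\<And>x. g x = c"
    by (rule has_vector_derivative_zero_constant[OF convex_UNIV, of g]) (use d in auto)
  \<comment> \<open>The constant is read off at \<xi> = 0, where the transform is the real Gamma
    integral.\<close>
  have "gamma_transform \<rho> \<beta> 0 = of_real (Gamma \<beta> / \<rho> powr \<beta>)"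
    unfolding gamma_transform_def gamma_weight_integral(2)[OF assms, symmetric]
    by (simp flip: integral_complex_of_real)
  then have "g 0 = Gamma (of_real \<beta>)"
    using assms by (simp add: g_def Gamma_complex_of_real powr_of_real[symmetric] Complex_eq)
  with c show ?thesis by (metis g_def)
qed

text \<open>The Riemann-Liouville kernel damped by e^(-\<rho>s). Convolution with it is fractional
  integration of order \<alpha> conjugated by the weight e^(-\<rho>t).\<close>

definition frac_kernel :: "real \<Rightarrow> real \<Rightarrow> real \<Rightarrow> real" where
  "frac_kernel \<rho> \<alpha> s = gamma_weight \<rho> \<alpha> s / Gamma \<alpha>"

definition frac_symbol :: "real \<Rightarrow> real \<Rightarrow> real \<Rightarrow> complex" where
  "frac_symbol \<rho> \<alpha> \<xi> = (LBINT s. of_real (frac_kernel \<rho> \<alpha> s) * exp (\<i> * of_real (- \<xi> * s)))"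

text \<open>In product form this says at once that neither factor vanishes and that they are inverse
  to each other, which gives boundedness and measurability of the inverse multiplier through the
  kernel.\<close>

lemma frac_symbol_eq:
  assumes "0 < \<rho>" "0 < \<alpha>"
  shows "Complex \<rho> \<xi> powr of_real \<alpha> * frac_symbol \<rho> \<alpha> \<xi> = 1"
proof -
  have "frac_symbol \<rho> \<alpha> \<xi> = gamma_transform \<rho> \<alpha> \<xi> / of_real (Gamma \<alpha>)"
    unfolding frac_symbol_def gamma_transform_def frac_kernel_def by simp
  moreover have "Gamma \<alpha> \<noteq> 0" using Gamma_real_pos[OF assms(2)] by simp
  ultimately show ?thesis
    using gamma_transform_eq[OF assms, of \<xi>] by (simp add: Gamma_complex_of_real)
qed

lemma frac_kernel_props:
  assumes "0 < \<rho>" "0 < \<alpha>"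
  shows "integrable lborel (frac_kernel \<rho> \<alpha>)" "(LBINT s. frac_kernel \<rho> \<alpha> s) = \<rho> powr (- \<alpha>)"
    "0 \<le> frac_kernel \<rho> \<alpha> s" "s \<le> 0 \<Longrightarrow> frac_kernel \<rho> \<alpha> s = 0"
proof -
  have "Gamma \<alpha> > 0" using assms by (intro Gamma_real_pos)
  then show "integrable lborel (frac_kernel \<rho> \<alpha>)" "(LBINT s. frac_kernel \<rho> \<alpha> s) = \<rho> powr (- \<alpha>)"
    unfolding frac_kernel_def using gamma_weight_integral[OF assms] by (auto simp: powr_minus field_simps)
  show "0 \<le> frac_kernel \<rho> \<alpha> s" "s \<le> 0 \<Longrightarrow> frac_kernel \<rho> \<alpha> s = 0"
    using \<open>Gamma \<alpha> > 0\<close> by (auto simp: frac_kernel_def gamma_weight_def)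
qed

section \<open>Convolution with an integrable kernel\<close>

definition conv :: "(real \<Rightarrow> real) \<Rightarrow> (real \<Rightarrow> 'b::euclidean_space) \<Rightarrow> real \<Rightarrow> 'b" where
  "conv \<kappa> w t = (LBINT s. \<kappa> s *\<^sub>R w (t - s))"

text \<open>Without the factor 1 / sqrt (2 pi) of \<open>ft\<close>, so that the convolution theorem
  carries no constant and the symbol is bounded by the integral of a nonnegative kernel.\<close>

definition conv_symbol :: "(real \<Rightarrow> real) \<Rightarrow> real \<Rightarrow> real \<Rightarrow> complex" where
  "conv_symbol \<kappa> \<sigma> \<xi> = (LBINT s. of_real (\<kappa> s) * exp (\<i> * of_real (\<sigma> * \<xi> * s)))"

text \<open>For t \<le> 0 every s has s \<le> 0, where the kernel vanishes, or t - s < 0, where w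
  does. This elementary remark takes the place of a Paley-Wiener theorem.\<close>

lemma conv_support:
  assumes "\<And>s. s \<le> 0 \<Longrightarrow> \<kappa> s = 0" "\<And>t. t \<le> 0 \<Longrightarrow> w t = 0" "t \<le> 0"
  shows "conv \<kappa> w t = 0"
proof -
  have "\<kappa> s *\<^sub>R w (t - s) = 0" for s
    using assms by (cases "s \<le> 0") auto
  then show ?thesis unfolding conv_def by (simp only: integral_zero)
qed

lemma lborel_integrable_shift:
  fixes f :: "real \<Rightarrow> 'b::euclidean_space"
  shows "integrable lborel f \<Longrightarrow> integrable lborel (\<lambda>t. f (t - s))"
  using lborel_integrable_real_affine[of f 1 "- s"] by simp

lemma lborel_integral_shift:
  fixes f :: "real \<Rightarrow> 'b::euclidean_space"
  shows "(LBINT t. f (t - s)) = (LBINT t. f t)"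
  using lborel_integral_real_affine[of 1 f "- s"] by simp

context
  fixes \<kappa> :: "real \<Rightarrow> real"
  assumes ki: "integrable lborel \<kappa>" and k0: "\<And>s. 0 \<le> \<kappa> s"
begin

lemma kernel_measurable [measurable]: "\<kappa> \<in> borel_measurable borel"
  using borel_measurable_integrable[OF ki] by simp

lemma conv_borel_measurable:
  assumes "w \<in> borel_measurable lborel"
  shows "conv \<kappa> w \<in> borel_measurable lborel"
proof -
  have [measurable]: "w \<in> borel_measurable borel" using assms by simp
  show ?thesis unfolding conv_def[abs_def] by measurable
qed

text \<open>Integrating over t first gives \<kappa>(s) times the L1 norm of f, by translation
  invariance, which is integrable in s.\<close>

lemma conv_pair_integrable:
  fixes f :: "real \<Rightarrow> 'b::euclidean_space"
  assumes f: "integrable lborel f"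
  shows "integrable (lborel \<Otimes>\<^sub>M lborel) (\<lambda>(t, s). \<kappa> s *\<^sub>R f (t - s))"
proof -
  have [measurable]: "f \<in> borel_measurable borel"
    using borel_measurable_integrable[OF f] by simp
  have "integrable (lborel \<Otimes>\<^sub>M lborel) (\<lambda>(s, t). \<kappa> s *\<^sub>R f (t - s))"
  proof (rule lborel_pair.Fubini_integrable)
    have "(LBINT t. norm (\<kappa> s *\<^sub>R f (t - s))) = \<kappa> s * (LBINT t. norm (f t))" for s
      using lborel_integral_shift[of "\<lambda>t. norm (f t)" s] k0[of s] by simp
    then show "integrable lborel (\<lambda>s. LBINT t. norm (case (s, t) of (s, t) \<Rightarrow> \<kappa> s *\<^sub>R f (t - s)))"
      using ki by simp
    show "AE s in lborel. integrable lborel (\<lambda>t. case (s, t) of (s, t) \<Rightarrow> \<kappa> s *\<^sub>R f (t - s))"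
      using lborel_integrable_shift[OF f] by simp
  qed measurable
  from lborel_pair.integrable_product_swap[OF this] show ?thesis by (simp add: case_prod_beta)
qed

text \<open>Young's inequality for \<open>L\<^sup>1 * L\<^sup>2\<close>, from the pointwise Cauchy-Schwarz bound
  \<open>\<bar>\<kappa> * w\<bar>\<^sup>2 \<le> (\<integral>\<kappa>) (\<kappa> * \<bar>w\<bar>\<^sup>2)\<close>.\<close>
lemma conv_young:
  fixes w :: "real \<Rightarrow> 'b::euclidean_space"
  assumes w: "sq lborel w"
  shows conv_integrable_AE: "AE t in lborel. integrable lborel (\<lambda>s. \<kappa> s *\<^sub>R w (t - s))"
    and sq_conv: "sq lborel (conv \<kappa> w)"
    and l2_conv_le: "l2 lborel (conv \<kappa> w) \<le> (LBINT s. \<kappa> s) * l2 lborel w"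
proof -
  define K where "K = (LBINT s. \<kappa> s)"
  have K0: "0 \<le> K" unfolding K_def by (rule integral_nonneg_AE) (simp add: k0)
  have [measurable]: "w \<in> borel_measurable borel"
    using sqD_measurable[OF w] by simp
  note pair = conv_pair_integrable[OF sqD_integrable[OF w]]
  define Q where "Q t = (LBINT s. \<kappa> s * (norm (w (t - s)))\<^sup>2)" for t
  have AEi: "AE t in lborel. integrable lborel (\<lambda>s. \<kappa> s * (norm (w (t - s)))\<^sup>2)"
    using lborel_pair.AE_integrable_fst[OF pair] by simp
  have Qi: "integrable lborel Q"
    using lborel_pair.integrable_fst[OF pair] by (simp add: Q_def[abs_def])
  have "(LBINT t. Q t) = (LBINT s. LBINT t. \<kappa> s * (norm (w (t - s)))\<^sup>2)"
    unfolding Q_def by (rule lborel_pair.Fubini_integral[symmetric]) (use pair in simp)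
  also have "\<dots> = (LBINT s. \<kappa> s * (l2 lborel w)\<^sup>2)"
    using lborel_integral_shift[of "\<lambda>t. (norm (w t))\<^sup>2"] by (simp add: l2_power2)
  also have "\<dots> = K * (l2 lborel w)\<^sup>2" by (simp add: K_def)
  finally have Qint: "(LBINT t. Q t) = K * (l2 lborel w)\<^sup>2" .
  have point: "integrable lborel (\<lambda>s. \<kappa> s *\<^sub>R w (t - s)) \<and> (norm (conv \<kappa> w t))\<^sup>2 \<le> K * Q t"
    if i: "integrable lborel (\<lambda>s. \<kappa> s * (norm (w (t - s)))\<^sup>2)" for t
  proof
    \<comment> \<open>The kernel is split as the product of two square roots, one kept alone and one
      attached to w; its nonnegativity makes the splitting possible.\<close>
    define a where "a s = sqrt (\<kappa> s)" for s
    define b where "b s = sqrt (\<kappa> s) *\<^sub>R w (t - s)" for s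
    have [measurable]: "a \<in> borel_measurable borel" "b \<in> borel_measurable borel"
      unfolding a_def b_def by measurable
    have a: "sq lborel a" using ki k0 by (simp add: sq_def a_def[abs_def])
    have b2: "(norm (b s))\<^sup>2 = \<kappa> s * (norm (w (t - s)))\<^sup>2" for s
      using k0[of s] by (simp add: b_def power_mult_distrib)
    have b: "sq lborel b" unfolding sq_def b2 using i by simp
    have ab: "norm (a s) * norm (b s) = norm (\<kappa> s *\<^sub>R w (t - s))" for s
      using k0[of s] by (simp add: a_def b_def)
    show int: "integrable lborel (\<lambda>s. \<kappa> s *\<^sub>R w (t - s))"
      using integrable_norm_mult[OF a b] unfolding ab
      by (rule Bochner_Integration.integrable_bound) auto
    have "norm (conv \<kappa> w t) \<le> (LBINT s. norm (\<kappa> s *\<^sub>R w (t - s)))"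
      unfolding conv_def by (rule integral_norm_bound)
    also have "\<dots> \<le> l2 lborel a * l2 lborel b"
      using Cauchy_Schwarz_norm[OF a b] unfolding ab .
    finally have "(norm (conv \<kappa> w t))\<^sup>2 \<le> (l2 lborel a * l2 lborel b)\<^sup>2"
      by (intro power_mono) auto
    also have "\<dots> = K * Q t"
      unfolding power_mult_distrib l2_power2 b2 using k0 by (simp add: a_def K_def Q_def)
    finally show "(norm (conv \<kappa> w t))\<^sup>2 \<le> K * Q t" .
  qed
  show "AE t in lborel. integrable lborel (\<lambda>s. \<kappa> s *\<^sub>R w (t - s))"
    using AEi by eventually_elim (use point in blast)
  have le: "AE t in lborel. (norm (conv \<kappa> w t))\<^sup>2 \<le> K * Q t"
    using AEi by eventually_elim (use point in blast)
  note cm = conv_borel_measurable[OF sqD_measurable[OF w]]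
  have [measurable]: "conv \<kappa> w \<in> borel_measurable lborel" by (rule cm)
  have "integrable lborel (\<lambda>t. (norm (conv \<kappa> w t))\<^sup>2)"
    by (rule Bochner_Integration.integrable_bound[OF integrable_mult_right[OF Qi, of K]])
      (use le in \<open>auto elim!: eventually_mono\<close>)
  then show sqc: "sq lborel (conv \<kappa> w)" using cm by (simp add: sq_def)
  have "(l2 lborel (conv \<kappa> w))\<^sup>2 \<le> (LBINT t. K * Q t)"
    unfolding l2_power2
    by (intro integral_mono_AE sqD_integrable sqc integrable_mult_right Qi le)
  also have "\<dots> = (K * l2 lborel w)\<^sup>2"
    by (simp add: Qint power2_eq_square)
  finally have "l2 lborel (conv \<kappa> w) \<le> K * l2 lborel w"
    by (rule power2_le_imp_le) (simp add: K0)
  then show "l2 lborel (conv \<kappa> w) \<le> (LBINT s. \<kappa> s) * l2 lborel w" by (simp add: K_def)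
qed

text \<open>Linearity can be claimed only where both convolution integrals converge, which for
  square-integrable functions is known almost everywhere.\<close>

lemma conv_diff_AE:
  fixes v w :: "real \<Rightarrow> 'b::euclidean_space"
  assumes v: "sq lborel v" and w: "sq lborel w"
  shows "AE t in lborel. conv \<kappa> (\<lambda>s. v s - w s) t = conv \<kappa> v t - conv \<kappa> w t"
  using conv_integrable_AE[OF v] conv_integrable_AE[OF w]
proof eventually_elim
  case (elim t)
  then show ?case by (simp add: conv_def scaleR_diff_right)
qed

lemma l2_conv_diff_le:
  fixes v w :: "real \<Rightarrow> 'b::euclidean_space"
  assumes v: "sq lborel v" and w: "sq lborel w"
  shows "l2 lborel (\<lambda>t. conv \<kappa> v t - conv \<kappa> w t) \<le> (LBINT s. \<kappa> s) * l2 lborel (\<lambda>t. v t - w t)"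
proof -
  note vw = sq_diff[OF v w]
  have "l2 lborel (\<lambda>t. conv \<kappa> v t - conv \<kappa> w t) = l2 lborel (conv \<kappa> (\<lambda>s. v s - w s))"
    by (rule l2_cong_AE[OF sqD_measurable[OF sq_diff[OF sq_conv[OF v] sq_conv[OF w]]] sqD_measurable[OF sq_conv[OF vw]]])
      (use conv_diff_AE[OF v w] in \<open>auto elim!: eventually_mono\<close>)
  then show ?thesis using l2_conv_le[OF vw] by simp
qed

lemma conv_integrable:
  fixes w :: "real \<Rightarrow> 'b::euclidean_space"
  assumes w: "integrable lborel w"
  shows "integrable lborel (conv \<kappa> w)"
  using lborel_pair.integrable_fst[OF conv_pair_integrable[OF w]] by (simp add: conv_def[abs_def])

lemma borel_measurable_conv_symbol: "conv_symbol \<kappa> \<sigma> \<in> borel_measurable borel"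
  unfolding conv_symbol_def[abs_def] by measurable

lemma norm_conv_symbol_le: "norm (conv_symbol \<kappa> \<sigma> \<xi>) \<le> (LBINT s. \<kappa> s)"
proof -
  have "norm (conv_symbol \<kappa> \<sigma> \<xi>) \<le> (LBINT s. norm (of_real (\<kappa> s) * exp (\<i> * of_real (\<sigma> * \<xi> * s))))"
    unfolding conv_symbol_def by (rule integral_norm_bound)
  then show ?thesis using k0 by (simp add: norm_mult)
qed

text \<open>Fubini and the shift t to t + s: the exponential of a sum factors, leaving the symbol of
  the kernel times the transform of w.\<close>

lemma ft_conv:
  fixes w :: "real \<Rightarrow> complex ^ 'n"
  assumes w: "integrable lborel w"
  shows "ft \<sigma> (conv \<kappa> w) \<xi> = cscale (conv_symbol \<kappa> \<sigma> \<xi>) (ft \<sigma> w \<xi>)"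
proof -
  have wm [measurable]: "w \<in> borel_measurable borel"
    using borel_measurable_integrable[OF w] by simp
  define e where "e r = exp (\<i> * complex_of_real (\<sigma> * \<xi> * r))" for r
  have [measurable]: "e \<in> borel_measurable borel" unfolding e_def by measurable
  have fe: "fker (\<sigma> * \<xi> * (t + s)) = e s * fker (\<sigma> * \<xi> * t)" for s t
    by (simp add: fker_def e_def distrib_left exp_add)
  note bl = bounded_bilinear.bounded_linear_right[OF bounded_bilinear_cscale]
    and bl' = bounded_bilinear.bounded_linear_left[OF bounded_bilinear_cscale]
  note pair = conv_pair_integrable[OF w]
  have pair': "integrable (lborel \<Otimes>\<^sub>M lborel) (\<lambda>(t, s). cscale (fker (\<sigma> * \<xi> * t)) (\<kappa> s *\<^sub>R w (t - s)))"
    by (rule Bochner_Integration.integrable_bound[OF integrable_scaleR_right[OF pair, of "1 / sqrt (2 * pi)"]])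
      (auto simp: norm_fker)
  have wi: "integrable lborel (\<lambda>t. cscale (fker (\<sigma> * \<xi> * t)) (w t))"
    using ft_integrable[of w \<sigma> \<xi>] w by (simp add: integrable_completion)
  have ke: "integrable lborel (\<lambda>s. of_real (\<kappa> s) * e s)"
    by (rule Bochner_Integration.integrable_bound[OF ki]) (auto simp: norm_mult e_def)
  have "ft \<sigma> (conv \<kappa> w) \<xi> = (LBINT t. cscale (fker (\<sigma> * \<xi> * t)) (LBINT s. \<kappa> s *\<^sub>R w (t - s)))"
    unfolding ft_lborel[OF conv_borel_measurable[OF borel_measurable_integrable[OF w]]] conv_def ..
  also have "\<dots> = (LBINT t. LBINT s. cscale (fker (\<sigma> * \<xi> * t)) (\<kappa> s *\<^sub>R w (t - s)))"
  \<comment> \<open>Moving the factor inside the inner integral requires that integral to converge,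
    which holds for almost every t.\<close>
  proof (rule integral_cong_AE)
    show "AE t in lborel. cscale (fker (\<sigma> * \<xi> * t)) (LBINT s. \<kappa> s *\<^sub>R w (t - s)) =
        (LBINT s. cscale (fker (\<sigma> * \<xi> * t)) (\<kappa> s *\<^sub>R w (t - s)))"
      using lborel_pair.AE_integrable_fst[OF pair]
      by eventually_elim (simp add: integral_bounded_linear[OF bl])
  qed measurable
  also have "\<dots> = (LBINT s. LBINT t. cscale (fker (\<sigma> * \<xi> * t)) (\<kappa> s *\<^sub>R w (t - s)))"
    by (rule lborel_pair.Fubini_integral[symmetric]) (use pair' in simp)
  also have "\<dots> = (LBINT s. cscale (of_real (\<kappa> s) * e s) (ft \<sigma> w \<xi>))"
  proof (intro Bochner_Integration.integral_cong refl)
    fix s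
    have "(LBINT t. cscale (fker (\<sigma> * \<xi> * t)) (\<kappa> s *\<^sub>R w (t - s))) =
        (LBINT t. cscale (fker (\<sigma> * \<xi> * (t + s))) (\<kappa> s *\<^sub>R w t))"
      using lborel_integral_shift[of "\<lambda>t. cscale (fker (\<sigma> * \<xi> * (t + s))) (\<kappa> s *\<^sub>R w t)" s] by simp
    also have "\<dots> = (LBINT t. cscale (of_real (\<kappa> s) * e s) (cscale (fker (\<sigma> * \<xi> * t)) (w t)))"
      unfolding fe cscale_scaleR cscale_cscale by (simp add: mult.assoc)
    also have "\<dots> = cscale (of_real (\<kappa> s) * e s) (ft \<sigma> w \<xi>)"
      unfolding ft_lborel[OF borel_measurable_integrable[OF w]] by (rule integral_bounded_linear[OF bl wi])
    finally show "(LBINT t. cscale (fker (\<sigma> * \<xi> * t)) (\<kappa> s *\<^sub>R w (t - s))) = cscale (of_real (\<kappa> s) * e s) (ft \<sigma> w \<xi>)" .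
  qed
  also have "\<dots> = cscale (conv_symbol \<kappa> \<sigma> \<xi>) (ft \<sigma> w \<xi>)"
    unfolding conv_symbol_def e_def[symmetric] by (rule integral_bounded_linear[OF bl' ke])
  finally show ?thesis .
qed

lemma sq_lebesgue_cscale_symbol:
  fixes W :: "real \<Rightarrow> complex ^ 'n"
  assumes W: "sq lebesgue W"
  shows "sq lebesgue (\<lambda>\<xi>. cscale (conv_symbol \<kappa> \<sigma> \<xi>) (W \<xi>))"
    "l2 lebesgue (\<lambda>\<xi>. cscale (conv_symbol \<kappa> \<sigma> \<xi>) (W \<xi>)) \<le> (LBINT s. \<kappa> s) * l2 lebesgue W"
proof -
  have K0: "0 \<le> (LBINT s. \<kappa> s)" by (rule integral_nonneg_AE) (simp add: k0)
  have m: "(\<lambda>\<xi>. cscale (conv_symbol \<kappa> \<sigma> \<xi>) (W \<xi>)) \<in> borel_measurable lebesgue"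
    using borel_measurable_conv_symbol
    by (intro borel_measurable_cscale sqD_measurable[OF W] measurable_lebesgue_lborel) simp
  have le: "AE \<xi> in lebesgue. norm (cscale (conv_symbol \<kappa> \<sigma> \<xi>) (W \<xi>)) \<le> (LBINT s. \<kappa> s) * norm (W \<xi>)"
    by (simp add: norm_conv_symbol_le mult_right_mono)
  show "sq lebesgue (\<lambda>\<xi>. cscale (conv_symbol \<kappa> \<sigma> \<xi>) (W \<xi>))"
    "l2 lebesgue (\<lambda>\<xi>. cscale (conv_symbol \<kappa> \<sigma> \<xi>) (W \<xi>)) \<le> (LBINT s. \<kappa> s) * l2 lebesgue W"
    using sq_bound[OF W m le] K0 by auto
qed

text \<open>For truncations of w the identity is the integral computation. Both sides depend
  continuously on w, by Young's inequality in time and by boundedness of the symbol in frequency, so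
  closedness of the graph of the transform gives the general case.\<close>

lemma Frel_conv:
  fixes w :: "real \<Rightarrow> complex ^ 'n"
  assumes s: "\<sigma>\<^sup>2 = 1" and w: "sq lborel w" and rel: "Frel \<sigma> w W"
  shows "Frel \<sigma> (conv \<kappa> w) (\<lambda>\<xi>. cscale (conv_symbol \<kappa> \<sigma> \<xi>) (W \<xi>))"
proof (rule Frel_limit[OF s])
  define K where "K = (LBINT s. \<kappa> s)"
  have wm [measurable]: "w \<in> borel_measurable borel" using sqD_measurable[OF w] by simp
  note W = FrelD[OF rel]
  let ?w = "\<lambda>n::nat. cutoff (real n) w"
  have wnm: "?w n \<in> borel_measurable lborel" for n
    unfolding cutoff_def by measurable
  have wn: "sq lborel (?w n)" "integrable lborel (?w n)" for n
    using sq_cut[OF W(1), of n] integrable_cut[OF W(1), of n] wnm[of n]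
    by (simp_all add: sq_lebesgue_iff integrable_completion)
  note cwm = conv_borel_measurable[OF wnm]
  show "sq lebesgue (conv \<kappa> w)"
    using sq_conv[OF w] conv_borel_measurable[OF sqD_measurable[OF w]] by (simp add: sq_lebesgue_iff)
  show "sq lebesgue (\<lambda>\<xi>. cscale (conv_symbol \<kappa> \<sigma> \<xi>) (W \<xi>))"
    by (rule sq_lebesgue_cscale_symbol[OF W(2)])
  show "Frel \<sigma> (conv \<kappa> (?w n)) (\<lambda>\<xi>. cscale (conv_symbol \<kappa> \<sigma> \<xi>) (ft \<sigma> (?w n) \<xi>))" for n
  proof -
    have "Frel \<sigma> (conv \<kappa> (?w n)) (ft \<sigma> (conv \<kappa> (?w n)))"
      using sq_conv[OF wn(1)] conv_integrable[OF wn(2)] cwm[of n]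
      by (intro Frel_L1[OF s]) (simp_all add: sq_lebesgue_iff integrable_completion)
    then show ?thesis unfolding ft_conv[OF wn(2), abs_def] .
  qed
  have seq: "filterlim (\<lambda>n. real n) at_top sequentially" by (rule filterlim_real_sequentially)
  have "(\<lambda>n. K * l2 lebesgue (\<lambda>t. w t - ?w n t)) \<longlonglongrightarrow> 0"
    by (intro tendsto_mult_right_zero filterlim_compose[OF l2_cut_tendsto[OF W(1)] seq])
  then show "(\<lambda>n. l2 lebesgue (\<lambda>t. conv \<kappa> (?w n) t - conv \<kappa> w t)) \<longlonglongrightarrow> 0"
  proof (rule Lim_null_comparison[rotated], intro always_eventually allI)
    fix n
    have "l2 lebesgue (\<lambda>t. conv \<kappa> (?w n) t - conv \<kappa> w t) = l2 lborel (\<lambda>t. conv \<kappa> (?w n) t - conv \<kappa> w t)"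
      by (rule l2_lebesgue_eq[OF sqD_measurable[OF sq_diff[OF sq_conv[OF wn(1)] sq_conv[OF w]]]])
    also have "\<dots> \<le> K * l2 lborel (\<lambda>t. ?w n t - w t)"
      unfolding K_def by (rule l2_conv_diff_le[OF wn(1) w])
    also have "l2 lborel (\<lambda>t. ?w n t - w t) = l2 lebesgue (\<lambda>t. w t - ?w n t)"
      unfolding l2_minus_commute[of lborel "?w n"]
      by (rule l2_lebesgue_eq[symmetric, OF sqD_measurable[OF sq_diff[OF w wn(1)]]])
    finally show "norm (l2 lebesgue (\<lambda>t. conv \<kappa> (?w n) t - conv \<kappa> w t)) \<le> K * l2 lebesgue (\<lambda>t. w t - ?w n t)"
      by simp
  qed
  have "(\<lambda>n. K * l2 lebesgue (\<lambda>\<xi>. W \<xi> - ft \<sigma> (?w n) \<xi>)) \<longlonglongrightarrow> 0"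
    by (intro tendsto_mult_right_zero filterlim_compose[OF W(3) seq])
  then show "(\<lambda>n. l2 lebesgue (\<lambda>\<xi>. cscale (conv_symbol \<kappa> \<sigma> \<xi>) (ft \<sigma> (?w n) \<xi>) - cscale (conv_symbol \<kappa> \<sigma> \<xi>) (W \<xi>))) \<longlonglongrightarrow> 0"
  proof (rule Lim_null_comparison[rotated], intro always_eventually allI)
    fix n
    have "l2 lebesgue (\<lambda>\<xi>. cscale (conv_symbol \<kappa> \<sigma> \<xi>) (ft \<sigma> (?w n) \<xi>) - cscale (conv_symbol \<kappa> \<sigma> \<xi>) (W \<xi>))
        \<le> K * l2 lebesgue (\<lambda>\<xi>. ft \<sigma> (?w n) \<xi> - W \<xi>)"
      unfolding cscale_diff[symmetric] K_def
      by (rule sq_lebesgue_cscale_symbol[OF sq_diff[OF sq_ft_cut[OF s W(1)] W(2)]])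
    then show "norm (l2 lebesgue (\<lambda>\<xi>. cscale (conv_symbol \<kappa> \<sigma> \<xi>) (ft \<sigma> (?w n) \<xi>) - cscale (conv_symbol \<kappa> \<sigma> \<xi>) (W \<xi>)))
        \<le> K * l2 lebesgue (\<lambda>\<xi>. W \<xi> - ft \<sigma> (?w n) \<xi>)"
      by (simp add: l2_minus_commute[of lebesgue W])
  qed
qed

text \<open>The Lipschitz bound together with square-integrability of N(t, 0) makes the Picard map
  \<open>\<Phi>\<close> act on L2, with Lipschitz constant q = c \<integral>\<kappa> by Young's
  inequality. Increments of the iteration from \<open>Y0\<close> shrink by q each time, hence are
  summable.\<close>

lemma volterra_fixpoint:
  fixes N :: "real \<Rightarrow> 'b::euclidean_space \<Rightarrow> 'b" and Y0 :: "real \<Rightarrow> 'b"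
  assumes Nm: "case_prod N \<in> borel_measurable (borel \<Otimes>\<^sub>M borel)"
    and lip: "\<And>t u v. norm (N t u - N t v) \<le> c * norm (u - v)" and c: "0 \<le> c"
    and contr: "c * (LBINT s. \<kappa> s) < 1"
    and N0: "sq lborel (\<lambda>t. N t 0)" and Y0: "sq lborel Y0"
  obtains Y where "sq lborel Y" "sq lborel (\<lambda>t. N t (Y t))"
    "AE t in lborel. Y t = Y0 t + conv \<kappa> (\<lambda>s. N s (Y s)) t"
proof -
  define K where "K = (LBINT s. \<kappa> s)"
  have K0: "0 \<le> K" unfolding K_def by (rule integral_nonneg_AE) (simp add: k0)
  define q where "q = c * K"
  have q: "0 \<le> q" "q < 1" using c K0 contr by (auto simp: q_def K_def)
  have NYm: "(\<lambda>t. N t (Y t)) \<in> borel_measurable lborel" if "Y \<in> borel_measurable lborel" for Y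
  proof -
    have "(\<lambda>t. (t, Y t)) \<in> lborel \<rightarrow>\<^sub>M borel \<Otimes>\<^sub>M borel"
      using that by simp
    from measurable_compose[OF this Nm] show ?thesis by simp
  qed
  have NY: "sq lborel (\<lambda>t. N t (Y t))" if Y: "sq lborel Y" for Y
  proof -
    have "sq lborel (\<lambda>t. N t (Y t) - N t 0)"
      using lip[of _ _ 0] by (intro sq_bound(1)[OF Y, where C=c] borel_measurable_diff NYm sqD_measurable[OF Y] sqD_measurable[OF N0]) simp
    from sq_add[OF this N0] show ?thesis by simp
  qed
  have Nd: "l2 lborel (\<lambda>t. N t (Y t) - N t (Z t)) \<le> c * l2 lborel (\<lambda>t. Y t - Z t)"
    if Y: "sq lborel Y" and Z: "sq lborel Z" for Y Z
    by (rule sq_bound(2)[OF sq_diff[OF Y Z] sqD_measurable[OF sq_diff[OF NY[OF Y] NY[OF Z]]] _ c]) (simp add: lip)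
  define \<Phi> where "\<Phi> Y t = Y0 t + conv \<kappa> (\<lambda>s. N s (Y s)) t" for Y t
  have \<Phi>: "sq lborel (\<Phi> Y)" if "sq lborel Y" for Y
    unfolding \<Phi>_def by (intro sq_add Y0 sq_conv NY that)
  have \<Phi>d: "l2 lborel (\<lambda>t. \<Phi> Y t - \<Phi> Z t) \<le> q * l2 lborel (\<lambda>t. Y t - Z t)"
    if Y: "sq lborel Y" and Z: "sq lborel Z" for Y Z
  proof -
    have "l2 lborel (\<lambda>t. \<Phi> Y t - \<Phi> Z t) \<le> K * l2 lborel (\<lambda>t. N t (Y t) - N t (Z t))"
      using l2_conv_diff_le[OF NY[OF Y] NY[OF Z]] by (simp add: \<Phi>_def K_def)
    also have "\<dots> \<le> K * (c * l2 lborel (\<lambda>t. Y t - Z t))"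
      by (intro mult_left_mono Nd Y Z K0)
    finally show ?thesis by (simp add: q_def mult_ac)
  qed
  define S where "S k = (\<Phi> ^^ k) Y0" for k
  have S0: "S 0 = Y0" and SS: "S (Suc k) = \<Phi> (S k)" for k by (simp_all add: S_def)
  have S: "sq lborel (S k)" for k
    by (induction k) (auto simp: S0 SS Y0 \<Phi>)
  have Sd: "l2 lborel (\<lambda>t. S (Suc k) t - S k t) \<le> q ^ k * l2 lborel (\<lambda>t. S 1 t - S 0 t)" for k
  proof (induction k)
    case (Suc k)
    have "l2 lborel (\<lambda>t. S (Suc (Suc k)) t - S (Suc k) t) \<le> q * l2 lborel (\<lambda>t. S (Suc k) t - S k t)"
      using \<Phi>d[OF S[of "Suc k"] S[of k]] by (simp add: SS)
    also have "\<dots> \<le> q * (q ^ k * l2 lborel (\<lambda>t. S 1 t - S 0 t))"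
      by (intro mult_left_mono Suc q)
    finally show ?case by (simp add: mult_ac)
  qed simp
  have sm: "summable (\<lambda>k. l2 lborel (\<lambda>t. S (Suc k) t - S k t))"
  proof (rule summable_comparison_test')
    show "summable (\<lambda>k. q ^ k * l2 lborel (\<lambda>t. S 1 t - S 0 t))"
      using q by (intro summable_mult2 summable_geometric) simp
    show "norm (l2 lborel (\<lambda>t. S (Suc k) t - S k t)) \<le> q ^ k * l2 lborel (\<lambda>t. S 1 t - S 0 t)" if "0 \<le> k" for k
      using Sd[of k] by simp
  qed
  obtain Y where Y: "sq lborel Y" and lim: "(\<lambda>k. l2 lborel (\<lambda>t. S k t - Y t)) \<longlonglongrightarrow> 0"
    by (rule l2_complete[OF S sm])
  \<comment> \<open>The iterate S (Suc k) equals \<Phi> (S k), so it is close to Y by convergence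
    and close to \<Phi> Y by the Lipschitz bound.\<close>
  have "l2 lborel (\<lambda>t. Y t - \<Phi> Y t) \<le> 0"
  proof (rule LIMSEQ_le_const)
    show "(\<lambda>k. l2 lborel (\<lambda>t. S (Suc k) t - Y t) + q * l2 lborel (\<lambda>t. S k t - Y t)) \<longlonglongrightarrow> 0"
      by (intro tendsto_add_zero tendsto_mult_right_zero lim LIMSEQ_Suc)
    have "l2 lborel (\<lambda>t. Y t - \<Phi> Y t) \<le> l2 lborel (\<lambda>t. S (Suc k) t - Y t) + q * l2 lborel (\<lambda>t. S k t - Y t)" for k
      using l2_triangle[OF Y S[of "Suc k"] \<Phi>[OF Y]] \<Phi>d[OF S[of k] Y]
      by (simp add: SS l2_minus_commute[of lborel Y])
    then show "\<exists>N. \<forall>k\<ge>N. l2 lborel (\<lambda>t. Y t - \<Phi> Y t) \<le> l2 lborel (\<lambda>t. S (Suc k) t - Y t) + q * l2 lborel (\<lambda>t. S k t - Y t)"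
      by blast
  qed
  then have "l2 lborel (\<lambda>t. Y t - \<Phi> Y t) = 0" by (simp add: antisym)
  then have "AE t in lborel. Y t = \<Phi> Y t"
    using l2_eq_0_iff[OF sq_diff[OF Y \<Phi>[OF Y]]] by simp
  with Y NY[OF Y] show ?thesis by (intro that) (auto simp: \<Phi>_def)
qed

end

declare kernel_measurable [measurable del]

section \<open>The fractional initial value problem\<close>

definition weighted :: "real \<Rightarrow> (real \<Rightarrow> complex ^ 'n) \<Rightarrow> real \<Rightarrow> complex ^ 'n" where
  "weighted \<rho> g t = exp (- \<rho> * t) *\<^sub>R g t"

lemma norm_weighted_power2: "(norm (weighted \<rho> g t))\<^sup>2 = (norm (g t))\<^sup>2 * exp (- 2 * \<rho> * t)"
proof -
  have "(exp (- \<rho> * t))\<^sup>2 = exp (- 2 * \<rho> * t)"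
    by (simp add: power2_eq_square flip: exp_add)
  then show ?thesis by (simp add: weighted_def power_mult_distrib mult.commute)
qed

lemma exp_lebesgue_measurable: "(\<lambda>t. exp (a * t) :: real) \<in> borel_measurable lebesgue"
  by (rule measurable_lebesgue_lborel) measurable

lemma weighted_measurable_iff:
  "weighted \<rho> g \<in> borel_measurable lebesgue \<longleftrightarrow> g \<in> borel_measurable lebesgue"
proof
  assume "g \<in> borel_measurable lebesgue"
  then show "weighted \<rho> g \<in> borel_measurable lebesgue"
    unfolding weighted_def[abs_def] by (intro borel_measurable_scaleR exp_lebesgue_measurable)
next
  assume "weighted \<rho> g \<in> borel_measurable lebesgue"
  then have "(\<lambda>t. exp (\<rho> * t) *\<^sub>R weighted \<rho> g t) \<in> borel_measurable lebesgue"
    by (intro borel_measurable_scaleR exp_lebesgue_measurable)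
  then show "g \<in> borel_measurable lebesgue"
    by (simp add: weighted_def flip: exp_add)
qed

lemma L2w_iff: "L2w \<rho> g \<longleftrightarrow> sq lebesgue (weighted \<rho> g)"
  unfolding L2w_def sq_def norm_weighted_power2 weighted_measurable_iff ..

lemma weighted_0 [simp]: "weighted 0 g = g"
  by (simp add: weighted_def fun_eq_iff)

lemma weighted_diff: "weighted \<rho> (\<lambda>t. f t - g t) = (\<lambda>t. weighted \<rho> f t - weighted \<rho> g t)"
  by (simp add: weighted_def fun_eq_iff scaleR_diff_right)

lemma tendsto_l2_iff:
  "((\<lambda>R. (l2 M (f R))\<^sup>2) \<longlongrightarrow> 0) F \<longleftrightarrow> ((\<lambda>R. l2 M (f R)) \<longlongrightarrow> 0) F"
  using tendsto_real_sqrt[of "\<lambda>R. (l2 M (f R))\<^sup>2" 0 F] tendsto_power[of "\<lambda>R. l2 M (f R)" 0 F 2] by auto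

text \<open>The integrands agree pointwise once the complex exponential is split into decay and
  oscillation, so the identity holds for every function g.\<close>

lemma trunc_laplace_eq: "trunc_laplace \<rho> g R = ft (- 1) (cutoff R (weighted \<rho> g))"
proof
  fix \<xi>
  have "exp (- (Complex \<rho> \<xi> * complex_of_real t)) = of_real (exp (- \<rho> * t)) * exp (\<i> * of_real (- 1 * \<xi> * t))" for t
    by (simp add: Complex_eq algebra_simps flip: exp_add exp_of_real)
  then show "trunc_laplace \<rho> g R \<xi> = ft (- 1) (cutoff R (weighted \<rho> g)) \<xi>"
    unfolding trunc_laplace_def ft_def set_lebesgue_integral_def cutoff_def weighted_def fker_def cscale_scaleR
    by (intro Bochner_Integration.integral_cong refl) (simp add: mult_ac)
qed

text \<open>\<open>Frel\<close> includes square-integrability of its source, while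
  \<open>laplace_rel\<close> leaves membership of g in the weighted space to its caller; the
  hypothesis reconciles the two.\<close>

lemma laplace_rel_iff:
  assumes "L2w \<rho> g"
  shows "laplace_rel \<rho> g G \<longleftrightarrow> Frel (- 1) (weighted \<rho> g) G"
  using assms
  by (simp add: laplace_rel_def Frel_def L2w_iff trunc_laplace_eq tendsto_l2_iff flip: l2_power2)

lemma trunc_laplace_inv_eq: "trunc_laplace_inv \<rho> h R t = exp (\<rho> * t) *\<^sub>R ft 1 (cutoff R h) t"
proof -
  have "exp (Complex \<rho> \<xi> * complex_of_real t) = of_real (exp (\<rho> * t)) * exp (\<i> * of_real (1 * t * \<xi>))" for \<xi>
    by (simp add: Complex_eq algebra_simps flip: exp_add exp_of_real)
  then have "trunc_laplace_inv \<rho> h R t = (LINT \<xi>|lebesgue. exp (\<rho> * t) *\<^sub>R cscale (fker (1 * t * \<xi>)) (cutoff R h \<xi>))"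
    unfolding trunc_laplace_inv_def set_lebesgue_integral_def cutoff_def fker_def cscale_scaleR
    by (intro Bochner_Integration.integral_cong refl) (simp add: mult_ac)
  then show ?thesis unfolding ft_def by simp
qed

text \<open>The factor e^(\<rho>t) of the inverse transform cancels against the weight, so the error
  in the weighted space is the plain L2 error of the inverse Fourier transform.\<close>

lemma laplace_inv_rel_iff:
  assumes "sq lebesgue h"
  shows "laplace_inv_rel \<rho> h w \<longleftrightarrow> Frel 1 h (weighted \<rho> w)"
proof -
  have "weighted \<rho> (trunc_laplace_inv \<rho> h R) = ft 1 (cutoff R h)" for R
    by (simp add: weighted_def fun_eq_iff trunc_laplace_inv_eq flip: exp_add)
  then have eq: "weighted \<rho> (\<lambda>t. w t - trunc_laplace_inv \<rho> h R t) = (\<lambda>t. weighted \<rho> w t - ft 1 (cutoff R h) t)" for R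
    unfolding weighted_diff by simp
  have "(LINT t|lebesgue. (norm (w t - trunc_laplace_inv \<rho> h R t))\<^sup>2 * exp (- 2 * \<rho> * t))
      = (l2 lebesgue (\<lambda>t. weighted \<rho> w t - ft 1 (cutoff R h) t))\<^sup>2" for R
    unfolding l2_power2 eq[symmetric] norm_weighted_power2 ..
  then show ?thesis
    using assms unfolding laplace_inv_rel_def Frel_def L2w_iff by (simp only: tendsto_l2_iff) simp
qed

text \<open>The space condition and the derivative relation each assert the existence of some
  transform G. Transforms are unique almost everywhere, so one G serves both, and
  square-integrability of the multiplied transform becomes part of \<open>Frel 1\<close>.\<close>

lemma frac_ivp_solution_iff:
  fixes y0 :: "complex ^ 'n"
  defines "u \<equiv> \<lambda>y t. y t - indicator {0<..} t *\<^sub>R y0"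
  assumes m: "(\<lambda>\<xi>. Complex \<rho> \<xi> powr of_real \<alpha>) \<in> borel_measurable lebesgue"
  shows "frac_ivp_solution \<alpha> f y0 \<rho> y \<longleftrightarrow> L2w \<rho> y \<and> L2w \<rho> (u y) \<and>
    (\<exists>G. Frel (- 1) (weighted \<rho> (u y)) G \<and> Frel 1 (\<lambda>\<xi>. cscale (Complex \<rho> \<xi> powr of_real \<alpha>) (G \<xi>)) (weighted \<rho> (\<lambda>t. ftilde f t (y t))))"
    (is "_ \<longleftrightarrow> _ \<and> _ \<and> (\<exists>G. ?P G)")
proof -
  let ?m = "\<lambda>G \<xi>. cscale (Complex \<rho> \<xi> powr of_real \<alpha>) (G \<xi>)"
  have s: "(- 1 :: real)\<^sup>2 = 1" by simp
  have "Hsp \<rho> \<alpha> (u y) \<and> frac_deriv_rel \<rho> \<alpha> (u y) (\<lambda>t. ftilde f t (y t)) \<longleftrightarrow> L2w \<rho> (u y) \<and> (\<exists>G. ?P G)"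
  proof (intro iffI conjI; (elim conjE)?)
    assume H: "Hsp \<rho> \<alpha> (u y)" and D: "frac_deriv_rel \<rho> \<alpha> (u y) (\<lambda>t. ftilde f t (y t))"
    then show L: "L2w \<rho> (u y)" by (simp add: Hsp_def)
    obtain H where H: "Frel (- 1) (weighted \<rho> (u y)) H" "sq lebesgue (?m H)"
      using H L by (auto simp: Hsp_def laplace_rel_iff L2w_iff)
    obtain G where G: "Frel (- 1) (weighted \<rho> (u y)) G" "laplace_inv_rel \<rho> (?m G) (\<lambda>t. ftilde f t (y t))"
      using D L by (auto simp: frac_deriv_rel_def laplace_rel_iff)
    \<comment> \<open>The space condition supplies this for its own witness \<open>H\<close>; it is
      carried over to the witness of the derivative relation.\<close>
    have "sq lebesgue (?m G)"
    proof (rule sq_cong_AE[OF H(2)])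
      show "?m G \<in> borel_measurable lebesgue"
        by (intro borel_measurable_cscale m sqD_measurable[OF FrelD(2)[OF G(1)]])
      show "AE \<xi> in lebesgue. ?m H \<xi> = ?m G \<xi>"
        using Frel_unique[OF s H(1) G(1)] by eventually_elim simp
    qed
    with G show "\<exists>G. ?P G" by (auto simp: laplace_inv_rel_iff)
  next
    assume L: "L2w \<rho> (u y)" and "\<exists>G. ?P G"
    then obtain G where G: "?P G" by blast
    note mG = FrelD(1)[OF conjunct2[OF G]]
    show "Hsp \<rho> \<alpha> (u y)"
      unfolding Hsp_def using L G mG by (auto simp: laplace_rel_iff L2w_iff)
    show "frac_deriv_rel \<rho> \<alpha> (u y) (\<lambda>t. ftilde f t (y t))"
      unfolding frac_deriv_rel_def using L G mG by (auto simp: laplace_rel_iff laplace_inv_rel_iff)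
  qed
  then show ?thesis unfolding frac_ivp_solution_def u_def by blast
qed

section \<open>Uniqueness and existence for a fixed weight\<close>

context
  fixes \<alpha> \<rho> :: real
  assumes rho: "0 < \<rho>" and alpha: "0 < \<alpha>"
begin

abbreviation "kern \<equiv> frac_kernel \<rho> \<alpha>"

abbreviation "multiplier \<xi> \<equiv> Complex \<rho> \<xi> powr of_real \<alpha>"

lemma kern_nonneg: "0 \<le> kern s"
  by (rule frac_kernel_props[OF rho alpha])

lemma multiplier_symbol: "multiplier \<xi> * conv_symbol kern (- 1) \<xi> = 1"
  using frac_symbol_eq[OF rho alpha, of \<xi>] by (simp add: frac_symbol_def conv_symbol_def)

text \<open>The multiplier is the reciprocal of the symbol, whose measurability comes from its being
  a parameter integral; no case analysis of the complex power is needed.\<close>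

lemma multiplier_measurable: "multiplier \<in> borel_measurable lebesgue"
proof (rule measurable_lebesgue_lborel)
  have "multiplier = (\<lambda>\<xi>. inverse (conv_symbol kern (- 1) \<xi>))"
    using multiplier_symbol by (metis inverse_unique mult.commute)
  then show "multiplier \<in> borel_measurable lborel"
    using borel_measurable_conv_symbol[OF frac_kernel_props(1)[OF rho alpha], of "- 1"] kern_nonneg
    by (simp add: borel_measurable_inverse)
qed

text \<open>The squared norm is a multiple of e^(-2\<rho>t) on t > 0, that is, of a Gamma weight
  with exponent 1 and rate 2\<rho>; positivity of \<rho> enters here.\<close>

lemma weighted_initial_sq:
  "sq lborel (weighted \<rho> (\<lambda>t. indicator {0<..} t *\<^sub>R (y0 :: complex ^ 'n)))" (is "sq lborel ?Y")
proof -
  have "(norm (?Y t))\<^sup>2 = (norm y0)\<^sup>2 * gamma_weight (2 * \<rho>) 1 t" for t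
    unfolding norm_weighted_power2 by (simp add: gamma_weight_def indicator_def)
  moreover have "integrable lborel (gamma_weight (2 * \<rho>) 1)"
    using rho by (intro gamma_weight_integral) auto
  moreover have "?Y \<in> borel_measurable lborel"
    unfolding weighted_def by measurable
  ultimately show ?thesis by (simp add: sq_def)
qed

text \<open>Both transforms are isometries and the multiplier is bounded below by \<open>\<rho>\<^sup>\<alpha>\<close>, so two solutions
  \<open>y\<close>, \<open>z\<close> satisfy \<open>\<parallel>y - z\<parallel> \<le> \<rho>\<^sup>-\<^sup>\<alpha> c \<parallel>y - z\<parallel>\<close> in the weighted norm.\<close>
lemma frac_ivp_unique:
  fixes f :: "real \<Rightarrow> complex ^ 'n \<Rightarrow> complex ^ 'n"
  assumes c: "0 \<le> c" and lip: "\<And>t u v. norm (ftilde f t u - ftilde f t v) \<le> c * norm (u - v)"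
    and contr: "c * \<rho> powr (- \<alpha>) < 1"
    and y: "frac_ivp_solution \<alpha> f y0 \<rho> y" and z: "frac_ivp_solution \<alpha> f y0 \<rho> z"
  shows "AE t in lebesgue. z t = y t"
proof -
  let ?u = "\<lambda>y t. y t - indicator {0<..} t *\<^sub>R y0" and ?f = "\<lambda>y t. ftilde f t (y t)"
  let ?m = "\<lambda>G \<xi>. cscale (multiplier \<xi>) (G \<xi>)"
  define K where "K = \<rho> powr (- \<alpha>)"
  have K0: "0 \<le> K" by (simp add: K_def)
  obtain G where yw: "sq lebesgue (weighted \<rho> y)" "Frel (- 1) (weighted \<rho> (?u y)) G" "Frel 1 (?m G) (weighted \<rho> (?f y))"
    using y unfolding frac_ivp_solution_iff[OF multiplier_measurable] L2w_iff by blast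
  obtain H where zw: "sq lebesgue (weighted \<rho> z)" "Frel (- 1) (weighted \<rho> (?u z)) H" "Frel 1 (?m H) (weighted \<rho> (?f z))"
    using z unfolding frac_ivp_solution_iff[OF multiplier_measurable] L2w_iff by blast
  let ?d = "\<lambda>t. weighted \<rho> z t - weighted \<rho> y t"
  have d: "sq lebesgue ?d" by (rule sq_diff[OF zw(1) yw(1)])
  \<comment> \<open>The initial term y0 is common to both solutions and cancels.\<close>
  have d1: "Frel (- 1) ?d (\<lambda>\<xi>. H \<xi> - G \<xi>)"
    using Frel_diff[OF _ zw(2) yw(2)] by (simp add: weighted_diff)
  have d2: "Frel 1 (?m (\<lambda>\<xi>. H \<xi> - G \<xi>)) (\<lambda>t. weighted \<rho> (?f z) t - weighted \<rho> (?f y) t)"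
    using Frel_diff[OF _ zw(3) yw(3)] by (simp add: cscale_diff)
  have "l2 lebesgue ?d = l2 lebesgue (\<lambda>\<xi>. H \<xi> - G \<xi>)"
    using Frel_isometry[OF _ d1] by simp
  \<comment> \<open>Inserting symbol times multiplier, which is 1, turns the lower bound on the
    multiplier into the upper bound \<rho>^(-\<alpha>) on the symbol, the integral of the
    kernel.\<close>
  also have "(\<lambda>\<xi>. H \<xi> - G \<xi>) = (\<lambda>\<xi>. cscale (conv_symbol kern (- 1) \<xi>) (?m (\<lambda>\<xi>. H \<xi> - G \<xi>) \<xi>))"
    by (simp add: cscale_cscale multiplier_symbol mult.commute[of "conv_symbol kern (- 1) _"])
  also have "l2 lebesgue \<dots> \<le> K * l2 lebesgue (?m (\<lambda>\<xi>. H \<xi> - G \<xi>))"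
    using sq_lebesgue_cscale_symbol(2)[OF frac_kernel_props(1)[OF rho alpha] kern_nonneg FrelD(1)[OF d2]]
    by (simp add: frac_kernel_props(2)[OF rho alpha] K_def)
  also have "l2 lebesgue (?m (\<lambda>\<xi>. H \<xi> - G \<xi>)) = l2 lebesgue (\<lambda>t. weighted \<rho> (?f z) t - weighted \<rho> (?f y) t)"
    using Frel_isometry[OF _ d2] by simp
  also have "K * \<dots> \<le> K * (c * l2 lebesgue ?d)"
  proof (intro mult_left_mono K0 sq_bound(2)[OF d sqD_measurable[OF FrelD(2)[OF d2]] _ c])
    have "norm (weighted \<rho> (?f z) t - weighted \<rho> (?f y) t) \<le> c * norm (?d t)" for t
      using mult_left_mono[OF lip[of t "z t" "y t"], of "exp (- \<rho> * t)"]
      by (simp add: weighted_def mult_ac flip: scaleR_diff_right)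
    then show "AE t in lebesgue. norm (weighted \<rho> (?f z) t - weighted \<rho> (?f y) t) \<le> c * norm (?d t)" by simp
  qed
  finally have "l2 lebesgue ?d \<le> (c * K) * l2 lebesgue ?d" by (simp add: mult_ac)
  then have "(1 - c * K) * l2 lebesgue ?d \<le> 0" by (simp add: algebra_simps)
  then have "l2 lebesgue ?d = 0"
    using contr l2_nonneg[of lebesgue ?d] by (auto simp: K_def mult_le_0_iff)
  then have "AE t in lebesgue. ?d t = 0"
    by (simp only: l2_eq_0_iff[OF d])
  then show ?thesis
    by eventually_elim (simp add: weighted_def)
qed

text \<open>Let W be the transform of the weighted right-hand side. The Volterra equation and the
  convolution theorem make symbol times W the transform of the weighted y - y0 \<chi>; the
  multiplier restores W, and Fourier inversion returns the right-hand side.\<close>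

lemma frac_ivp_exists:
  fixes f :: "real \<Rightarrow> complex ^ 'n \<Rightarrow> complex ^ 'n"
  assumes c: "0 \<le> c" and lip: "\<And>t u v. norm (ftilde f t u - ftilde f t v) \<le> c * norm (u - v)"
    and contr: "c * \<rho> powr (- \<alpha>) < 1"
    and meas: "(\<lambda>(t, v). ftilde f t v) \<in> borel_measurable (borel \<Otimes>\<^sub>M borel)"
    and f0: "L2w \<rho> (\<lambda>t. ftilde f t 0)"
  obtains y where "frac_ivp_solution \<alpha> f y0 \<rho> y" "AE t in lebesgue. t < 0 \<longrightarrow> y t = 0"
proof -
  note ker = frac_kernel_props[OF rho alpha]
  \<comment> \<open>The nonlinearity conjugated by the weight, so that N(t, Y(t)) is the weighted
    form of the right-hand side at y. The two exponentials cancel in differences, which keeps the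
    Lipschitz constant c independent of \<rho>.\<close>
  define N where "N t v = exp (- \<rho> * t) *\<^sub>R ftilde f t (exp (\<rho> * t) *\<^sub>R v)" for t v
  define Y0 where "Y0 = weighted \<rho> (\<lambda>t. indicator {0<..} t *\<^sub>R y0)"
  have Nm: "case_prod N \<in> borel_measurable (borel \<Otimes>\<^sub>M borel)"
  proof -
    have "(\<lambda>p. (fst p, exp (\<rho> * fst p) *\<^sub>R snd p)) \<in> borel \<Otimes>\<^sub>M borel \<rightarrow>\<^sub>M borel \<Otimes>\<^sub>M (borel :: (complex ^ 'n) measure)"
      by measurable
    from measurable_compose[OF this meas]
    have "(\<lambda>p. exp (- \<rho> * fst p) *\<^sub>R ftilde f (fst p) (exp (\<rho> * fst p) *\<^sub>R snd p)) \<in> borel_measurable (borel \<Otimes>\<^sub>M borel)"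
      by (intro borel_measurable_scaleR) auto
    then show ?thesis by (simp add: N_def case_prod_beta')
  qed
  have Nlip: "norm (N t u - N t v) \<le> c * norm (u - v)" for t u v
  proof -
    have "norm (N t u - N t v) \<le> exp (- \<rho> * t) * (c * norm (exp (\<rho> * t) *\<^sub>R u - exp (\<rho> * t) *\<^sub>R v))"
      using mult_left_mono[OF lip[of t "exp (\<rho> * t) *\<^sub>R u" "exp (\<rho> * t) *\<^sub>R v"], of "exp (- \<rho> * t)"]
      by (simp add: N_def flip: scaleR_diff_right)
    also have "\<dots> = c * norm (u - v)"
      by (simp add: exp_minus flip: scaleR_diff_right)
    finally show ?thesis .
  qed
  have "(\<lambda>t. (t, 0 :: complex ^ 'n)) \<in> borel \<rightarrow>\<^sub>M borel \<Otimes>\<^sub>M borel" by measurable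
  from measurable_compose[OF this Nm]
  have "(\<lambda>t. N t 0) \<in> borel_measurable lborel" by simp
  moreover have "(\<lambda>t. N t 0) = weighted \<rho> (\<lambda>t. ftilde f t 0)"
    by (simp add: N_def weighted_def fun_eq_iff)
  ultimately have N0: "sq lborel (\<lambda>t. N t 0)"
    using f0 by (simp add: L2w_iff sq_lebesgue_iff)
  obtain Y where Y: "sq lborel Y" and NY: "sq lborel (\<lambda>t. N t (Y t))"
    and eq: "AE t in lborel. Y t = Y0 t + conv kern (\<lambda>s. N s (Y s)) t"
    by (rule volterra_fixpoint[OF ker(1) ker(3) Nm Nlip c _ N0 weighted_initial_sq[of y0, folded Y0_def]])
      (use contr ker(2) in auto)
  define y where "y t = exp (\<rho> * t) *\<^sub>R Y t" for t
  have wy: "weighted \<rho> y = Y"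
    by (simp add: weighted_def y_def fun_eq_iff flip: exp_add)
  have wf: "weighted \<rho> (\<lambda>t. ftilde f t (y t)) = (\<lambda>t. N t (Y t))"
    by (simp add: weighted_def y_def N_def fun_eq_iff)
  have wu: "weighted \<rho> (\<lambda>t. y t - indicator {0<..} t *\<^sub>R y0) = (\<lambda>t. Y t - Y0 t)"
    by (simp add: weighted_diff wy Y0_def)
  have leb: "sq lborel g \<Longrightarrow> sq lebesgue g" for g :: "real \<Rightarrow> complex ^ 'n"
    using sq_lebesgue_iff sqD_measurable by blast
  note sY0 = weighted_initial_sq[of y0, folded Y0_def]
  obtain W where W: "Frel (- 1) (\<lambda>t. N t (Y t)) W"
    by (rule Frel_exists[OF _ leb[OF NY]]) auto
  let ?G = "\<lambda>\<xi>. cscale (conv_symbol kern (- 1) \<xi>) (W \<xi>)"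
  have G: "Frel (- 1) (conv kern (\<lambda>t. N t (Y t))) ?G"
    by (rule Frel_conv[OF ker(1) ker(3) _ NY W]) simp
  have relU: "Frel (- 1) (\<lambda>t. Y t - Y0 t) ?G"
  proof (rule Frel_cong_AE[OF _ G])
    show "AE t in lebesgue. conv kern (\<lambda>t. N t (Y t)) t = Y t - Y0 t"
      using AE_completion[OF eq] by eventually_elim simp
    show "(\<lambda>t. Y t - Y0 t) \<in> borel_measurable lebesgue"
      by (rule sqD_measurable[OF leb[OF sq_diff[OF Y sY0]]])
    show "?G \<in> borel_measurable lebesgue" by (rule sqD_measurable[OF FrelD(2)[OF G]])
  qed simp_all
  have mG: "(\<lambda>\<xi>. cscale (multiplier \<xi>) (?G \<xi>)) = W"
    by (simp add: cscale_cscale multiplier_symbol)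
  have relW: "Frel 1 (\<lambda>\<xi>. cscale (multiplier \<xi>) (?G \<xi>)) (\<lambda>t. N t (Y t))"
    unfolding mG using Frel_inverse[OF _ W] by simp
  have "frac_ivp_solution \<alpha> f y0 \<rho> y"
    unfolding frac_ivp_solution_iff[OF multiplier_measurable] L2w_iff wy wu wf
    by (intro conjI exI[of _ ?G] leb[OF Y] leb[OF sq_diff[OF Y sY0]] relU relW)
  moreover have "AE t in lebesgue. t < 0 \<longrightarrow> y t = 0"
    \<comment> \<open>For t < 0 both terms of the Volterra equation vanish: the initial term by its
      indicator, the convolution because kernel and right-hand side are zero on the nonpositive
      half-line.\<close>
    using AE_completion[OF eq]
  proof eventually_elim
    case (elim t)
    show ?case
    proof
      assume t: "t < 0"
      then have "conv kern (\<lambda>s. N s (Y s)) t = 0"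
        by (intro conv_support ker(4)) (auto simp: N_def ftilde_def)
      with t elim show "y t = 0" by (simp add: y_def Y0_def weighted_def)
    qed
  qed
  ultimately show ?thesis by (rule that)
qed

end

text \<open>The set where t > 0 is open, hence Borel, so extending a function continuous there by 0
  is harmless even with a jump at t = 0. Joint measurability is what makes the composition with a
  measurable y measurable.\<close>

lemma borel_measurable_ftilde:
  fixes f :: "real \<Rightarrow> complex ^ 'n \<Rightarrow> complex ^ 'n"
  assumes "continuous_on ({0<..} \<times> UNIV) (\<lambda>(t, v). f t v)"
  shows "(\<lambda>(t, v). ftilde f t v) \<in> borel_measurable (borel \<Otimes>\<^sub>M borel)"
proof -
  have "open ({0<..} \<times> UNIV :: (real \<times> (complex ^ 'n)) set)"
    by (intro open_Times) auto
  then have "(\<lambda>p. indicator ({0<..} \<times> UNIV) p *\<^sub>R (\<lambda>(t, v). f t v) p) \<in> borel_measurable borel"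
    by (intro borel_measurable_continuous_on_indicator assms) auto
  moreover have "(\<lambda>p. indicator ({0<..} \<times> UNIV) p *\<^sub>R (\<lambda>(t, v). f t v) p) = (\<lambda>(t, v). ftilde f t v)"
    by (auto simp: fun_eq_iff ftilde_def indicator_def)
  ultimately show ?thesis by (simp add: borel_prod)
qed

theorem theorem6p2:
  fixes \<alpha> \<rho>0 c :: real
    and f :: "real \<Rightarrow> complex ^ 'n \<Rightarrow> complex ^ 'n"
    and y0 :: "complex ^ 'n"
  assumes "0 < \<alpha>" and "\<alpha> \<le> 1"
    and "continuous_on ({0<..} \<times> UNIV) (\<lambda>(t, v). f t v)"
    and "0 \<le> c"
    and "\<forall>t>0. \<forall>y1 y2. norm (f t y1 - f t y2) \<le> c * norm (y1 - y2)"
    and "L2w \<rho>0 (\<lambda>t. if 0 < t then f t 0 else 0)"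
  shows "\<exists>\<rho>1>0. \<forall>\<rho>\<ge>\<rho>1.
           \<exists>y. frac_ivp_solution \<alpha> f y0 \<rho> y
             \<and> (\<forall>z. frac_ivp_solution \<alpha> f y0 \<rho> z \<longrightarrow> (AE t in lebesgue. z t = y t))
             \<and> (AE t in lebesgue. t < 0 \<longrightarrow> y t = 0)"
proof -
  \<comment> \<open>The 1 guarantees positivity, \<rho>0 makes the inhomogeneity square-integrable
    in the heavier weight, and the last term forces \<rho>^\<alpha> \<ge> c + 1, so that c
    \<rho>^(-\<alpha>) < 1 strictly.\<close>
  define \<rho>1 where "\<rho>1 = max (max 1 \<rho>0) ((c + 1) powr (1 / \<alpha>))"
  have lip: "norm (ftilde f t u - ftilde f t v) \<le> c * norm (u - v)" for t u v
    using assms(4,5) by (simp add: ftilde_def)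
  have meas: "(\<lambda>(t, v). ftilde f t v) \<in> borel_measurable (borel \<Otimes>\<^sub>M borel)"
    by (rule borel_measurable_ftilde[OF assms(3)])
  have f0: "L2w \<rho>0 (\<lambda>t. ftilde f t 0)"
    using assms(6) by (simp add: ftilde_def)
  have "\<exists>y. frac_ivp_solution \<alpha> f y0 \<rho> y
             \<and> (\<forall>z. frac_ivp_solution \<alpha> f y0 \<rho> z \<longrightarrow> (AE t in lebesgue. z t = y t))
             \<and> (AE t in lebesgue. t < 0 \<longrightarrow> y t = 0)" if \<rho>: "\<rho> \<ge> \<rho>1" for \<rho>
  proof -
    have \<rho>0: "0 < \<rho>" "\<rho>0 \<le> \<rho>" using \<rho> by (auto simp: \<rho>1_def)
    have "c + 1 = ((c + 1) powr (1 / \<alpha>)) powr \<alpha>"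
      using assms by (simp add: powr_powr)
    also have "\<dots> \<le> \<rho> powr \<alpha>"
      using \<rho> assms by (intro powr_mono2) (auto simp: \<rho>1_def)
    finally have contr: "c * \<rho> powr (- \<alpha>) < 1"
      using \<rho>0 by (simp add: powr_minus field_simps)
    \<comment> \<open>For t > 0 the weight decreases as \<rho> grows. For t < 0 it would increase,
      but there the extended right-hand side is zero.\<close>
    have f0': "L2w \<rho> (\<lambda>t. ftilde f t 0)"
      unfolding L2w_iff
    proof (rule sq_bound(1)[OF f0[unfolded L2w_iff], where C=1])
      show "weighted \<rho> (\<lambda>t. ftilde f t 0) \<in> borel_measurable lebesgue"
        using sqD_measurable[OF f0[unfolded L2w_iff]] by (simp add: weighted_measurable_iff)
      have "norm (weighted \<rho> (\<lambda>t. ftilde f t 0) t) \<le> 1 * norm (weighted \<rho>0 (\<lambda>t. ftilde f t 0) t)" for t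
        using \<rho>0(2) by (cases "0 < t") (auto simp: weighted_def ftilde_def intro!: mult_right_mono)
      then show "AE t in lebesgue. norm (weighted \<rho> (\<lambda>t. ftilde f t 0) t) \<le> 1 * norm (weighted \<rho>0 (\<lambda>t. ftilde f t 0) t)"
        by simp
    qed
    obtain y where y: "frac_ivp_solution \<alpha> f y0 \<rho> y" "AE t in lebesgue. t < 0 \<longrightarrow> y t = 0"
      by (rule frac_ivp_exists[OF \<rho>0(1) assms(1,4) lip contr meas f0'])
    then show ?thesis
      using frac_ivp_unique[OF \<rho>0(1) assms(1,4) lip contr y(1)] by blast
  qed
  then show ?thesis by (intro exI[of _ \<rho>1]) (auto simp: \<rho>1_def)
qed

end
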